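(* Let $d,s\in\mathbb{N}$ and let $\theta=(\theta_r)_{r\in\mathbb{N}}$ be a monotonically decreasing sequence of real numbers with $\lim_{r\to\infty}\theta_r=0$. Let $(X(t))_{t\in\mathbb{R}^d}$, $X(t)=(X_1(t),\dots,X_s(t))$, be an $\mathbb{R}^s$-valued random field. Assume that $(X(t))_{t\in\mathbb{R}^d}$ is stationary, measurable, $BL(\theta)$-dependent and fulfills \[ \int_{\mathbb{R}^d} |\operatorname{Cov}(X_i(0), X_j(t))| \, dt < \infty, \quad i,j=1, \dots, s.\] Let $(W_n)_{n\in \mathbb{N}}$ be a VH-growing sequence of subsets of $\mathbb{R}^d$. Then \[\Big(\frac{ \int_{W_n} X_1(t)\, dt - \mathbb{E}[X_1(0)]\, \lambda_d(W_n)}{\sqrt{\lambda_d(W_n)}}, \dots, \frac{ \int_{W_n} X_s(t)\, dt - \mathbb{E}[X_s(0)]\, \lambda_d(W_n)}{\sqrt{\lambda_d(W_n)}} \Big)\to \mathcal{N}(0,\Sigma), \quad n\to\infty,\] in distribution, where $\Sigma$ is the $s\times s$ matrix with entries \[ \int_{\mathbb{R}^d} \operatorname{Cov}(X_i(0), X_j(t))\, dt , \quad i,j=1, \dots, s.\]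
   Context: $\lambda_d$ denotes Lebesgue measure on $\mathbb{R}^d$. VH-growing: a sequence $(W_n)_{n\in\mathbb{N}}$ of compact subsets of $\mathbb{R}^d$ (with $\lambda_d(W_n)>0$, so that the ratio below is defined) grows in Van Hove-sense (is VH-growing) if $\lim_{n\to\infty} \lambda_d((\operatorname{bd} W_n)+B^d)/\lambda_d(W_n)=0$, where $\operatorname{bd} W$ is the boundary of $W$, $A+B=\{a+b\mid a\in A, b\in B\}$, and $B^d$ is the closed Euclidean unit ball. Random fields: an $\mathbb{R}^s$-valued random field $(X(t))_{t\in\mathbb{R}^d}$ is a family of $\mathbb{R}^s$-valued random vectors on a common probability space; it is measurable if $(\omega,t)\mapsto X(t)(\omega)$ is jointly measurable, and stationary if its finite-dimensional distributions are invariant under translations of $\mathbb{R}^d$. The use of $\operatorname{Cov}(X_i(0),X_j(t))$ for all $t$ (including $t=0$, $i=j$) presupposes $\mathbb{E}[X_i(0)^2]<\infty$ for all $i$. $BL(\theta)$-dependence: for finite $I,J\subseteq\mathbb{R}^d$ put $\operatorname{dist}(I,J)=\min\{\|x-y\|_1: x\in I, y\in J\}$, with $\|\cdot\|_1$ the $\ell_1$-norm. For a Lipschitz function $f:\mathbb{R}^n\to\mathbb{R}$ let $\operatorname{Lip}(f)=\sup\{|f(x)-f(y)|/\|x-y\|_1 : x\neq y\}$. For $\Delta>0$ let $T(\Delta)=\{(j_1/\Delta,\dots,j_d/\Delta)\mid (j_1,\dots,j_d)\in\mathbb{Z}^d\}$. For a finite set $I=\{t_1,\dots,t_n\}$ with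 $n=\#I$ elements, $f(X_I):=f(X(t_1),\dots,X(t_n))$ (for a fixed enumeration of $I$). The field $(X(t))_{t\in\mathbb{R}^d}$ is $BL(\theta)$-dependent if for every $r\in\mathbb{N}$, every real $\Delta>1$, all disjoint finite sets $I,J\subseteq T(\Delta)$ with $\operatorname{dist}(I,J)\ge r$ and all bounded Lipschitz functions $f:\mathbb{R}^{s\cdot\#I}\to\mathbb{R}$, $g:\mathbb{R}^{s\cdot\#J}\to\mathbb{R}$, \[\operatorname{Cov}(f(X_I),g(X_J))\le \min\{\#I,\#J\}\operatorname{Lip}(f)\operatorname{Lip}(g)\,\Delta^d\,\theta_r.\] $\mathcal{N}(0,\Sigma)$ is the (possibly degenerate) centered multivariate normal distribution with covariance matrix $\Sigma$. *)

theory Defs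
  imports "HOL-Probability.Probability"
begin

definition cov :: "'a measure \<Rightarrow> ('a \<Rightarrow> real) \<Rightarrow> ('a \<Rightarrow> real) \<Rightarrow> real" where
  "cov M U V = (\<integral>\<omega>. (U \<omega> - (\<integral>\<omega>'. U \<omega>' \<partial>M)) * (V \<omega> - (\<integral>\<omega>'. V \<omega>' \<partial>M)) \<partial>M)"

definition VH_growing :: "(nat \<Rightarrow> (real ^ 'd) set) \<Rightarrow> bool" where
  "VH_growing W \<longleftrightarrow>
     (\<forall>n. compact (W n) \<and> measure lborel (W n) > 0) \<and>
     (\<lambda>n. measure lborel (frontier (W n) + cball 0 1) / measure lborel (W n)) \<longlonglongrightarrow> 0"

definition measurable_field :: "'a measure \<Rightarrow> (real ^ 'd \<Rightarrow> 'a \<Rightarrow> real ^ 's) \<Rightarrow> bool" where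
  "measurable_field M X \<longleftrightarrow> (\<lambda>(\<omega>, t). X t \<omega>) \<in> borel_measurable (M \<Otimes>\<^sub>M borel)"

definition stationary_field :: "'a measure \<Rightarrow> (real ^ 'd \<Rightarrow> 'a \<Rightarrow> real ^ 's) \<Rightarrow> bool" where
  "stationary_field M X \<longleftrightarrow>
     (\<forall>I h. finite I \<longrightarrow>
        distr M (Pi\<^sub>M I (\<lambda>_. borel)) (\<lambda>\<omega>. \<lambda>t\<in>I. X (t + h) \<omega>)
      = distr M (Pi\<^sub>M I (\<lambda>_. borel)) (\<lambda>\<omega>. \<lambda>t\<in>I. X t \<omega>))"

definition l1_norm :: "real ^ 'n \<Rightarrow> real" where
  "l1_norm x = (\<Sum>i\<in>UNIV. \<bar>x $ i\<bar>)"

text \<open>Minimal \<open>\<ell>\<^sub>1\<close>-distance; used for finite nonempty sets only.\<close>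

definition l1_setdist :: "(real ^ 'd) set \<Rightarrow> (real ^ 'd) set \<Rightarrow> real" where
  "l1_setdist I J = Min {l1_norm (x - y) | x y. x \<in> I \<and> y \<in> J}"

definition grid :: "real \<Rightarrow> (real ^ 'd) set" where
  "grid \<Delta> = {t. \<exists>j :: 'd \<Rightarrow> int. t = (\<chi> k. of_int (j k) / \<Delta>)}"

text \<open>
  For a finite index set \<open>I\<close> with \<open>n\<close> elements, \<open>\<real>\<close>-vectors of length \<open>s n\<close> are represented as
  extensional functions from \<open>I\<close> to \<^typ>\<open>real ^ 's\<close>, so that no enumeration of \<open>I\<close> has to be
  chosen. Functions of such vectors matter only on \<open>I \<rightarrow>\<^sub>E UNIV\<close>.
\<close>

definition l1_dist_on :: "'t set \<Rightarrow> ('t \<Rightarrow> real ^ 's) \<Rightarrow> ('t \<Rightarrow> real ^ 's) \<Rightarrow> real" where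
  "l1_dist_on I x y = (\<Sum>t\<in>I. l1_norm (x t - y t))"

definition bounded_lipschitz :: "'t set \<Rightarrow> (('t \<Rightarrow> real ^ 's) \<Rightarrow> real) \<Rightarrow> bool" where
  "bounded_lipschitz I f \<longleftrightarrow>
     bounded (f ` (I \<rightarrow>\<^sub>E UNIV)) \<and>
     (\<exists>L. \<forall>x \<in> I \<rightarrow>\<^sub>E UNIV. \<forall>y \<in> I \<rightarrow>\<^sub>E UNIV. \<bar>f x - f y\<bar> \<le> L * l1_dist_on I x y)"

definition Lip :: "'t set \<Rightarrow> (('t \<Rightarrow> real ^ 's) \<Rightarrow> real) \<Rightarrow> real" where
  "Lip I f = Sup {\<bar>f x - f y\<bar> / l1_dist_on I x y | x y.
                    x \<in> I \<rightarrow>\<^sub>E UNIV \<and> y \<in> I \<rightarrow>\<^sub>E UNIV \<and> x \<noteq> y}"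

text \<open>
  The sequence \<open>\<theta>\<close> is indexed by the positive integers; \<open>\<theta> 0\<close> is irrelevant. Empty \<open>I\<close> or \<open>J\<close>
  would contribute only the trivial inequality \<open>0 \<le> 0\<close> and are left out because their distance
  is undefined.
\<close>

definition BL_dependent ::
    "'a measure \<Rightarrow> (nat \<Rightarrow> real) \<Rightarrow> (real ^ 'd \<Rightarrow> 'a \<Rightarrow> real ^ 's) \<Rightarrow> bool" where
  "BL_dependent M \<theta> X \<longleftrightarrow>
     (\<forall>r \<Delta> I J f g.
        1 \<le> r \<longrightarrow> 1 < \<Delta> \<longrightarrow>
        finite I \<longrightarrow> finite J \<longrightarrow> I \<noteq> {} \<longrightarrow> J \<noteq> {} \<longrightarrow>
        I \<subseteq> grid \<Delta> \<longrightarrow> J \<subseteq> grid \<Delta> \<longrightarrow> I \<inter> J = {} \<longrightarrow>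
        real r \<le> l1_setdist I J \<longrightarrow>
        bounded_lipschitz I f \<longrightarrow> bounded_lipschitz J g \<longrightarrow>
        cov M (\<lambda>\<omega>. f (\<lambda>t\<in>I. X t \<omega>)) (\<lambda>\<omega>. g (\<lambda>t\<in>J. X t \<omega>))
          \<le> real (min (card I) (card J)) * Lip I f * Lip J g * \<Delta> ^ CARD('d) * \<theta> r)"

text \<open>
  The law of \<open>A Z\<close> with \<open>A A\<^sup>T = \<Sigma>\<close> and \<open>Z\<close> a vector of independent standard normal variables;
  a singular \<open>\<Sigma>\<close> is allowed. That such an \<open>A\<close> exists says that \<open>\<Sigma>\<close> is symmetric and
  positive semidefinite; the law does not depend on the choice of \<open>A\<close>.
\<close>

definition is_centered_normal :: "real ^ 's ^ 's \<Rightarrow> (real ^ 's) measure \<Rightarrow> bool" where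
  "is_centered_normal \<Sigma> N \<longleftrightarrow>
     (\<exists>A :: real ^ 's ^ 's.
        A ** transpose A = \<Sigma> \<and>
        N = distr (Pi\<^sub>M UNIV (\<lambda>_ :: 's. density lborel std_normal_density)) borel
              (\<lambda>z. A *v (\<chi> i. z i)))"

text \<open>
  Convergence in distribution of random vectors to the law \<open>N\<close>, tested against bounded continuous
  functions; the library's \<open>weak_conv_m\<close> covers the real line only.
\<close>

definition conv_in_distribution ::
    "'a measure \<Rightarrow> (nat \<Rightarrow> 'a \<Rightarrow> real ^ 's) \<Rightarrow> (real ^ 's) measure \<Rightarrow> bool" where
  "conv_in_distribution M Y N \<longleftrightarrow>
     (\<forall>n. Y n \<in> borel_measurable M) \<and>
     (\<forall>f :: real ^ 's \<Rightarrow> real. continuous_on UNIV f \<longrightarrow> bounded (range f) \<longrightarrow>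
        (\<lambda>n. \<integral>\<omega>. f (Y n \<omega>) \<partial>M) \<longlonglongrightarrow> (\<integral>x. f x \<partial>N))"

end

theory Submission
  imports Defs
begin

text \<open>
  Fix \<open>u\<close> and let \<open>\<xi>(t) = u \<bullet> (X(t) - \<mu>)\<close> with covariance function \<open>c\<close>. The normalized integrals have
  bounded second moments, hence are tight, so by the continuity theorem on \<open>\<real>\<^sup>s\<close>
  (\<open>levy_continuity_vec\<close>) it suffices to show
  \<open>E exp(i \<integral>\<^bsub>W\<^esub> \<xi> / \<surd>\<lambda>(W)) \<rightarrow> exp(- \<integral>c / 2)\<close> for every \<open>u\<close>. A factorization \<open>\<Sigma> = A A\<^sup>T\<close>, which
  makes the right-hand side the characteristic function of a law, exists because \<open>u \<bullet> \<Sigma> u = \<integral>c\<close> is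
  a limit of variances.

  The scalar limit is Bernstein's method with blocks of a \<^emph>\<open>fixed\<close> size. The window \<open>W\<^sub>n\<close> is tiled
  by cubes of side \<open>p + q\<close>, and each tile inside \<open>W\<^sub>n\<close> keeps only a cube of side \<open>p\<close>, so that
  different blocks are at distance at least \<open>q\<close>. Three approximations are made.

  \<^item> Replacing the integral over \<open>W\<^sub>n\<close> by the sum of the block integrals discards a set whose share of
    \<open>\<lambda>(W\<^sub>n)\<close> tends to \<open>1 - (p/(p+q))\<^sup>d\<close>: the part near the boundary is negligible by the Van Hove
    condition (\<open>VH_growing_tiles\<close>), the corridors give the rest. Integrals of \<open>\<xi>\<close> over a set have a
    second moment of at most \<open>\<parallel>c\<parallel>\<^sub>1\<close> times its measure (\<open>smear_second_moment_le\<close>).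

  \<^item> Treating the blocks as independent costs at most \<open>const \<cdot> p\<^sup>d \<theta>\<^sub>q / \<lambda>(W\<^sub>n)\<close> per block
    (\<open>block_mixing\<close>). The decisive feature of the dependence condition is the factor
    \<open>min{#I, #J}\<close>: a single block is decoupled from all remaining ones at the price of its own volume.
    There are at most \<open>\<lambda>(W\<^sub>n)/(p+q)\<^sup>d\<close> blocks, so the total error is at most \<open>const \<cdot> \<theta>\<^sub>q\<close>, uniformly
    in \<open>n\<close> and \<open>p\<close>, and \<open>\<theta>\<^sub>q \<rightarrow> 0\<close> makes it small.

  \<^item> For fixed \<open>p\<close> and \<open>q\<close> the product of the block characteristic functions is a power
    \<open>\<phi>(1/\<surd>\<lambda>(W\<^sub>n))\<^sup>N\<close> with \<open>N / \<lambda>(W\<^sub>n) \<rightarrow> (p+q)\<^bsup>-d\<^esup>\<close>, and the classical second order expansion of \<open>\<phi>\<close>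
    (\<open>char_power_limit\<close>) gives \<open>exp(- V\<^sub>p / (2 (p+q)\<^sup>d))\<close>, where \<open>V\<^sub>p\<close> is the variance of a block.

  Now let \<open>n \<rightarrow> \<infinity>\<close>, then \<open>p \<rightarrow> \<infinity>\<close>, where \<open>V\<^sub>p / p\<^sup>d \<rightarrow> \<integral>c\<close> (\<open>smear_cube_variance_limit\<close>), and at last
  \<open>q \<rightarrow> \<infinity>\<close>.

  The dependence condition speaks about finite subsets of grids, whereas blocks are integrals. The
  passage uses Riemann sums on the grid of mesh \<open>1/m\<close>. A block of side \<open>p\<close> has \<open>(pm)\<^sup>d\<close> grid points,
  the Lipschitz constants of functions of the two Riemann sums are of order \<open>m\<^bsup>-d\<^esup>\<close> each, and the
  condition has a factor \<open>m\<^sup>d\<close>; the powers of \<open>m\<close> cancel. Riemann sums converge to the integrals in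
  \<open>L\<^sup>1\<close> because \<open>E\<bar>\<xi>(h) - \<xi>(0)\<bar> \<rightarrow> 0\<close> as \<open>h \<rightarrow> 0\<close> (\<open>increment_tendsto_0\<close>), and this is where joint
  measurability is used: by stationarity the increment may be averaged over a cube, and
  almost every path, being locally integrable, is continuous in the \<open>L\<^sup>1\<close>-mean under translation.
\<close>

section \<open>Symmetric positive semidefinite matrices and normal laws\<close>

text \<open>
  Cholesky's elimination, by induction on the set \<open>K\<close> of the indices of rows that may be nonzero.
  If the pivot \<open>S\<^sub>k\<^sub>k\<close> vanishes, positivity forces the whole row \<open>k\<close> to vanish. Otherwise
  \<open>S - v v\<^sup>T\<close> with \<open>v = S e\<^sub>k / \<surd>S\<^sub>k\<^sub>k\<close> has a zero row \<open>k\<close>, and it stays positive semidefinite because its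
  quadratic form at \<open>x\<close> is that of \<open>S\<close> at the point of \<open>x + \<real> e\<^sub>k\<close> where the latter is minimal.
\<close>

lemma psd_matrix_factor_aux:
  fixes S :: "real ^ 'n ^ 'n"
  assumes "finite K" "transpose S = S" "\<And>x. 0 \<le> x \<bullet> (S *v x)"
    and "\<And>i j. i \<notin> K \<Longrightarrow> S $ i $ j = 0"
  shows "\<exists>A :: real ^ 'n ^ 'n. A ** transpose A = S \<and> (\<forall>i k. k \<notin> K \<longrightarrow> A $ i $ k = 0)"
  using assms
proof (induction K arbitrary: S rule: finite_induct)
  case empty
  then have "S = 0" by (simp add: vec_eq_iff)
  then show ?case by (intro exI[of _ 0]) (simp add: transpose_def matrix_matrix_mult_def vec_eq_iff)
next
  case (insert k K)
  note psd = insert.prems(2) and supp = insert.prems(3)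
  have sym: "S $ i $ j = S $ j $ i" for i j
    using insert.prems(1) by (metis transpose_def vec_lambda_beta)
  have symB: "x \<bullet> (S *v y) = y \<bullet> (S *v x)" for x y
    by (metis dot_lmul_matrix inner_commute insert.prems(1) transpose_matrix_vector)
  have entry: "axis i 1 \<bullet> (S *v axis j 1) = S $ i $ j" for i j
    by (simp add: inner_axis' matrix_vector_mult_basis column_def)
  have quad: "(x + t *\<^sub>R axis k 1) \<bullet> (S *v (x + t *\<^sub>R axis k 1))
      = x \<bullet> (S *v x) + 2 * t * (x \<bullet> (S *v axis k 1)) + t\<^sup>2 * S $ k $ k" for x t
    by (simp add: matrix_vector_right_distrib inner_add_left inner_add_right
        matrix_vector_mult_scaleR symB[of "axis k 1" x] entry power2_eq_square algebra_simps)
  have diag: "0 \<le> S $ k $ k"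
    using psd[of "axis k 1"] by (simp add: entry)
  show ?case
  proof (cases "S $ k $ k = 0")
    case True
    have "S $ k $ j = 0" for j
    proof (rule ccontr)
      assume nz: "S $ k $ j \<noteq> 0"
      \<comment> \<open>along \<open>e\<^sub>j + t e\<^sub>k\<close> the form is affine in \<open>t\<close>; it takes the value \<open>-1\<close> at this \<open>t\<close>\<close>
      let ?t = "- (S $ j $ j + 1) / (2 * S $ k $ j)"
      have "0 \<le> S $ j $ j + 2 * ?t * S $ k $ j"
        using psd[of "axis j 1 + ?t *\<^sub>R axis k 1"] True sym[of j k]
        unfolding quad by (simp add: entry)
      moreover have "2 * ?t * S $ k $ j = - (S $ j $ j + 1)"
        using nz by (simp add: field_simps)
      ultimately show False by simp
    qed
    then have "S $ i $ j = 0" if "i \<notin> K" for i j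
      using supp[of i j] that by (cases "i = k") auto
    from insert.IH[OF insert.prems(1) psd this] show ?thesis by blast
  next
    case False
    with diag have pos: "0 < S $ k $ k" by simp
    define v :: "real ^ 'n" where "v = (\<chi> i. S $ i $ k / sqrt (S $ k $ k))"
    define V :: "real ^ 'n ^ 'n" where "V = (\<chi> i j. v $ i * v $ j)"
    have vk: "v = (1 / sqrt (S $ k $ k)) *\<^sub>R (S *v axis k 1)"
      by (simp add: v_def vec_eq_iff matrix_vector_mult_basis column_def)
    have Vx: "V *v x = (v \<bullet> x) *\<^sub>R v" for x
      by (simp add: V_def vec_eq_iff matrix_vector_mult_def inner_vec_def sum_distrib_left
          sum_distrib_right mult_ac)
    have "transpose (S - V) = S - V"
      by (simp add: transpose_def vec_eq_iff V_def sym mult.commute)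
    moreover have "0 \<le> x \<bullet> ((S - V) *v x)" for x
    proof -
      let ?b = "x \<bullet> (S *v axis k 1)"
      have "x \<bullet> ((S - V) *v x) = x \<bullet> (S *v x) - (v \<bullet> x)\<^sup>2"
        by (simp add: matrix_vector_mult_diff_rdistrib inner_diff_right Vx inner_commute
            power2_eq_square)
      also have "(v \<bullet> x)\<^sup>2 = ?b\<^sup>2 / S $ k $ k"
        using pos by (simp add: vk inner_commute power_divide)
      also have "x \<bullet> (S *v x) - ?b\<^sup>2 / S $ k $ k
          = (x + (- ?b / S $ k $ k) *\<^sub>R axis k 1) \<bullet> (S *v (x + (- ?b / S $ k $ k) *\<^sub>R axis k 1))"
        unfolding quad using pos by (simp add: field_simps power2_eq_square)
      finally show ?thesis using psd by metis
    qed
    moreover have "(S - V) $ i $ j = 0" if "i \<notin> K" for i j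
    proof (cases "i = k")
      case True
      then show ?thesis using pos sym[of k j] by (simp add: V_def v_def)
    next
      case False
      then show ?thesis using supp[of i] that by (simp add: V_def v_def)
    qed
    ultimately obtain A :: "real ^ 'n ^ 'n"
      where A: "A ** transpose A = S - V" "\<And>i l. l \<notin> K \<Longrightarrow> A $ i $ l = 0"
      using insert.IH[of "S - V"] by metis
    define A' :: "real ^ 'n ^ 'n" where "A' = (\<chi> i l. if l = k then v $ i else A $ i $ l)"
    have "(A' ** transpose A') $ i $ j = S $ i $ j" for i j
    proof -
      have "(A' ** transpose A') $ i $ j = (\<Sum>l\<in>UNIV. A' $ i $ l * A' $ j $ l)"
        by (simp add: matrix_matrix_mult_def transpose_def)
      also have "\<dots> = (\<Sum>l\<in>UNIV. A $ i $ l * A $ j $ l + (if l = k then v $ i * v $ j else 0))"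
        using A(2)[OF insert.hyps(2)] by (intro sum.cong refl) (simp add: A'_def)
      also have "\<dots> = (A ** transpose A) $ i $ j + V $ i $ j"
        by (simp add: sum.distrib matrix_matrix_mult_def transpose_def V_def)
      finally show ?thesis by (simp add: A(1))
    qed
    then have "A' ** transpose A' = S" by (simp add: vec_eq_iff)
    moreover have "A' $ i $ l = 0" if "l \<notin> insert k K" for i l
      using that A(2) by (simp add: A'_def)
    ultimately show ?thesis by blast
  qed
qed

lemma psd_matrix_factor:
  fixes S :: "real ^ 'n ^ 'n"
  assumes "transpose S = S" "\<And>x. 0 \<le> x \<bullet> (S *v x)"
  obtains A :: "real ^ 'n ^ 'n" where "A ** transpose A = S"
  using psd_matrix_factor_aux[of UNIV S] assms by auto

text \<open>
  The exponent is \<open>w \<bullet> z\<close> with \<open>w = A\<^sup>T u\<close>, so the integral over the product measure factors into the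
  one-dimensional characteristic functions, and \<open>w \<bullet> w = u \<bullet> (A A\<^sup>T) u\<close>.
\<close>

lemma char_linear_image_std_normal:
  fixes A :: "real ^ 's ^ 's" and u :: "real ^ 's"
  shows "(\<integral>z. iexp (u \<bullet> (A *v (\<chi> i. z i)))
            \<partial>Pi\<^sub>M UNIV (\<lambda>_ :: 's. density lborel std_normal_density))
          = exp (- complex_of_real (u \<bullet> ((A ** transpose A) *v u)) / 2)"
proof -
  let ?N = "std_normal_distribution"
  interpret N: prob_space ?N
    using prob_space_normal_density[of 1 0] by simp
  interpret product_sigma_finite "\<lambda>_ :: 's. ?N"
    by (simp add: product_sigma_finite_def N.sigma_finite_measure_axioms)
  define w where "w = transpose A *v u"
  have "u \<bullet> (A *v (\<chi> i. z i)) = (\<Sum>i\<in>UNIV. w $ i * z i)" for z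
  proof -
    have "u \<bullet> (A *v (\<chi> i. z i)) = w \<bullet> (\<chi> i. z i)"
      unfolding w_def by (simp add: dot_lmul_matrix)
    then show ?thesis by (simp add: inner_vec_def)
  qed
  then have "(\<integral>z. iexp (u \<bullet> (A *v (\<chi> i. z i))) \<partial>Pi\<^sub>M UNIV (\<lambda>_. ?N))
      = (\<integral>z. (\<Prod>i\<in>UNIV. iexp (w $ i * z i)) \<partial>Pi\<^sub>M UNIV (\<lambda>_. ?N))"
    by (simp add: exp_sum sum_distrib_left)
  also have "\<dots> = (\<Prod>i\<in>UNIV. \<integral>x. iexp (w $ i * x) \<partial>?N)"
    by (intro product_integral_prod) (auto intro!: N.integrable_const_bound[where B=1])
  also have "\<dots> = (\<Prod>i\<in>UNIV. complex_of_real (exp (- ((w $ i)\<^sup>2) / 2)))"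
    using char_std_normal_distribution by (simp add: char_def fun_eq_iff)
  also have "\<dots> = complex_of_real (exp (\<Sum>i\<in>UNIV. - ((w $ i)\<^sup>2) / 2))"
    by (simp add: exp_sum)
  also have "(\<Sum>i\<in>UNIV. - ((w $ i)\<^sup>2) / 2) = - (w \<bullet> w) / 2"
    by (simp add: inner_vec_def power2_eq_square sum_negf sum_divide_distrib)
  also have "w \<bullet> w = u \<bullet> ((A ** transpose A) *v u)"
    unfolding w_def by (simp add: matrix_vector_mul_assoc[symmetric] dot_lmul_matrix)
  finally show ?thesis by (simp add: exp_of_real[symmetric])
qed

section \<open>Characteristic functions and convergence in distribution on \<open>\<real>\<^sup>s\<close>\<close>

text \<open>
  Trigonometric polynomials with arbitrary real frequencies. Convergence of characteristic functions
  is convergence of the expectations of exactly these functions.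
\<close>

inductive trig_poly :: "(real ^ 's \<Rightarrow> complex) \<Rightarrow> bool" where
  monom: "trig_poly (\<lambda>x. c * iexp (u \<bullet> x))"
| add: "trig_poly f \<Longrightarrow> trig_poly g \<Longrightarrow> trig_poly (\<lambda>x. f x + g x)"

lemma trig_poly_const: "trig_poly (\<lambda>x. c)"
  using trig_poly.monom[of c 0] by simp

lemma trig_poly_sum:
  "finite I \<Longrightarrow> (\<And>i. i \<in> I \<Longrightarrow> trig_poly (f i)) \<Longrightarrow> trig_poly (\<lambda>x. \<Sum>i\<in>I. f i x)"
  by (induction I rule: finite_induct) (auto intro: trig_poly.add trig_poly_const)

lemma trig_poly_mult:
  assumes "trig_poly f" "trig_poly g"
  shows "trig_poly (\<lambda>x. f x * g x)"
  using assms(1)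
proof induction
  case (monom c u)
  show ?case using assms(2)
  proof induction
    case (monom d v)
    have eq: "c * iexp (u \<bullet> x) * (d * iexp (v \<bullet> x)) = (c * d) * iexp ((u + v) \<bullet> x)" for x
      by (simp add: inner_add_left distrib_left exp_add)
    show ?case unfolding eq by (rule trig_poly.monom)
  next
    case (add f g)
    from trig_poly.add[OF add.IH] show ?case by (simp add: distrib_left)
  qed
next
  case (add f g)
  from trig_poly.add[OF add.IH] show ?case by (simp add: distrib_right)
qed

lemma trig_poly_cos_sin:
  fixes i :: "'d :: finite"
  shows "trig_poly (\<lambda>x. complex_of_real (cos (a * x $ i)))" (is ?c)
    and "trig_poly (\<lambda>x. complex_of_real (sin (a * x $ i)))" (is ?s)
proof -
  have ax: "axis i b \<bullet> x = b * x $ i" for b and x :: "real ^ 'd"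
    by (simp add: inner_axis')
  have "trig_poly (\<lambda>x. 1/2 * iexp (axis i a \<bullet> x) + 1/2 * iexp (axis i (- a) \<bullet> x))"
    by (intro trig_poly.intros)
  then show ?c
    unfolding ax by (simp add: cos_of_real[symmetric] cos_exp_eq minus_mult_left[symmetric] add_divide_distrib)
  have "trig_poly (\<lambda>x. (1/(2*\<i>)) * iexp (axis i a \<bullet> x) + (-1/(2*\<i>)) * iexp (axis i (- a) \<bullet> x))"
    by (intro trig_poly.intros)
  moreover have "complex_of_real (sin y) = (1/(2*\<i>)) * iexp y + (-1/(2*\<i>)) * iexp (-y)" for y
    by (simp add: sin_of_real[symmetric] sin_exp_eq field_simps)
  ultimately show ?s
    unfolding ax by simp
qed

lemma trig_poly_continuous: "trig_poly f \<Longrightarrow> continuous_on UNIV f"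
  by (induction rule: trig_poly.induct) (auto intro!: continuous_intros)

lemma trig_poly_bounded: "trig_poly f \<Longrightarrow> \<exists>B. \<forall>x. norm (f x) \<le> B"
proof (induction rule: trig_poly.induct)
  case (monom c u)
  then show ?case by (intro exI[of _ "norm c"]) (simp add: norm_mult)
next
  case (add f g)
  then obtain B C where "\<forall>x. norm (f x) \<le> B" "\<forall>x. norm (g x) \<le> C" by blast
  then show ?case by (intro exI[of _ "B + C"]) (auto intro: norm_triangle_le add_mono)
qed

lemma trig_poly_measurable [measurable]: "trig_poly f \<Longrightarrow> f \<in> borel_measurable borel"
  by (intro borel_measurable_continuous_onI trig_poly_continuous)

text \<open>
  The quotient map of \<open>\<real>\<^sup>s\<close> onto the torus of period \<open>2 L\<close>, embedded into Euclidean space. Polynomials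
  on the image pull back to trigonometric polynomials.
\<close>

definition torus_map :: "real \<Rightarrow> real ^ 's \<Rightarrow> (real ^ 's) \<times> (real ^ 's)" where
  "torus_map L x = ((\<chi> i. cos (pi / L * x $ i)), (\<chi> i. sin (pi / L * x $ i)))"

lemma torus_map_continuous: "continuous_on S (torus_map L)"
  unfolding torus_map_def by (intro continuous_intros)

lemma trig_poly_torus:
  assumes "real_polynomial_function g"
  shows "trig_poly (\<lambda>x. complex_of_real (g (torus_map L x)))"
  using assms
proof (induction rule: real_polynomial_function.induct)
  case (linear f)
  \<comment> \<open>the Riesz representative of the linear form \<open>f\<close>\<close>
  define w where "w = adjoint f 1"
  have w: "f z = w \<bullet> z" for z
    using adjoint_works[OF bounded_linear.linear[OF linear], of z 1]
    by (simp add: w_def inner_commute)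
  have "complex_of_real (f (torus_map L x)) =
     (\<Sum>i\<in>UNIV. complex_of_real (fst w $ i) * of_real (cos (pi / L * x $ i)))
      + (\<Sum>i\<in>UNIV. complex_of_real (snd w $ i) * of_real (sin (pi / L * x $ i)))" for x
    by (simp add: w torus_map_def inner_prod_def inner_vec_def)
  then show ?case
    by (simp only:) (intro trig_poly.add trig_poly_sum trig_poly_mult trig_poly_const
        trig_poly_cos_sin finite)
qed (auto intro: trig_poly.add trig_poly_mult trig_poly_const)

lemma torus_map_representative:
  fixes y :: "real ^ 's"
  assumes "0 < L"
  obtains x where "x \<in> cbox (\<chi> i. - L) (\<chi> i. L)" "torus_map L x = torus_map L y"
proof -
  define k where "k i = \<lfloor>(y $ i + L) / (2 * L)\<rfloor>" for i
  define x :: "real ^ 's" where "x = (\<chi> i. y $ i - 2 * L * k i)"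
  have "- L \<le> x $ i \<and> x $ i \<le> L" for i
  proof -
    have "k i \<le> (y $ i + L) / (2 * L)" "(y $ i + L) / (2 * L) < k i + 1"
      unfolding k_def by linarith+
    then show ?thesis using assms by (simp add: x_def field_simps)
  qed
  then have "x \<in> cbox (\<chi> i. - L) (\<chi> i. L)" by (simp add: mem_box_cart)
  moreover have shift: "pi / L * x $ i = pi / L * y $ i - 2 * pi * k i" for i
    using assms by (simp add: x_def field_simps)
  have "cos (pi / L * x $ i) = cos (pi / L * y $ i)" "sin (pi / L * x $ i) = sin (pi / L * y $ i)" for i
    by (simp_all only: shift cos_diff sin_diff cos_int_2pin sin_int_2pin)
  then have "torus_map L x = torus_map L y"
    by (simp add: torus_map_def)
  ultimately show thesis by (rule that)
qed

text \<open>
  Two distinct points of the cube that the torus identifies have a coordinate \<open>\<plusminus>L\<close>, thus lie outside the open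
  ball of radius \<open>L\<close>. A function that vanishes outside this ball therefore descends to the torus.
\<close>

lemma torus_map_inj:
  fixes x y :: "real ^ 's"
  assumes "0 < L" "x \<in> cbox (\<chi> i. - L) (\<chi> i. L)" "y \<in> cbox (\<chi> i. - L) (\<chi> i. L)"
    and eq: "torus_map L x = torus_map L y" and "x \<noteq> y"
  shows "L \<le> norm x"
proof -
  obtain i where i: "x $ i \<noteq> y $ i" using \<open>x \<noteq> y\<close> by (auto simp: vec_eq_iff)
  have b: "\<bar>x $ i\<bar> \<le> L" "\<bar>y $ i\<bar> \<le> L" using assms(2,3) by (auto simp: mem_box_cart abs_le_iff minus_le_iff)
  have "cos (pi / L * x $ i) = cos (pi / L * y $ i)" "sin (pi / L * x $ i) = sin (pi / L * y $ i)"
    using eq by (auto simp: torus_map_def vec_eq_iff)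
  then obtain n :: int where "pi / L * x $ i = pi / L * y $ i + 2 * of_int n * pi"
    using sin_cos_eq_iff[of "pi / L * x $ i" "pi / L * y $ i"] by (auto simp: mult_ac)
  then have "pi * (x $ i - y $ i) = pi * (2 * L * n)" using assms(1) by (simp add: field_simps)
  then have n: "x $ i - y $ i = 2 * L * n" unfolding mult_left_cancel[OF pi_neq_zero] .
  have "n \<noteq> 0" using n i by auto
  then have "1 \<le> \<bar>real_of_int n\<bar>" by linarith
  then have "2 * L \<le> \<bar>x $ i - y $ i\<bar>" using n assms(1) by (simp add: abs_mult)
  then have "L \<le> \<bar>x $ i\<bar>" using b by linarith
  also have "\<dots> \<le> norm x" by (rule component_le_norm_cart)
  finally show ?thesis .
qed

text \<open>
  The point of the torus is the bound for \<open>T\<close> on the whole space, which makes the error outside the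
  ball controllable by tightness. The function is cut off to the ball of radius \<open>L = R + 1\<close>, pushed down
  to the torus and approximated there by Stone--Weierstrass; since every point has a representative in
  the cube, a bound on the cube is a bound everywhere.
\<close>

lemma trig_poly_approximation:
  fixes f :: "real ^ 's \<Rightarrow> real"
  assumes f: "continuous_on UNIV f" "\<And>x. \<bar>f x\<bar> \<le> B" and "0 < e" "0 < R"
  obtains T where "trig_poly (\<lambda>x. complex_of_real (T x))"
    "\<And>x. norm x \<le> R \<Longrightarrow> \<bar>f x - T x\<bar> \<le> e" "\<And>x. \<bar>T x\<bar> \<le> B + e"
proof -
  define L where "L = R + 1"
  have L: "0 < L" using assms by (simp add: L_def)
  define f0 where "f0 x = f x * max 0 (min 1 (L - norm x))" for x
  let ?C = "cbox (\<chi> i. - L) (\<chi> i. L) :: (real ^ 's) set"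
  let ?K = "torus_map L ` ?C"
  have f0c: "continuous_on UNIV f0"
    unfolding f0_def by (intro continuous_intros f(1))
  have f0b: "\<bar>f0 x\<bar> \<le> B" for x
  proof -
    have "\<bar>f0 x\<bar> \<le> \<bar>f x\<bar> * 1"
      unfolding f0_def abs_mult by (intro mult_left_mono) auto
    with f(2)[of x] show ?thesis by simp
  qed
  have f0R: "f0 x = f x" if "norm x \<le> R" for x
    using that by (simp add: f0_def L_def)
  have f0L: "f0 x = 0" if "L \<le> norm x" for x
    using that by (simp add: f0_def)
  have inj: "f0 x = f0 y" if "x \<in> ?C" "y \<in> ?C" "torus_map L x = torus_map L y" for x y
    using torus_map_inj[OF L that] torus_map_inj[OF L that(2,1) that(3)[symmetric]] f0L
    by (cases "x = y") auto
  define F where "F z = f0 (SOME x. x \<in> ?C \<and> torus_map L x = z)" for z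
  have F: "F (torus_map L x) = f0 x" if "x \<in> ?C" for x
  proof -
    have "\<exists>x'. x' \<in> ?C \<and> torus_map L x' = torus_map L x" using that by blast
    from someI_ex[OF this] show ?thesis
      unfolding F_def using inj that by blast
  qed
  have K: "compact ?K"
    by (intro compact_continuous_image torus_map_continuous compact_cbox)
  \<comment> \<open>preimages of closed sets under \<open>F\<close> are images of compact sets, hence closed\<close>
  have "continuous_on ?K F"
    unfolding continuous_on_closed_vimage[OF compact_imp_closed[OF K]]
  proof (intro allI impI)
    fix S :: "real set" assume S: "closed S"
    have "F -` S \<inter> ?K = torus_map L ` (?C \<inter> f0 -` S)"
      using F by (force simp: image_iff)
    moreover have "compact (?C \<inter> f0 -` S)"
      by (intro compact_Int_closed compact_cbox closed_vimage S f0c)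
    ultimately show "closed (F -` S \<inter> ?K)"
      by (metis compact_continuous_image torus_map_continuous compact_imp_closed)
  qed
  then obtain g where g: "real_polynomial_function g" "\<And>z. z \<in> ?K \<Longrightarrow> \<bar>F z - g z\<bar> < e"
    using Stone_Weierstrass_real_polynomial_function[OF K _ \<open>0 < e\<close>] by blast
  define T where "T x = g (torus_map L x)" for x
  have "trig_poly (\<lambda>x. complex_of_real (T x))"
    unfolding T_def by (rule trig_poly_torus[OF g(1)])
  moreover have "\<bar>f x - T x\<bar> \<le> e" if "norm x \<le> R" for x
  proof -
    have "\<bar>x $ i\<bar> \<le> L" for i
      using component_le_norm_cart[of x i] that by (simp add: L_def)
    then have "x \<in> ?C" by (simp add: mem_box_cart abs_le_iff minus_le_iff)
    then show ?thesis using F[of x] g(2)[of "torus_map L x"] f0R[OF that] by (simp add: T_def)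
  qed
  moreover have "\<bar>T y\<bar> \<le> B + e" for y
  proof -
    obtain x where x: "x \<in> ?C" "torus_map L x = torus_map L y"
      by (rule torus_map_representative[OF L])
    have "\<bar>f0 x - T y\<bar> \<le> e"
      using F[OF x(1)] g(2)[OF imageI[OF x(1)]] x(2) by (simp add: T_def)
    with f0b[of x] show ?thesis by linarith
  qed
  ultimately show thesis by (rule that)
qed

text \<open>
  By tightness of the sequence and of the limit law, the expectation of a bounded continuous function
  changes little when the function is replaced by a trigonometric polynomial that is close to it on a
  large ball and bounded everywhere; for trigonometric polynomials the convergence is the hypothesis.
\<close>

theorem levy_continuity_vec:
  fixes Y :: "nat \<Rightarrow> 'a \<Rightarrow> real ^ 's" and N :: "(real ^ 's) measure"
  assumes "prob_space M" "prob_space N" and N: "sets N = sets borel"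
    and Y [measurable]: "\<And>n. Y n \<in> borel_measurable M"
    and char: "\<And>u. (\<lambda>n. \<integral>\<omega>. iexp (u \<bullet> Y n \<omega>) \<partial>M) \<longlonglongrightarrow> (\<integral>x. iexp (u \<bullet> x) \<partial>N)"
    and tight: "\<And>e. 0 < e \<Longrightarrow> \<exists>R. \<forall>n. measure M {\<omega> \<in> space M. R < norm (Y n \<omega>)} \<le> e"
    and f: "continuous_on UNIV (f :: real ^ 's \<Rightarrow> real)" "bounded (range f)"
  shows "(\<lambda>n. \<integral>\<omega>. f (Y n \<omega>) \<partial>M) \<longlonglongrightarrow> (\<integral>x. f x \<partial>N)"
proof -
  interpret M: prob_space M by fact
  interpret N: prob_space N by fact
  note [measurable_cong] = N
  have [measurable]: "f \<in> borel_measurable borel"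
    using f(1) by (rule borel_measurable_continuous_onI)
  obtain B where B: "\<And>x. \<bar>f x\<bar> \<le> B" "0 < B"
    using f(2) unfolding bounded_pos by auto
  have trig: "(\<lambda>n. \<integral>\<omega>. T (Y n \<omega>) \<partial>M) \<longlonglongrightarrow> (\<integral>x. T x \<partial>N)" if "trig_poly T" for T
    using that
  proof induction
    case (monom c u)
    from tendsto_mult[OF tendsto_const char] show ?case by simp
  next
    case (add T S)
    note [measurable] = add.hyps[THEN trig_poly_measurable]
    obtain b c where bc: "\<And>x. norm (T x) \<le> b" "\<And>x. norm (S x) \<le> c"
      using add.hyps[THEN trig_poly_bounded] by auto
    have "integrable M (\<lambda>\<omega>. T (Y n \<omega>))" "integrable M (\<lambda>\<omega>. S (Y n \<omega>))"
      "integrable N T" "integrable N S" for n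
      using bc by (auto intro: M.integrable_const_bound[where B=b] M.integrable_const_bound[where B=c]
          N.integrable_const_bound[where B=b] N.integrable_const_bound[where B=c])
    with tendsto_add[OF add.IH] show ?case by simp
  qed
  have tightN: "\<exists>R. measure N {x \<in> space N. R < norm x} \<le> e" if "0 < e" for e
  proof -
    have "(\<lambda>n. measure N {x \<in> space N. real n < norm x}) \<longlonglongrightarrow> measure N (\<Inter>n. {x \<in> space N. real n < norm x})"
      by (intro N.finite_Lim_measure_decseq) (auto simp: decseq_def)
    moreover have "(\<Inter>n. {x \<in> space N. real n < norm x}) = {}"
      by (auto simp: not_less) (metis reals_Archimedean2 not_less_iff_gr_or_eq)
    ultimately have "eventually (\<lambda>n. measure N {x \<in> space N. real n < norm x} < e) sequentially"
      using that by (intro order_tendstoD) auto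
    then show ?thesis by (auto simp: eventually_sequentially intro: less_imp_le)
  qed
  have key: "\<bar>(\<integral>\<omega>. f (Z \<omega>) \<partial>P) - (\<integral>\<omega>. T (Z \<omega>) \<partial>P)\<bar> \<le> e + (2 * B + e) * e"
    if "prob_space P" and [measurable]: "Z \<in> borel_measurable P" "T \<in> borel_measurable borel"
      and "0 < e" "measure P {\<omega> \<in> space P. R < norm (Z \<omega>)} \<le> e"
      and T: "\<And>x. norm x \<le> R \<Longrightarrow> \<bar>f x - T x\<bar> \<le> e" "\<And>x. \<bar>T x\<bar> \<le> B + e"
    for P :: "'b measure" and Z :: "'b \<Rightarrow> real ^ 's" and T e R
  proof -
    interpret P: prob_space P by fact
    let ?A = "{\<omega> \<in> space P. R < norm (Z \<omega>)}"
    have i: "integrable P (\<lambda>\<omega>. f (Z \<omega>))" "integrable P (\<lambda>\<omega>. T (Z \<omega>))"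
      using B T(2) by (auto intro: P.integrable_const_bound[where B=B] P.integrable_const_bound[where B="B+e"])
    have ia: "integrable P (indicat_real ?A)"
      by (intro P.integrable_const_bound[where B=1]) auto
    have "\<bar>(\<integral>\<omega>. f (Z \<omega>) \<partial>P) - (\<integral>\<omega>. T (Z \<omega>) \<partial>P)\<bar> = \<bar>\<integral>\<omega>. f (Z \<omega>) - T (Z \<omega>) \<partial>P\<bar>"
      using i by simp
    also have "\<dots> \<le> (\<integral>\<omega>. \<bar>f (Z \<omega>) - T (Z \<omega>)\<bar> \<partial>P)"
      using integral_norm_bound[of P "\<lambda>\<omega>. f (Z \<omega>) - T (Z \<omega>)"] by simp
    also have "\<dots> \<le> (\<integral>\<omega>. e + (2 * B + e) * indicator ?A \<omega> \<partial>P)"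
    proof (intro integral_mono)
      fix \<omega> assume "\<omega> \<in> space P"
      then show "\<bar>f (Z \<omega>) - T (Z \<omega>)\<bar> \<le> e + (2 * B + e) * indicator ?A \<omega>"
        using T(1)[of "Z \<omega>"] T(2)[of "Z \<omega>"] B(1)[of "Z \<omega>"] \<open>0 < e\<close>
        by (auto simp: indicator_def not_less)
    qed (use i ia in auto)
    also have "\<dots> = e + (2 * B + e) * measure P ?A"
      using ia by (simp add: P.prob_space)
    also have "\<dots> \<le> e + (2 * B + e) * e"
      using that B(2) by (intro add_left_mono mult_left_mono) auto
    finally show ?thesis .
  qed
  show ?thesis
  proof (rule LIMSEQ_I)
    fix r :: real assume "0 < r"
    define e where "e = min 1 (r / (4 * (2 + 2 * B)))"
    have e: "0 < e" "e \<le> 1" using \<open>0 < r\<close> B(2) by (auto simp: e_def)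
    have "e + (2 * B + e) * e \<le> (2 + 2 * B) * e"
      using e mult_right_mono[of e 1 e] by (simp add: algebra_simps)
    also have "\<dots> \<le> (2 + 2 * B) * (r / (4 * (2 + 2 * B)))"
      using B(2) by (intro mult_left_mono) (auto simp: e_def)
    also have "\<dots> = r / 4" using B(2) by (simp add: field_simps)
    finally have e': "e + (2 * B + e) * e \<le> r / 4" .
    obtain R1 where R1: "\<And>n. measure M {\<omega> \<in> space M. R1 < norm (Y n \<omega>)} \<le> e"
      using tight[OF e(1)] by blast
    obtain R2 where R2: "measure N {x \<in> space N. R2 < norm x} \<le> e"
      using tightN[OF e(1)] by blast
    define R where "R = max 1 (max R1 R2)"
    have RM: "measure M {\<omega> \<in> space M. R < norm (Y n \<omega>)} \<le> e" for n
      by (rule order_trans[OF M.finite_measure_mono R1[of n]]) (auto simp: R_def)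
    have RN: "measure N {x \<in> space N. R < norm x} \<le> e"
      by (rule order_trans[OF N.finite_measure_mono R2]) (auto simp: R_def)
    have "0 < R" by (simp add: R_def)
    obtain T where T: "trig_poly (\<lambda>x. complex_of_real (T x))"
      "\<And>x. norm x \<le> R \<Longrightarrow> \<bar>f x - T x\<bar> \<le> e" "\<And>x. \<bar>T x\<bar> \<le> B + e"
      using trig_poly_approximation[OF f(1) B(1) e(1) \<open>0 < R\<close>] by metis
    have Tm [measurable]: "T \<in> borel_measurable borel"
      using trig_poly_measurable[OF T(1)] by (simp add: borel_measurable_complex_iff)
    have "(\<lambda>n. \<integral>\<omega>. complex_of_real (T (Y n \<omega>)) \<partial>M) \<longlonglongrightarrow> (\<integral>x. complex_of_real (T x) \<partial>N)"
      by (rule trig[OF T(1)])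
    then have "(\<lambda>n. \<integral>\<omega>. T (Y n \<omega>) \<partial>M) \<longlonglongrightarrow> (\<integral>x. T x \<partial>N)"
      by (simp add: tendsto_of_real_iff)
    from LIMSEQ_D[OF this, of "r / 4"] \<open>0 < r\<close>
    obtain n0 where n0: "\<And>n. n \<ge> n0 \<Longrightarrow> \<bar>(\<integral>\<omega>. T (Y n \<omega>) \<partial>M) - (\<integral>x. T x \<partial>N)\<bar> < r / 4"
      by auto
    show "\<exists>no. \<forall>n\<ge>no. norm ((\<integral>\<omega>. f (Y n \<omega>) \<partial>M) - (\<integral>x. f x \<partial>N)) < r"
    proof (intro exI allI impI)
      fix n assume "n0 \<le> n"
      from n0[OF this] have 1: "\<bar>(\<integral>\<omega>. T (Y n \<omega>) \<partial>M) - (\<integral>x. T x \<partial>N)\<bar> < r / 4" .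
      have 2: "\<bar>(\<integral>\<omega>. f (Y n \<omega>) \<partial>M) - (\<integral>\<omega>. T (Y n \<omega>) \<partial>M)\<bar> \<le> r / 4"
        by (rule order_trans[OF key[OF assms(1) Y Tm e(1) RM T(2,3)] e'])
      have 3: "\<bar>(\<integral>x. f x \<partial>N) - (\<integral>x. T x \<partial>N)\<bar> \<le> r / 4"
        by (rule order_trans[OF key[OF assms(2) measurable_ident_sets[OF N] Tm e(1) RN T(2,3)] e'])
      show "norm ((\<integral>\<omega>. f (Y n \<omega>) \<partial>M) - (\<integral>x. f x \<partial>N)) < r"
        using 1 2 3 \<open>0 < r\<close> unfolding real_norm_def by linarith
    qed
  qed
qed

section \<open>Continuity of translations in \<open>L\<^sup>1\<close>\<close>

lemma integrable_lborel_translate: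
  fixes g :: "'a::euclidean_space \<Rightarrow> real"
  assumes "integrable lborel g"
  shows "integrable lborel (\<lambda>t. g (t + h))"
    and "(LBINT t. g (t + h)) = (LBINT t. g t)"
proof -
  have [measurable]: "g \<in> borel_measurable borel" using assms by auto
  show "integrable lborel (\<lambda>t. g (t + h))"
    using assms integrable_distr[of "(+) h" lborel borel g]
    by (simp add: lborel_distr_plus add.commute)
  show "(LBINT t. g (t + h)) = (LBINT t. g t)"
    using integral_distr[of "(+) h" lborel borel g]
    by (simp add: lborel_distr_plus add.commute)
qed

lemma measure_lborel_translate:
  fixes A :: "'a::euclidean_space set"
  assumes [measurable]: "A \<in> sets borel"
  shows "emeasure lborel {t. t + h \<in> A} = emeasure lborel A"
    and "measure lborel {t. t + h \<in> A} = measure lborel A"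
proof -
  have "emeasure lborel A = emeasure (distr lborel borel ((+) h)) A"
    by (simp add: lborel_distr_plus)
  also have "\<dots> = emeasure lborel {t. t + h \<in> A}"
    by (subst emeasure_distr) (auto simp: vimage_def add.commute)
  finally show "emeasure lborel {t. t + h \<in> A} = emeasure lborel A" by simp
  then show "measure lborel {t. t + h \<in> A} = measure lborel A" by (simp add: measure_def)
qed

text \<open>
  Outer regularity gives an open \<open>U \<supseteq> A\<close> of nearly the same measure. A point of \<open>A\<close> that a
  translation moves out of \<open>A\<close> is moved out of \<open>U\<close> or into \<open>U - A\<close>. The second set has small measure by
  translation invariance. Each point of \<open>A\<close> eventually stays in the open set \<open>U\<close>, so the first set is
  dealt with by dominated convergence.
\<close>

lemma measure_translate_diff_tendsto_0:
  fixes A :: "'a::euclidean_space set"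
  assumes A[measurable]: "A \<in> sets borel" and fin: "emeasure lborel A < \<infinity>"
    and h: "h \<longlonglongrightarrow> 0"
  shows "(\<lambda>n. measure lborel (A - {t. t + h n \<in> A})) \<longlonglongrightarrow> 0"
proof (rule LIMSEQ_I)
  fix e :: real assume "0 < e"
  obtain U where U: "open U" "A \<subseteq> U" "emeasure lborel (U - A) < e / 2"
    using outer_regular_lborel[OF A, of "e/2"] \<open>0 < e\<close> by auto
  have [measurable]: "U \<in> sets borel" using U(1) by auto
  have "(\<lambda>n. LBINT t. indicator (A - {t. t + h n \<in> U}) t) \<longlonglongrightarrow> (\<integral>t. (0::real) \<partial>(lborel :: 'a measure))"
  proof (rule integral_dominated_convergence[where w = "indicator A"])
    show "AE t in lborel. (\<lambda>n. indicator (A - {t. t + h n \<in> U}) t) \<longlonglongrightarrow> (0 :: real)"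
    proof (intro AE_I2)
      fix t :: 'a
      show "(\<lambda>n. indicator (A - {t. t + h n \<in> U}) t) \<longlonglongrightarrow> (0 :: real)"
      proof (cases "t \<in> A")
        case True
        have "(\<lambda>n. t + h n) \<longlonglongrightarrow> t" using tendsto_add[OF tendsto_const h, of t] by simp
        then have "eventually (\<lambda>n. t + h n \<in> U) sequentially"
          using U True by (intro topological_tendstoD) auto
        then have "eventually (\<lambda>n. indicator (A - {t. t + h n \<in> U}) t = (0::real)) sequentially"
          by eventually_elim simp
        then show ?thesis by (rule tendsto_eventually)
      qed simp
    qed
  qed (use fin in \<open>auto simp: indicator_def integrable_indicator_iff\<close>)
  then have "(\<lambda>n. measure lborel (A - {t. t + h n \<in> U})) \<longlonglongrightarrow> 0"
    by simp
  then have "eventually (\<lambda>n. measure lborel (A - {t. t + h n \<in> U}) < e / 2) sequentially"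
    using \<open>0 < e\<close> by (intro order_tendstoD) auto
  then have "eventually (\<lambda>n. norm (measure lborel (A - {t. t + h n \<in> A}) - 0) < e) sequentially"
  proof eventually_elim
    case (elim n)
    have UA: "emeasure lborel (U - A) < \<infinity>" 
      by (rule less_trans[OF U(3)]) simp
    have s1: "{t. t + h n \<in> U - A} \<in> sets lborel" by measurable
    have e1: "emeasure lborel {t. t + h n \<in> U - A} = emeasure lborel (U - A)"
      by (rule measure_lborel_translate) auto
    have fA: "A \<in> fmeasurable lborel" using fin by (auto intro: fmeasurableI)
    have f1: "{t. t + h n \<in> U - A} \<in> fmeasurable lborel"
      using s1 e1 UA by (auto intro!: fmeasurableI)
    have f2: "A - {t. t + h n \<in> U} \<in> fmeasurable lborel"
      by (rule fmeasurable_Diff[OF fA]) measurable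
    have "measure lborel (A - {t. t + h n \<in> A})
        \<le> measure lborel ((A - {t. t + h n \<in> U}) \<union> {t. t + h n \<in> U - A})"
      using f1 f2 by (intro measure_mono_fmeasurable fmeasurable.Un) auto
    also have "\<dots> \<le> measure lborel (A - {t. t + h n \<in> U}) + measure lborel {t. t + h n \<in> U - A}"
      using f1 f2 by (intro measure_Un_le) auto
    also have "measure lborel {t. t + h n \<in> U - A} < e / 2"
    proof -
      have "emeasure lborel {t. t + h n \<in> U - A} = ennreal (measure lborel {t. t + h n \<in> U - A})"
        using e1 UA by (intro emeasure_eq_ennreal_measure) auto
      with U(3) e1 have "ennreal (measure lborel {t. t + h n \<in> U - A}) < ennreal (e / 2)"
        by metis
      then show ?thesis by (simp only: ennreal_less_iff[OF measure_nonneg])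
    qed
    finally show ?case using elim by simp
  qed
  then show "\<exists>no. \<forall>n\<ge>no. norm (measure lborel (A - {t. t + h n \<in> A}) - 0) < e"
    by (simp add: eventually_sequentially)
qed

lemma L1_translation_continuous:
  fixes g :: "'a::euclidean_space \<Rightarrow> real"
  assumes "integrable lborel g" and h: "h \<longlonglongrightarrow> 0"
  shows "(\<lambda>n. LBINT t. \<bar>g (t + h n) - g t\<bar>) \<longlonglongrightarrow> 0"
  using assms(1)
proof (induction rule: integrable_induct)
  case (base A c)
  have [measurable]: "A \<in> sets borel" using base by simp
  have fA: "A \<in> fmeasurable lborel" using base by (auto intro: fmeasurableI)
  have "(LBINT t. \<bar>indicat_real A (t + h n) *\<^sub>R c - indicat_real A t *\<^sub>R c\<bar>)
      = 2 * measure lborel (A - {t. t + h n \<in> A}) * \<bar>c\<bar>" for n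
  proof -
    let ?D = "{t. t + h n \<in> A}"
    have [measurable]: "?D \<in> sets borel" by measurable
    have fD: "?D \<in> fmeasurable lborel"
      using base measure_lborel_translate(1)[of A "h n"] by (auto intro!: fmeasurableI)
    have AD: "A - ?D \<in> fmeasurable lborel" "?D - A \<in> fmeasurable lborel"
      "A \<inter> ?D \<in> fmeasurable lborel"
      using fA fD by (auto intro!: fmeasurable_Diff fmeasurable.Int)
    have eq: "\<bar>indicat_real A (t + h n) *\<^sub>R c - indicat_real A t *\<^sub>R c\<bar>
        = indicator (A - ?D) t * \<bar>c\<bar> + indicator (?D - A) t * \<bar>c\<bar>" for t
      by (auto simp: indicator_def)
    have i: "integrable lborel (indicat_real (A - ?D))" "integrable lborel (indicat_real (?D - A))"
      using AD by (auto simp: integrable_indicator_iff fmeasurable_def)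
    have "(LBINT t. \<bar>indicat_real A (t + h n) *\<^sub>R c - indicat_real A t *\<^sub>R c\<bar>)
        = measure lborel (A - ?D) * \<bar>c\<bar> + measure lborel (?D - A) * \<bar>c\<bar>"
      unfolding eq using i by (subst Bochner_Integration.integral_add) auto
    moreover have "measure lborel (?D - A) = measure lborel (A - ?D)"
    proof -
      have "measure lborel ?D = measure lborel (?D - A) + measure lborel (A \<inter> ?D)"
        using AD by (subst measure_Un_AE[symmetric]) (auto intro!: arg_cong[where f = "measure lborel"])
      moreover have "measure lborel A = measure lborel (A - ?D) + measure lborel (A \<inter> ?D)"
        using AD by (subst measure_Un_AE[symmetric]) (auto intro!: arg_cong[where f = "measure lborel"])
      moreover have "measure lborel ?D = measure lborel A"
        by (rule measure_lborel_translate) simp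
      ultimately show ?thesis by simp
    qed
    ultimately show ?thesis by simp
  qed
  moreover have "(\<lambda>n. 2 * measure lborel (A - {t. t + h n \<in> A}) * \<bar>c\<bar>) \<longlonglongrightarrow> 2 * 0 * \<bar>c\<bar>"
    using base h by (intro tendsto_intros measure_translate_diff_tendsto_0) auto
  ultimately show ?case by simp
next
  case (add f g)
  let ?d = "\<lambda>f n. LBINT t. \<bar>f (t + h n) - f t\<bar>"
  note [measurable] = add.hyps[THEN borel_measurable_integrable]
  note tr = integrable_lborel_translate(1)[OF add.hyps(1)] integrable_lborel_translate(1)[OF add.hyps(2)]
  show ?case
  proof (rule tendsto_sandwich[OF _ _ tendsto_const])
    show "(\<lambda>n. ?d f n + ?d g n) \<longlonglongrightarrow> 0"
      using tendsto_add[OF add.IH] by simp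
    have "?d (\<lambda>t. f t + g t) n
        \<le> (LBINT t. \<bar>f (t + h n) - f t\<bar> + \<bar>g (t + h n) - g t\<bar>)" for n
      using tr add.hyps by (intro integral_mono) auto
    moreover have "(LBINT t. \<bar>f (t + h n) - f t\<bar> + \<bar>g (t + h n) - g t\<bar>)
        = ?d f n + ?d g n" for n
      using tr add.hyps by (intro Bochner_Integration.integral_add) auto
    ultimately have "?d (\<lambda>t. f t + g t) n
        \<le> ?d f n + ?d g n" for n
      by simp
    then show "\<forall>\<^sub>F n in sequentially. ?d (\<lambda>t. f t + g t) n
        \<le> ?d f n + ?d g n"
      by simp
  qed simp
next
  case (lim f s)
  note [measurable] = lim.hyps(1,4)[THEN borel_measurable_integrable]
  show ?case
  proof (rule LIMSEQ_I)
    fix e :: real assume "0 < e"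
    have "(\<lambda>i. LBINT t. \<bar>f t - s i t\<bar>) \<longlonglongrightarrow> (\<integral>t. 0 \<partial>(lborel :: 'a measure))"
    proof (rule integral_dominated_convergence[where w = "\<lambda>t. 3 * \<bar>f t\<bar>"])
      show "AE t in lborel. (\<lambda>i. \<bar>f t - s i t\<bar>) \<longlonglongrightarrow> 0"
      proof (intro AE_I2)
        fix t :: 'a
        have "(\<lambda>i. \<bar>f t - s i t\<bar>) \<longlonglongrightarrow> \<bar>f t - f t\<bar>"
          by (intro tendsto_intros lim.hyps(2)) simp
        then show "(\<lambda>i. \<bar>f t - s i t\<bar>) \<longlonglongrightarrow> 0" by simp
      qed
      show "AE t in lborel. norm \<bar>f t - s i t\<bar> \<le> 3 * \<bar>f t\<bar>" for i
      proof (intro AE_I2)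
        fix t :: 'a
        show "norm \<bar>f t - s i t\<bar> \<le> 3 * \<bar>f t\<bar>"
          using lim.hyps(3)[of t i] by (simp add: abs_le_iff; linarith)
      qed
    qed (use lim.hyps in auto)
    then have "eventually (\<lambda>i. (LBINT t. \<bar>f t - s i t\<bar>) < e / 3) sequentially"
      using \<open>0 < e\<close> by (intro order_tendstoD) auto
    then obtain i where i: "(LBINT t. \<bar>f t - s i t\<bar>) < e / 3"
      by (auto simp: eventually_sequentially)
    have int: "integrable lborel (\<lambda>t. \<bar>f t - s i t\<bar>)"
      using lim.hyps by auto
    note tr = integrable_lborel_translate[OF int]
    note tr' = integrable_lborel_translate(1)[OF lim.hyps(1)] integrable_lborel_translate(1)[OF lim.hyps(4)]
    have "eventually (\<lambda>n. (LBINT t. \<bar>s i (t + h n) - s i t\<bar>) < e / 3) sequentially"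
      using \<open>0 < e\<close> lim.IH[of i] by (intro order_tendstoD) auto
    then have "eventually (\<lambda>n. norm ((LBINT t. \<bar>f (t + h n) - f t\<bar>) - 0) < e) sequentially"
    proof eventually_elim
      case (elim n)
      have "(LBINT t. \<bar>f (t + h n) - f t\<bar>)
          \<le> (LBINT t. \<bar>f (t + h n) - s i (t + h n)\<bar> + (\<bar>f t - s i t\<bar> + \<bar>s i (t + h n) - s i t\<bar>))"
        using tr tr' lim.hyps int by (intro integral_mono) auto
      also have "\<dots> = (LBINT t. \<bar>f t - s i t\<bar>)
          + ((LBINT t. \<bar>f t - s i t\<bar>) + (LBINT t. \<bar>s i (t + h n) - s i t\<bar>))"
        using tr tr' lim.hyps int by (simp add: tr)
      finally show ?case using elim i by simp
    qed
    then show "\<exists>no. \<forall>n\<ge>no. norm ((LBINT t. \<bar>f (t + h n) - f t\<bar>) - 0) < e"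
      by (simp add: eventually_sequentially)
  qed
qed

section \<open>Cubes, lattices and windows that grow in the sense of Van Hove\<close>

text \<open>
  Half-open cubes, so that the cubes of a lattice partition the space.
\<close>

definition hbox :: "real ^ 'd \<Rightarrow> real \<Rightarrow> (real ^ 'd) set" where
  "hbox a r = {x. \<forall>i. a $ i \<le> x $ i \<and> x $ i < a $ i + r}"

lemma hbox_borel [measurable]: "hbox a r \<in> sets borel"
  unfolding hbox_def by measurable

lemma measure_hbox:
  fixes a :: "real ^ 'd"
  assumes "0 \<le> r"
  shows "emeasure lborel (hbox a r) = ennreal (r ^ CARD('d))"
    and "measure lborel (hbox a r) = r ^ CARD('d)"
    and "hbox a r \<in> fmeasurable lborel"
proof -
  let ?b = "a + (\<chi> i. r)"
  have prod: "(\<Prod>b\<in>Basis. (?b - a) \<bullet> b) = r ^ CARD('d)"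
    by (simp add: Basis_vec_def inner_axis UNION_singleton_eq_range prod.reindex inj_on_def axis_eq_axis)
  have le: "\<And>b. b \<in> Basis \<Longrightarrow> a \<bullet> b \<le> ?b \<bullet> b"
    using assms by (auto simp: Basis_vec_def inner_axis)
  have e: "emeasure lborel (box a ?b) = ennreal (r ^ CARD('d))" "emeasure lborel (cbox a ?b) = ennreal (r ^ CARD('d))"
    using le prod by (simp_all add: emeasure_lborel_box emeasure_lborel_cbox)
  have "box a ?b \<subseteq> hbox a r" "hbox a r \<subseteq> cbox a ?b"
    by (auto simp: hbox_def mem_box_cart less_imp_le)
  from emeasure_mono[OF this(1), of lborel] emeasure_mono[OF this(2), of lborel] e
  show eq: "emeasure lborel (hbox a r) = ennreal (r ^ CARD('d))" by auto
  then show "measure lborel (hbox a r) = r ^ CARD('d)"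
    using assms by (simp add: measure_def)
  show "hbox a r \<in> fmeasurable lborel" using eq by (auto intro: fmeasurableI)
qed

lemma hbox_mono:
  assumes "r \<le> s"
  shows "hbox a r \<subseteq> hbox a s"
proof
  fix x assume "x \<in> hbox a r"
  then have x: "a $ i \<le> x $ i" "x $ i < a $ i + r" for i by (auto simp: hbox_def)
  have "x $ i < a $ i + s" for i using x(2)[of i] assms by linarith
  with x(1) show "x \<in> hbox a s" by (simp add: hbox_def)
qed

lemma norm_diff_hbox_le:
  fixes a :: "real ^ 'd"
  assumes "x \<in> hbox a r" "y \<in> hbox a r"
  shows "norm (x - y) \<le> r * CARD('d)"
proof -
  have "norm (x - y) \<le> (\<Sum>i\<in>UNIV. \<bar>(x - y) $ i\<bar>)" by (rule norm_le_l1_cart)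
  also have "\<dots> \<le> (\<Sum>i::'d\<in>UNIV. r)"
  proof (rule sum_mono)
    fix i :: 'd
    have "a $ i \<le> x $ i" "x $ i < a $ i + r" "a $ i \<le> y $ i" "y $ i < a $ i + r"
      using assms by (auto simp: hbox_def)
    then show "\<bar>(x - y) $ i\<bar> \<le> r" by simp
  qed
  finally show ?thesis by (simp add: mult.commute)
qed

lemma integrable_indicator_fmeasurable: "A \<in> fmeasurable M \<Longrightarrow> integrable M (indicat_real A)"
  by (simp add: integrable_indicator_iff fmeasurable_def)

definition lattice_point :: "real \<Rightarrow> ('d \<Rightarrow> int) \<Rightarrow> real ^ 'd" where
  "lattice_point \<delta> j = (\<chi> i. \<delta> * of_int (j i))"

lemma mem_lattice_hbox_iff:
  assumes "0 < \<delta>"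
  shows "x \<in> hbox (lattice_point \<delta> j) \<delta> \<longleftrightarrow> j = (\<lambda>i. \<lfloor>x $ i / \<delta>\<rfloor>)"
proof -
  have "\<delta> * of_int (j i) \<le> x $ i \<and> x $ i < \<delta> * of_int (j i) + \<delta> \<longleftrightarrow> j i = \<lfloor>x $ i / \<delta>\<rfloor>" for i
  proof -
    have "\<delta> * of_int (j i) \<le> x $ i \<and> x $ i < \<delta> * of_int (j i) + \<delta>
      \<longleftrightarrow> of_int (j i) \<le> x $ i / \<delta> \<and> x $ i / \<delta> < of_int (j i) + 1"
      using assms by (simp add: field_simps)
    then show ?thesis by (metis floor_eq_iff)
  qed
  then show ?thesis by (auto simp: hbox_def lattice_point_def fun_eq_iff)
qed

lemma lattice_hbox_disjoint:
  fixes j k :: "'d::finite \<Rightarrow> int"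
  assumes "0 < \<delta>" "j \<noteq> k" "r \<le> \<delta>"
  shows "hbox (lattice_point \<delta> j) r \<inter> hbox (lattice_point \<delta> k) r = {}"
proof -
  have "hbox (lattice_point \<delta> j) \<delta> \<inter> hbox (lattice_point \<delta> k) \<delta> = {}"
    using assms(2) by (auto simp: mem_lattice_hbox_iff[OF assms(1)])
  with hbox_mono[OF assms(3)] show ?thesis by blast
qed

text \<open>
  The integer points \<open>j\<close> for which \<open>j / m\<close> lies in the half-open cube of side \<open>p\<close> with corner \<open>b k\<close>.
  The parameters are natural numbers so that such a cube is a union of cells of mesh \<open>1 / m\<close>.
\<close>

definition subgrid :: "nat \<Rightarrow> nat \<Rightarrow> nat \<Rightarrow> ('d \<Rightarrow> int) \<Rightarrow> ('d \<Rightarrow> int) set" where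
  "subgrid m b p k = {j. \<forall>i. int (m * b) * k i \<le> j i \<and> j i < int (m * b) * k i + int (m * p)}"

lemma subgrid_card:
  fixes k :: "'d::finite \<Rightarrow> int"
  shows "finite (subgrid m b p k)" "card (subgrid m b p k) = (m * p) ^ CARD('d)"
proof -
  have eq: "subgrid m b p k = (\<Pi>\<^sub>E i\<in>UNIV. {int (m * b) * k i ..< int (m * b) * k i + int (m * p)})"
    unfolding subgrid_def by (auto simp: PiE_UNIV_domain)
  show "finite (subgrid m b p k)" unfolding eq by (intro finite_PiE) auto
  show "card (subgrid m b p k) = (m * p) ^ CARD('d)"
    unfolding eq by (subst card_PiE) (auto simp: nat_mult_distrib)
qed

lemma subgrid_shift:
  "subgrid m b p k = (\<lambda>j i. j i + int (m * b) * k i) ` subgrid m b p (\<lambda>_. 0)"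
proof -
  have "j \<in> (\<lambda>j i. j i + int (m * b) * k i) ` subgrid m b p (\<lambda>_. 0)" if "j \<in> subgrid m b p k" for j
    using that by (intro image_eqI[of _ _ "\<lambda>i. j i - int (m * b) * k i"]) (auto simp: subgrid_def algebra_simps)
  then show ?thesis by (auto simp: subgrid_def)
qed

lemma mem_hbox_subgrid_iff:
  assumes "0 < m"
  shows "x \<in> hbox (lattice_point (real b) k) (real p)
    \<longleftrightarrow> (\<lambda>i. \<lfloor>real m * x $ i\<rfloor>) \<in> subgrid m b p k"
proof -
  have "real b * of_int (k i) \<le> x $ i \<and> x $ i < real b * of_int (k i) + real p
    \<longleftrightarrow> int (m * b) * k i \<le> \<lfloor>real m * x $ i\<rfloor> \<and> \<lfloor>real m * x $ i\<rfloor> < int (m * b) * k i + int (m * p)" for i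
  proof -
    have "int (m * b) * k i \<le> \<lfloor>real m * x $ i\<rfloor> \<longleftrightarrow> real m * (real b * of_int (k i)) \<le> real m * x $ i"
      by (simp add: le_floor_iff mult_ac)
    moreover have "\<lfloor>real m * x $ i\<rfloor> < int (m * b) * k i + int (m * p)
      \<longleftrightarrow> real m * x $ i < real m * (real b * of_int (k i) + real p)"
      by (simp add: floor_less_iff algebra_simps)
    ultimately show ?thesis using assms by simp
  qed
  then show ?thesis by (simp add: hbox_def lattice_point_def subgrid_def)
qed

lemma indicator_hbox_subgrid:
  assumes "0 < m"
  shows "indicator (hbox (lattice_point (real b) k) (real p)) x
    = (\<Sum>j\<in>subgrid m b p k. indicator (hbox (lattice_point (1 / real m) j) (1 / real m)) x :: real)"
proof -
  have "(\<Sum>j\<in>subgrid m b p k. indicator (hbox (lattice_point (1 / real m) j) (1 / real m)) x :: real)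
    = (\<Sum>j\<in>subgrid m b p k. if j = (\<lambda>i. \<lfloor>real m * x $ i\<rfloor>) then 1 else 0)"
    using assms by (intro sum.cong) (auto simp: indicator_def mem_lattice_hbox_iff mult.commute)
  also have "\<dots> = (if (\<lambda>i. \<lfloor>real m * x $ i\<rfloor>) \<in> subgrid m b p k then 1 else 0)"
    using subgrid_card(1)[of m b p k] by simp
  finally show ?thesis
    using mem_hbox_subgrid_iff[OF assms, of x b k p] by (simp add: indicator_def)
qed

lemma component_le_l1_norm: "\<bar>x $ i\<bar> \<le> l1_norm x"
  unfolding l1_norm_def by (rule member_le_sum) auto

text \<open>
  The indices \<open>k\<close> and \<open>k'\<close> differ in some coordinate. There the cubes of side \<open>p\<close> are separated by a
  corridor of width \<open>q\<close>, and the \<open>\<ell>\<^sub>1\<close>-distance dominates every coordinate distance.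
\<close>

lemma subgrid_separated:
  assumes "0 < m" "k \<noteq> k'" "j \<in> subgrid m (p + q) p k" "j' \<in> subgrid m (p + q) p k'"
  shows "real q \<le> l1_norm (lattice_point (1 / real m) j - lattice_point (1 / real m) j')"
proof -
  obtain i where i: "k i \<noteq> k' i" using assms(2) by auto
  have *: "int (m * q) \<le> a' - a"
    if "x < y" "a < int (m * (p + q)) * x + int (m * p)" "int (m * (p + q)) * y \<le> a'" for a a' x y
  proof -
    have "int (m * (p + q)) * (x + 1) \<le> int (m * (p + q)) * y"
      using that(1) by (intro mult_left_mono) auto
    then show ?thesis using that by (simp add: algebra_simps)
  qed
  have "int (m * q) \<le> \<bar>j i - j' i\<bar>"
  proof (cases "k i < k' i")
    case True
    from *[OF this, of "j i" "j' i"] assms(3,4) show ?thesis by (simp add: subgrid_def del: of_nat_mult of_nat_add)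
  next
    case False
    then have "k' i < k i" using i by simp
    from *[OF this, of "j' i" "j i"] assms(3,4) show ?thesis by (simp add: subgrid_def del: of_nat_mult of_nat_add)
  qed
  then have "real m * real q \<le> \<bar>of_int (j i) - of_int (j' i)\<bar>"
    by (metis (mono_tags, opaque_lifting) of_int_abs of_int_diff of_int_le_iff of_int_of_nat_eq of_nat_mult)
  then have "real q \<le> \<bar>(lattice_point (1 / real m) j - lattice_point (1 / real m) j') $ i\<bar>"
    using assms(1) by (simp add: lattice_point_def diff_divide_distrib[symmetric] field_simps)
  also have "\<dots> \<le> l1_norm (lattice_point (1 / real m) j - lattice_point (1 / real m) j')"
    by (rule component_le_l1_norm)
  finally show ?thesis .
qed

lemma measure_lborel_plus_image:
  fixes A :: "'a::euclidean_space set"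
  assumes "A \<in> sets borel"
  shows "measure lborel ((+) y ` A) = measure lborel A"
proof -
  have "(+) y ` A = {x. x + (- y) \<in> A}"
    by (auto simp: image_iff) (metis add.commute diff_add_cancel)
  then show ?thesis using measure_lborel_translate(2)[OF assms, of "- y"] by simp
qed

lemma compact_frontier_thickening:
  fixes W :: "(real ^ 'd) set"
  assumes "compact W"
  shows "compact (frontier W + cball 0 r)"
proof -
  have "frontier W + cball 0 r = {x + y | x y. x \<in> frontier W \<and> y \<in> cball 0 r}"
    unfolding set_plus_def by blast
  then show ?thesis
    by (simp only: compact_sums compact_frontier compact_cball assms)
qed

text \<open>
  The ball of radius \<open>R\<close> is covered by finitely many translates of the unit ball, hence the wide
  neighbourhood of the boundary by as many translates of the narrow one. So the unit radius in the
  Van Hove condition may be replaced by any other.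
\<close>

lemma measure_frontier_thickening_bound:
  fixes R :: real
  obtains C where "\<And>W :: (real ^ 'd) set. compact W \<Longrightarrow>
    measure lborel (frontier W + cball 0 R) \<le> C * measure lborel (frontier W + cball 0 1)"
proof -
  obtain F where F: "finite F" "cball (0 :: real ^ 'd) R \<subseteq> (\<Union>y\<in>F. ball y 1)"
    using compact_cball[of "0 :: real ^ 'd" R] unfolding compact_eq_totally_bounded
    by (meson zero_less_one)
  have "measure lborel (frontier W + cball 0 R) \<le> real (card F) * measure lborel (frontier W + cball 0 1)"
    if "compact W" for W :: "(real ^ 'd) set"
  proof -
    let ?T = "frontier W + cball 0 1"
    have c: "compact (frontier W + cball 0 r)" for r
      using that by (rule compact_frontier_thickening)
    have m: "compact K \<Longrightarrow> K \<in> fmeasurable lborel" for K :: "(real ^ 'd) set"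
      by (rule fmeasurable_compact)
    have ct: "compact ((+) y ` ?T)" for y
      using c by (rule compact_translation)
    have "frontier W + cball 0 R \<subseteq> (\<Union>y\<in>F. (+) y ` ?T)"
    proof
      fix x assume "x \<in> frontier W + cball 0 R"
      then obtain w z where "x = w + z" "w \<in> frontier W" "z \<in> cball 0 R" by (auto elim: set_plus_elim)
      moreover then obtain y where "y \<in> F" "z \<in> ball y 1" using F(2) by blast
      moreover have "w + (z - y) \<in> ?T"
        using calculation by (intro set_plus_intro) (auto simp: dist_norm norm_minus_commute)
      ultimately show "x \<in> (\<Union>y\<in>F. (+) y ` ?T)"
        by (auto intro!: bexI[of _ y] image_eqI[of _ _ "w + (z - y)"])
    qed
    then have "measure lborel (frontier W + cball 0 R) \<le> measure lborel (\<Union>y\<in>F. (+) y ` ?T)"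
      using m[OF ct] F(1)
      by (intro measure_mono_fmeasurable fmeasurable.finite_UN fmeasurableD[OF m[OF c]]) auto
    also have "\<dots> \<le> (\<Sum>y\<in>F. measure lborel ((+) y ` ?T))"
      using fmeasurableD[OF m[OF ct]] F(1) by (intro measure_UNION_le) auto
    also have "\<dots> = (\<Sum>y\<in>F. measure lborel ?T)"
      using c by (simp add: measure_lborel_plus_image borel_compact)
    finally show ?thesis by simp
  qed
  then show thesis by (rule that)
qed

definition inner_tiles :: "real \<Rightarrow> (real ^ 'd) set \<Rightarrow> ('d \<Rightarrow> int) set" where
  "inner_tiles b W = {k. hbox (lattice_point b k) b \<subseteq> W}"

text \<open>
  A tile that meets \<open>W\<close> without lying in \<open>W\<close> contains a segment from a point of \<open>W\<close> to a point
  outside of \<open>W\<close>, which has to cross the boundary of \<open>W\<close>.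
\<close>

lemma diff_tiles_subset_thickening:
  fixes W :: "(real ^ 'd) set"
  assumes "0 < b"
  shows "W - (\<Union>k\<in>inner_tiles b W. hbox (lattice_point b k) b)
    \<subseteq> frontier W + cball 0 (b * CARD('d))"
proof
  fix x assume x: "x \<in> W - (\<Union>k\<in>inner_tiles b W. hbox (lattice_point b k) b)"
  define k where "k = (\<lambda>i. \<lfloor>x $ i / b\<rfloor>)"
  have xk: "x \<in> hbox (lattice_point b k) b" using mem_lattice_hbox_iff[OF assms] k_def by blast
  with x obtain y where y: "y \<in> hbox (lattice_point b k) b" "y \<notin> W"
    unfolding inner_tiles_def by blast
  have xy: "norm (x - y) \<le> b * CARD('d)" by (rule norm_diff_hbox_le[OF xk y(1)])
  have "closed_segment x y \<inter> frontier W \<noteq> {}"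
    using x y by (intro connected_Int_frontier) auto
  then obtain z where z: "z \<in> closed_segment x y" "z \<in> frontier W" by blast
  have "norm (x - z) \<le> norm (x - y)"
    using segment_bound1[OF z(1)] by (simp add: norm_minus_commute)
  then have "x - z \<in> cball 0 (b * CARD('d))" using xy by simp
  from set_plus_intro[OF z(2) this] show "x \<in> frontier W + cball 0 (b * CARD('d))" by simp
qed

lemma measure_tile_union:
  fixes K :: "('d::finite \<Rightarrow> int) set" and b p :: real
  assumes "finite K" "0 < b" "0 \<le> p" "p \<le> b"
  shows "measure lborel (\<Union>k\<in>K. hbox (lattice_point b k) p) = card K * p ^ CARD('d)"
proof -
  have "measure lborel (\<Union>k\<in>K. hbox (lattice_point b k) p) = (\<Sum>k\<in>K. measure lborel (hbox (lattice_point b k) p))"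
    using assms lattice_hbox_disjoint[OF assms(2) _ assms(4)]
    by (intro measure_finite_Union) (auto simp: disjoint_family_on_def measure_hbox)
  then show ?thesis using assms by (simp add: measure_hbox)
qed

lemma finite_inner_tiles:
  fixes W :: "(real ^ 'd) set"
  assumes "compact W" "0 < b"
  shows "finite (inner_tiles b W)"
proof (rule ccontr)
  assume inf: "\<not> finite (inner_tiles b W)"
  have W: "W \<in> fmeasurable lborel" using assms(1) by (rule fmeasurable_compact)
  obtain n :: nat where n: "measure lborel W / b ^ CARD('d) < real n" using reals_Archimedean2 by blast
  obtain K where K: "finite K" "card K = n" "K \<subseteq> inner_tiles b W"
    using infinite_arbitrarily_large[OF inf] by blast
  have "card K * b ^ CARD('d) = measure lborel (\<Union>k\<in>K. hbox (lattice_point b k) b)"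
    using measure_tile_union[OF K(1) assms(2), of b] assms(2) by simp
  also have "\<dots> \<le> measure lborel W"
    using K W assms by (intro measure_mono_fmeasurable) (auto simp: inner_tiles_def)
  finally show False using n K(2) assms(2) by (simp add: field_simps)
qed

lemma VH_growing_windows:
  assumes "VH_growing W"
  shows "compact (W n)" "0 < measure lborel (W n)"
  using assms by (auto simp: VH_growing_def)

lemma VH_growing_tiles:
  fixes W :: "nat \<Rightarrow> (real ^ 'd) set"
  assumes W: "VH_growing W" and b: "0 < b"
  shows "(\<lambda>n. real (card (inner_tiles b (W n))) / measure lborel (W n)) \<longlonglongrightarrow> 1 / b ^ CARD('d)"
proof -
  note cW = VH_growing_windows[OF W]
  have ratio: "(\<lambda>n. measure lborel (frontier (W n) + cball 0 1) / measure lborel (W n)) \<longlonglongrightarrow> 0"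
    using W by (auto simp: VH_growing_def)
  obtain C where C: "\<And>W :: (real ^ 'd) set. compact W \<Longrightarrow>
    measure lborel (frontier W + cball 0 (b * CARD('d))) \<le> C * measure lborel (frontier W + cball 0 1)"
    using measure_frontier_thickening_bound by blast
  let ?N = "\<lambda>n. real (card (inner_tiles b (W n)))" and ?L = "\<lambda>n. measure lborel (W n)"
  have le: "0 \<le> 1 - ?N n * b ^ CARD('d) / ?L n" and
    ge: "1 - ?N n * b ^ CARD('d) / ?L n \<le> C * (measure lborel (frontier (W n) + cball 0 1) / ?L n)" for n
  proof -
    let ?U = "\<Union>k\<in>inner_tiles b (W n). hbox (lattice_point b k) b"
    have U: "measure lborel ?U = ?N n * b ^ CARD('d)"
      using measure_tile_union[OF finite_inner_tiles[OF cW(1) b] b, of b] b by simp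
    have sub: "?U \<subseteq> W n" by (auto simp: inner_tiles_def)
    have fU: "?U \<in> fmeasurable lborel" "W n \<in> fmeasurable lborel"
      using b finite_inner_tiles[OF cW(1) b] measure_hbox(3)[of b] fmeasurable_compact[OF cW(1)]
      by (auto intro!: fmeasurable.finite_UN)
    have d: "measure lborel (W n - ?U) = ?L n - ?N n * b ^ CARD('d)"
      using measurable_measure_Diff[OF fU(2) fmeasurableD[OF fU(1)] sub] U by simp
    have "measure lborel (W n - ?U) \<le> measure lborel (frontier (W n) + cball 0 (b * CARD('d)))"
      using diff_tiles_subset_thickening[OF b] fU
      by (intro measure_mono_fmeasurable) (auto intro!: fmeasurable_compact compact_frontier_thickening cW)
    also have "\<dots> \<le> C * measure lborel (frontier (W n) + cball 0 1)" by (rule C[OF cW(1)])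
    finally have "?L n - ?N n * b ^ CARD('d) \<le> C * measure lborel (frontier (W n) + cball 0 1)"
      by (simp add: d)
    then show "1 - ?N n * b ^ CARD('d) / ?L n \<le> C * (measure lborel (frontier (W n) + cball 0 1) / ?L n)"
      using cW(2)[of n] divide_right_mono[of _ _ "?L n"] by (fastforce simp: diff_divide_distrib)
    have "0 \<le> ?L n - ?N n * b ^ CARD('d)" using measure_nonneg[of lborel "W n - ?U"] d by simp
    then show "0 \<le> 1 - ?N n * b ^ CARD('d) / ?L n" using cW(2)[of n] by (simp add: field_simps)
  qed
  have "(\<lambda>n. 1 - ?N n * b ^ CARD('d) / ?L n) \<longlonglongrightarrow> 0"
    by (rule tendsto_sandwich[OF _ _ tendsto_const tendsto_mult_right_zero[OF ratio, of C]])
      (use le ge in auto)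
  then have "(\<lambda>n. (1 - (1 - ?N n * b ^ CARD('d) / ?L n)) / b ^ CARD('d)) \<longlonglongrightarrow> (1 - 0) / b ^ CARD('d)"
    by (intro tendsto_intros) (use b in auto)
  then show ?thesis using b by simp
qed

text \<open>
  A nonempty compact set has a boundary point, so that \<open>bd W\<^sub>n + B\<^sup>d\<close> has at least the volume of the
  unit ball, while its ratio to \<open>\<lambda>(W\<^sub>n)\<close> tends to zero.
\<close>

lemma VH_growing_at_top:
  fixes W :: "nat \<Rightarrow> (real ^ 'd) set"
  assumes W: "VH_growing W"
  shows "filterlim (\<lambda>n. measure lborel (W n)) at_top sequentially"
proof -
  note cW = VH_growing_windows[OF W]
  let ?v = "measure lborel (cball (0 :: real ^ 'd) 1)"
  have v: "0 < ?v" by (simp add: content_cball_pos)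
  have ge: "?v \<le> measure lborel (frontier (W n) + cball 0 1)" for n
  proof -
    have "W n \<noteq> {}" using cW(2)[of n] by auto
    moreover have "W n \<noteq> UNIV" using compact_imp_bounded[OF cW(1)[of n]] not_bounded_UNIV by metis
    ultimately have "frontier (W n) \<noteq> {}" by (simp add: frontier_eq_empty)
    then obtain z where z: "z \<in> frontier (W n)" by blast
    have "?v = measure lborel ((+) z ` cball 0 1)" 
      by (simp only: measure_lborel_plus_image borel_closed[OF closed_cball])
    also have "\<dots> \<le> measure lborel (frontier (W n) + cball 0 1)"
    proof (intro measure_mono_fmeasurable)
      show "(+) z ` cball 0 1 \<subseteq> frontier (W n) + cball 0 1"
        using set_plus_intro[OF z] by (rule image_subsetI)
      show "(+) z ` cball 0 1 \<in> sets lborel"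
        using compact_translation[OF compact_cball] by (auto intro: borel_compact)
    qed (auto intro!: fmeasurable_compact compact_frontier_thickening cW)
    finally show ?thesis .
  qed
  have "(\<lambda>n. ?v / measure lborel (W n)) \<longlonglongrightarrow> 0"
  proof (rule tendsto_sandwich[OF _ _ tendsto_const])
    show "(\<lambda>n. measure lborel (frontier (W n) + cball 0 1) / measure lborel (W n)) \<longlonglongrightarrow> 0"
      using W by (auto simp: VH_growing_def)
  qed (use ge cW(2) in \<open>auto intro!: always_eventually divide_right_mono simp: less_imp_le\<close>)
  then have "filterlim (\<lambda>n. inverse (?v / measure lborel (W n))) at_top sequentially"
    using v cW(2) by (intro filterlim_inverse_at_top) auto
  then have "filterlim (\<lambda>n. ?v * inverse (?v / measure lborel (W n))) at_top sequentially"
    using v by (intro filterlim_tendsto_pos_mult_at_top[OF tendsto_const])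
  then show ?thesis using v by (simp add: field_simps)
qed

section \<open>Second moments of integrals of a random field\<close>

text \<open>
  Fubini's theorem in the form used for random fields: integrability over the product is deduced from
  a bound \<open>G\<close> for the absolute moments at fixed \<open>x\<close>.
\<close>

lemma (in pair_sigma_finite) fubini_dominated:
  fixes h :: "'a \<Rightarrow> 'b \<Rightarrow> real"
  assumes meas: "case_prod h \<in> borel_measurable (M1 \<Otimes>\<^sub>M M2)"
    and int: "\<And>x. x \<in> space M1 \<Longrightarrow> integrable M2 (h x)"
    and bound: "\<And>x. x \<in> space M1 \<Longrightarrow> (\<integral>y. \<bar>h x y\<bar> \<partial>M2) \<le> G x"
    and G: "integrable M1 G"
  shows "AE y in M2. integrable M1 (\<lambda>x. h x y)"
    and "integrable M2 (\<lambda>y. \<integral>x. h x y \<partial>M1)"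
    and "integrable M1 (\<lambda>x. \<integral>y. h x y \<partial>M2)"
    and "(\<integral>y. (\<integral>x. h x y \<partial>M1) \<partial>M2) = (\<integral>x. (\<integral>y. h x y \<partial>M2) \<partial>M1)"
    and "(\<integral>y. \<bar>\<integral>x. h x y \<partial>M1\<bar> \<partial>M2) \<le> (\<integral>x. G x \<partial>M1)"
proof -
  note [measurable] = meas
  have absint: "integrable M1 (\<lambda>x. \<integral>y. \<bar>h x y\<bar> \<partial>M2)"
  proof (rule Bochner_Integration.integrable_bound[OF G])
    show "AE x in M1. norm (\<integral>y. \<bar>h x y\<bar> \<partial>M2) \<le> norm (G x)"
      using bound by (intro AE_I2) (force intro: order_trans[OF _ abs_ge_self])
  qed measurable
  have pair: "integrable (M1 \<Otimes>\<^sub>M M2) (case_prod h)"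
  proof (rule Fubini_integrable[OF meas])
    show "integrable M1 (\<lambda>x. \<integral>y. norm (case (x, y) of (x, y) \<Rightarrow> h x y) \<partial>M2)"
      using absint by simp
  qed (use int in auto)
  show ae: "AE y in M2. integrable M1 (\<lambda>x. h x y)"
    using AE_integrable_snd[of h] pair by simp
  show i2: "integrable M2 (\<lambda>y. \<integral>x. h x y \<partial>M1)"
    using integrable_snd[of h] pair by simp
  show "integrable M1 (\<lambda>x. \<integral>y. h x y \<partial>M2)"
    using integrable_fst[of h] pair by simp
  show "(\<integral>y. (\<integral>x. h x y \<partial>M1) \<partial>M2) = (\<integral>x. (\<integral>y. h x y \<partial>M2) \<partial>M1)"
    by (rule Fubini_integral) (use pair in simp)
  have pair': "integrable (M1 \<Otimes>\<^sub>M M2) (case_prod (\<lambda>x y. \<bar>h x y\<bar>))"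
    using integrable_abs[OF pair] by (simp add: case_prod_unfold)
  have "(\<integral>y. \<bar>\<integral>x. h x y \<partial>M1\<bar> \<partial>M2) \<le> (\<integral>y. (\<integral>x. \<bar>h x y\<bar> \<partial>M1) \<partial>M2)"
  proof (rule integral_mono)
    show "integrable M2 (\<lambda>y. \<integral>x. \<bar>h x y\<bar> \<partial>M1)"
      using integrable_snd[OF pair'] .
    show "\<bar>\<integral>x. h x y \<partial>M1\<bar> \<le> (\<integral>x. \<bar>h x y\<bar> \<partial>M1)" for y
      using integral_norm_bound[of M1 "\<lambda>x. h x y"] by simp
  qed (use i2 in auto)
  also have "\<dots> = (\<integral>x. (\<integral>y. \<bar>h x y\<bar> \<partial>M2) \<partial>M1)"
    by (rule Fubini_integral[OF pair'])
  also have "\<dots> \<le> (\<integral>x. G x \<partial>M1)"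
    by (rule integral_mono[OF absint G bound])
  finally show "(\<integral>y. \<bar>\<integral>x. h x y \<partial>M1\<bar> \<partial>M2) \<le> (\<integral>x. G x \<partial>M1)" .
qed

lemma abs_mult_le_squares: "\<bar>x * y\<bar> \<le> x\<^sup>2 + (y :: real)\<^sup>2"
proof -
  have "0 \<le> (\<bar>x\<bar> - \<bar>y\<bar>)\<^sup>2" by simp
  then have "2 * \<bar>x * y\<bar> \<le> x\<^sup>2 + y\<^sup>2"
    by (simp add: power2_eq_square abs_mult algebra_simps)
  then show ?thesis by simp
qed

text \<open>
  A jointly measurable, centered, weakly stationary real field with integrable covariance function.
\<close>

locale L2_field = prob_space M for M :: "'a measure" +
  fixes \<xi> :: "real ^ 'd \<Rightarrow> 'a \<Rightarrow> real" and c :: "real ^ 'd \<Rightarrow> real"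
  assumes field_measurable: "(\<lambda>(\<omega>, t). \<xi> t \<omega>) \<in> borel_measurable (M \<Otimes>\<^sub>M borel)"
    and square_integrable: "\<And>t. integrable M (\<lambda>\<omega>. (\<xi> t \<omega>)\<^sup>2)"
    and mean_zero: "\<And>t. expectation (\<xi> t) = 0"
    and covariance: "\<And>s t. expectation (\<lambda>\<omega>. \<xi> s \<omega> * \<xi> t \<omega>) = c (t - s)"
    and c_integrable: "integrable lborel c"
begin

sublocale P: pair_sigma_finite "lborel :: (real ^ 'd) measure" M
  by (simp add: pair_sigma_finite_def lborel.sigma_finite_measure_axioms sigma_finite_measure_axioms)

lemma measurable_field_comp [measurable (raw)]:
  assumes "f \<in> measurable N M" "g \<in> borel_measurable N"
  shows "(\<lambda>x. \<xi> (g x) (f x)) \<in> borel_measurable N"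
  using measurable_compose[OF measurable_Pair[OF assms] field_measurable] by simp

lemma c_measurable [measurable]: "c \<in> borel_measurable borel"
  using c_integrable by auto

lemma field_integrable: "integrable M (\<xi> t)"
  by (rule square_integrable_imp_integrable[OF _ square_integrable]) measurable

lemma field_square: "expectation (\<lambda>\<omega>. (\<xi> t \<omega>)\<^sup>2) = c 0"
  using covariance[of t t] by (simp add: power2_eq_square)

lemma expectation_abs_field_le: "expectation (\<lambda>\<omega>. \<bar>\<xi> t \<omega>\<bar>) \<le> 1 + c 0"
proof -
  have "expectation (\<lambda>\<omega>. \<bar>\<xi> t \<omega>\<bar>) \<le> expectation (\<lambda>\<omega>. 1 + (\<xi> t \<omega>)\<^sup>2)"
  proof (rule integral_mono)
    show "\<bar>\<xi> t \<omega>\<bar> \<le> 1 + (\<xi> t \<omega>)\<^sup>2" for \<omega>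
      using zero_le_power2[of "\<bar>\<xi> t \<omega>\<bar> - 1/2"] by (simp add: power2_eq_square algebra_simps)
  qed (use field_integrable square_integrable in auto)
  also have "\<dots> = 1 + c 0"
    using square_integrable field_square by (simp add: prob_space)
  finally show ?thesis .
qed

lemma product_integrable:
  assumes [measurable]: "Y \<in> borel_measurable M" and Y: "integrable M (\<lambda>\<omega>. (Y \<omega>)\<^sup>2)"
  shows "integrable M (\<lambda>\<omega>. \<xi> s \<omega> * Y \<omega>)"
    and "expectation (\<lambda>\<omega>. \<bar>\<xi> s \<omega> * Y \<omega>\<bar>) \<le> c 0 + expectation (\<lambda>\<omega>. (Y \<omega>)\<^sup>2)"
proof -
  have i: "integrable M (\<lambda>\<omega>. (\<xi> s \<omega>)\<^sup>2 + (Y \<omega>)\<^sup>2)"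
    using Y square_integrable by simp
  show i': "integrable M (\<lambda>\<omega>. \<xi> s \<omega> * Y \<omega>)"
    by (rule Bochner_Integration.integrable_bound[OF i])
      (use abs_mult_le_squares in \<open>auto simp: abs_mult\<close>)
  have "expectation (\<lambda>\<omega>. \<bar>\<xi> s \<omega> * Y \<omega>\<bar>) \<le> expectation (\<lambda>\<omega>. (\<xi> s \<omega>)\<^sup>2 + (Y \<omega>)\<^sup>2)"
    by (intro integral_mono abs_mult_le_squares i integrable_abs i')
  also have "\<dots> = c 0 + expectation (\<lambda>\<omega>. (Y \<omega>)\<^sup>2)"
    using Y square_integrable field_square by simp
  finally show "expectation (\<lambda>\<omega>. \<bar>\<xi> s \<omega> * Y \<omega>\<bar>) \<le> c 0 + expectation (\<lambda>\<omega>. (Y \<omega>)\<^sup>2)" .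
qed

text \<open>
  The integral of the field against a weight; weights are mostly indicators. At outcomes whose path is
  not integrable against \<open>g\<close>, a null set for integrable \<open>g\<close>, the value is the default \<open>0\<close>.
\<close>

definition smear :: "(real ^ 'd \<Rightarrow> real) \<Rightarrow> 'a \<Rightarrow> real" where
  "smear g \<omega> = (LBINT t. g t * \<xi> t \<omega>)"

lemma smear_measurable [measurable]:
  assumes [measurable]: "g \<in> borel_measurable borel"
  shows "smear g \<in> borel_measurable M"
  unfolding smear_def by measurable

lemma smear_integrable:
  assumes g: "integrable lborel g"
  shows "AE \<omega> in M. integrable lborel (\<lambda>t. g t * \<xi> t \<omega>)"
    and "integrable M (smear g)"
    and "expectation (smear g) = 0"
proof -
  have [measurable]: "g \<in> borel_measurable borel" using g by auto
  have m: "case_prod (\<lambda>t \<omega>. g t * \<xi> t \<omega>) \<in> borel_measurable (lborel \<Otimes>\<^sub>M M)" by measurable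
  have i: "integrable M (\<lambda>\<omega>. g t * \<xi> t \<omega>)" for t using field_integrable by simp
  have b: "expectation (\<lambda>\<omega>. \<bar>g t * \<xi> t \<omega>\<bar>) \<le> \<bar>g t\<bar> * (1 + c 0)" for t
    using mult_left_mono[OF expectation_abs_field_le[of t], of "\<bar>g t\<bar>"] by (simp add: abs_mult)
  have G: "integrable lborel (\<lambda>t. \<bar>g t\<bar> * (1 + c 0))" using g by simp
  note F = P.fubini_dominated[OF m i b G]
  show "AE \<omega> in M. integrable lborel (\<lambda>t. g t * \<xi> t \<omega>)" by (rule F(1))
  show "integrable M (smear g)" using F(2) by (simp add: smear_def[abs_def])
  show "expectation (smear g) = 0" using F(4) by (simp add: smear_def[abs_def] mean_zero)
qed

text \<open>
  Cauchy--Schwarz along the paths, \<open>(\<integral>g\<xi>)\<^sup>2 \<le> (\<integral>\<bar>g\<bar> + 1) \<integral>\<bar>g\<bar>\<xi>\<^sup>2\<close>, reduces the claim to the first moment of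
  \<open>\<integral>\<bar>g\<bar>\<xi>\<^sup>2\<close>.
\<close>

lemma smear_square_integrable:
  assumes g: "integrable lborel g"
  shows "integrable M (\<lambda>\<omega>. (smear g \<omega>)\<^sup>2)"
proof -
  have [measurable]: "g \<in> borel_measurable borel" using g by auto
  have m: "case_prod (\<lambda>t \<omega>. \<bar>g t\<bar> * (\<xi> t \<omega>)\<^sup>2) \<in> borel_measurable (lborel \<Otimes>\<^sub>M M)" by measurable
  have i: "integrable M (\<lambda>\<omega>. \<bar>g t\<bar> * (\<xi> t \<omega>)\<^sup>2)" for t using square_integrable by simp
  have b: "expectation (\<lambda>\<omega>. \<bar>\<bar>g t\<bar> * (\<xi> t \<omega>)\<^sup>2\<bar>) \<le> \<bar>g t\<bar> * c 0" for t
    using field_square by (simp add: abs_mult)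
  have G: "integrable lborel (\<lambda>t. \<bar>g t\<bar> * c 0)" using g by simp
  note F = P.fubini_dominated[OF m i b G]
  define A where "A = (LBINT t. \<bar>g t\<bar>)"
  have "0 \<le> A" unfolding A_def by simp
  have "AE \<omega> in M. norm ((smear g \<omega>)\<^sup>2) \<le> norm ((A + 1) * (LBINT t. \<bar>g t\<bar> * (\<xi> t \<omega>)\<^sup>2))"
    using smear_integrable(1)[OF g] F(1)
  proof eventually_elim
    case (elim \<omega>)
    define B where "B = (LBINT t. \<bar>g t\<bar> * (\<xi> t \<omega>)\<^sup>2)"
    define D where "D = (LBINT t. \<bar>g t * \<xi> t \<omega>\<bar>)"
    \<comment> \<open>nearly the minimizer \<open>D / A\<close> of the quadratic polynomial below; \<open>A + 1\<close> covers \<open>A = 0\<close> as well\<close>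
    define x where "x = D / (A + 1)"
    have "0 \<le> (LBINT t. \<bar>g t\<bar> * (\<bar>\<xi> t \<omega>\<bar> - x)\<^sup>2)" by simp
    also have "\<dots> = (LBINT t. \<bar>g t\<bar> * (\<xi> t \<omega>)\<^sup>2 - 2 * x * \<bar>g t * \<xi> t \<omega>\<bar> + x\<^sup>2 * \<bar>g t\<bar>)"
      by (intro Bochner_Integration.integral_cong refl)
        (simp add: power2_eq_square abs_mult algebra_simps)
    also have "\<dots> = B - 2 * x * D + x\<^sup>2 * A"
      using elim g by (simp add: A_def B_def D_def)
    finally have "2 * x * D \<le> B + x\<^sup>2 * A" by simp
    moreover have "x\<^sup>2 * A \<le> x\<^sup>2 * (A + 1)" by (intro mult_left_mono) auto
    moreover have xA: "x * (A + 1) = D"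
      using \<open>0 \<le> A\<close> by (simp add: x_def)
    have "x\<^sup>2 * (A + 1) = x * D"
      by (simp add: power2_eq_square xA[symmetric] mult_ac)
    ultimately have "x * D \<le> B" by simp
    then have "(A + 1) * (x * D) \<le> (A + 1) * B"
      using \<open>0 \<le> A\<close> by (intro mult_left_mono) auto
    then have "D\<^sup>2 \<le> (A + 1) * B"
      by (simp add: power2_eq_square xA[symmetric] mult_ac)
    moreover have "(smear g \<omega>)\<^sup>2 \<le> D\<^sup>2"
      using integral_norm_bound[of lborel "\<lambda>t. g t * \<xi> t \<omega>"]
      by (intro abs_le_square_iff[THEN iffD1]) (simp add: smear_def D_def)
    ultimately show ?case by (simp add: B_def)
  qed
  then show ?thesis
    by (intro Bochner_Integration.integrable_bound[OF integrable_mult_right[OF F(2)]]) measurable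
qed

text \<open>
  Fubini is applied twice on the product with the probability space, to \<open>\<xi>(s) Y\<close> and then to
  \<open>Y\<^sup>2 = \<integral>g(s) \<xi>(s) Y ds\<close> for \<open>Y = \<integral>g \<xi>\<close>. This avoids the product of three measure spaces.
\<close>

lemma smear_second_moment:
  assumes g: "integrable lborel g"
  shows "expectation (\<lambda>\<omega>. (smear g \<omega>)\<^sup>2) = (LBINT s. g s * (LBINT t. g t * c (t - s)))"
    and "integrable lborel (\<lambda>s. g s * (LBINT t. g t * c (t - s)))"
proof -
  have [measurable]: "g \<in> borel_measurable borel" using g by auto
  have inner: "expectation (\<lambda>\<omega>. \<xi> s \<omega> * smear g \<omega>) = (LBINT t. g t * c (t - s))" for s
  proof -
    have m: "case_prod (\<lambda>t \<omega>. g t * (\<xi> s \<omega> * \<xi> t \<omega>)) \<in> borel_measurable (lborel \<Otimes>\<^sub>M M)" by measurable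
    have i: "integrable M (\<lambda>\<omega>. g t * (\<xi> s \<omega> * \<xi> t \<omega>))" for t
      using product_integrable(1)[OF _ square_integrable, of t s] by simp
    have b: "expectation (\<lambda>\<omega>. \<bar>g t * (\<xi> s \<omega> * \<xi> t \<omega>)\<bar>) \<le> \<bar>g t\<bar> * (c 0 + c 0)" for t
      using mult_left_mono[OF product_integrable(2)[OF _ square_integrable, of t s], of "\<bar>g t\<bar>"]
      by (simp add: abs_mult[of "g t"] field_square)
    have G: "integrable lborel (\<lambda>t. \<bar>g t\<bar> * (c 0 + c 0))" using g by simp
    have "(LBINT t. g t * (\<xi> s \<omega> * \<xi> t \<omega>)) = \<xi> s \<omega> * smear g \<omega>" for \<omega>
      unfolding smear_def by (simp add: integral_mult_right_zero[symmetric] mult_ac del: integral_mult_right_zero)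
    with P.fubini_dominated(4)[OF m i b G] show ?thesis by (simp add: covariance)
  qed
  let ?E = "expectation (\<lambda>\<omega>. (smear g \<omega>)\<^sup>2)"
  have m: "case_prod (\<lambda>s \<omega>. g s * (\<xi> s \<omega> * smear g \<omega>)) \<in> borel_measurable (lborel \<Otimes>\<^sub>M M)" by measurable
  have i: "integrable M (\<lambda>\<omega>. g s * (\<xi> s \<omega> * smear g \<omega>))" for s
    using product_integrable(1)[OF _ smear_square_integrable[OF g], of s] by simp
  have b: "expectation (\<lambda>\<omega>. \<bar>g s * (\<xi> s \<omega> * smear g \<omega>)\<bar>) \<le> \<bar>g s\<bar> * (c 0 + ?E)" for s
    using mult_left_mono[OF product_integrable(2)[OF _ smear_square_integrable[OF g], of s], of "\<bar>g s\<bar>"]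
    by (simp add: abs_mult[of "g s"])
  have G: "integrable lborel (\<lambda>s. \<bar>g s\<bar> * (c 0 + ?E))" using g by simp
  note F = P.fubini_dominated[OF m i b G]
  have "(LBINT s. g s * (\<xi> s \<omega> * smear g \<omega>)) = (smear g \<omega>)\<^sup>2" for \<omega>
  proof -
    have "(LBINT s. g s * (\<xi> s \<omega> * smear g \<omega>)) = (LBINT s. g s * \<xi> s \<omega>) * smear g \<omega>"
      by (simp only: mult.assoc[symmetric] integral_mult_left_zero)
    then show ?thesis by (simp add: smear_def power2_eq_square)
  qed
  with F(3,4) show "?E = (LBINT s. g s * (LBINT t. g t * c (t - s)))"
    and "integrable lborel (\<lambda>s. g s * (LBINT t. g t * c (t - s)))"
    by (simp_all add: inner)
qed

lemma smear_second_moment_le: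
  assumes g: "integrable lborel g" and g1: "\<And>t. \<bar>g t\<bar> \<le> 1"
  shows "expectation (\<lambda>\<omega>. (smear g \<omega>)\<^sup>2) \<le> (LBINT t. \<bar>c t\<bar>) * (LBINT t. \<bar>g t\<bar>)"
proof -
  have [measurable]: "g \<in> borel_measurable borel" using g by auto
  have inner: "\<bar>LBINT t. g t * c (t - s)\<bar> \<le> (LBINT t. \<bar>c t\<bar>)" for s
  proof -
    have ic: "integrable lborel (\<lambda>t. \<bar>c (t - s)\<bar>)"
      using integrable_lborel_translate(1)[OF c_integrable, of "- s"] by simp
    have "\<bar>LBINT t. g t * c (t - s)\<bar> \<le> (LBINT t. \<bar>g t * c (t - s)\<bar>)"
      using integral_norm_bound[of lborel "\<lambda>t. g t * c (t - s)"] by simp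
    also have "\<dots> \<le> (LBINT t. \<bar>c (t - s)\<bar>)"
    proof (rule integral_mono[OF _ ic])
      have le: "\<bar>g t * c (t - s)\<bar> \<le> \<bar>c (t - s)\<bar>" for t
        using mult_right_mono[OF g1[of t], of "\<bar>c (t - s)\<bar>"] by (simp add: abs_mult)
      then show "\<bar>g t * c (t - s)\<bar> \<le> \<bar>c (t - s)\<bar>" for t .
      show "integrable lborel (\<lambda>t. \<bar>g t * c (t - s)\<bar>)"
        by (rule Bochner_Integration.integrable_bound[OF ic]) (use le in auto)
    qed
    also have "\<dots> = (LBINT t. \<bar>c t\<bar>)"
      using integrable_lborel_translate(2)[OF integrable_abs[OF c_integrable], of "- s"] by simp
    finally show ?thesis .
  qed
  have "expectation (\<lambda>\<omega>. (smear g \<omega>)\<^sup>2) \<le> (LBINT s. \<bar>g s\<bar> * (LBINT t. \<bar>c t\<bar>))"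
    unfolding smear_second_moment(1)[OF g]
  proof (rule integral_mono[OF smear_second_moment(2)[OF g]])
    show "g s * (LBINT t. g t * c (t - s)) \<le> \<bar>g s\<bar> * (LBINT t. \<bar>c t\<bar>)" for s
      using mult_left_mono[OF inner[of s], of "\<bar>g s\<bar>"] abs_ge_self[of "g s * (LBINT t. g t * c (t - s))"]
      by (simp only: abs_mult) linarith
  qed (use g in simp)
  then show ?thesis by (simp add: mult.commute)
qed

lemma smear_diff:
  assumes "integrable lborel g" "integrable lborel h"
  shows "AE \<omega> in M. smear g \<omega> - smear h \<omega> = smear (\<lambda>t. g t - h t) \<omega>"
  using smear_integrable(1)[OF assms(1)] smear_integrable(1)[OF assms(2)]
  by eventually_elim (simp add: smear_def left_diff_distrib)

lemma smear_sum:
  assumes "finite K" "\<And>k. k \<in> K \<Longrightarrow> integrable lborel (g k)"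
  shows "AE \<omega> in M. (\<Sum>k\<in>K. smear (g k) \<omega>) = smear (\<lambda>t. \<Sum>k\<in>K. g k t) \<omega>"
proof -
  have "AE \<omega> in M. \<forall>k\<in>K. integrable lborel (\<lambda>t. g k t * \<xi> t \<omega>)"
    using assms smear_integrable(1) by (simp add: AE_finite_all)
  then show ?thesis
    by eventually_elim (simp add: smear_def sum_distrib_right)
qed

text \<open>
  With \<open>h = t - s\<close> the variance becomes \<open>\<integral>c(h) \<lambda>(Q \<inter> (Q - h)) dh\<close>. The overlap of the cube \<open>Q\<close> of
  side \<open>p\<close> with a fixed translate of itself has asymptotically full relative measure.
\<close>

lemma smear_cube_variance_limit:
  "(\<lambda>p::nat. expectation (\<lambda>\<omega>. (smear (indicator (hbox 0 (real p))) \<omega>)\<^sup>2) / real p ^ CARD('d))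
     \<longlonglongrightarrow> (LBINT t. c t)"
proof -
  let ?Q = "\<lambda>p::nat. hbox (0 :: real ^ 'd) (real p)"
  let ?k = "\<lambda>p s h. indicator (?Q p) s * (indicator (?Q p) (s + h) * c h)"
  define ov where "ov p h = measure lborel (?Q p \<inter> {s. s + h \<in> ?Q p})" for p h
  have fQ: "?Q p \<in> fmeasurable lborel" for p by (rule measure_hbox) simp
  have fI: "?Q p \<inter> {s. s + h \<in> ?Q p} \<in> fmeasurable lborel" for p h
  proof -
    have "{s. s + h \<in> ?Q p} \<in> sets lborel" by measurable
    then show ?thesis using fmeasurable_Int_fmeasurable[OF fQ] by blast
  qed
  have iQ: "integrable lborel (indicat_real (?Q p))" for p
    by (rule integrable_indicator_fmeasurable[OF fQ])
  have second: "expectation (\<lambda>\<omega>. (smear (indicator (?Q p)) \<omega>)\<^sup>2) = (LBINT h. c h * ov p h)" for p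
  proof -
    have m: "case_prod (?k p) \<in> borel_measurable (lborel \<Otimes>\<^sub>M lborel)"
      by measurable
    have i0: "integrable lborel (\<lambda>h. indicator (?Q p) (s + h) * c h)" for s
      by (rule Bochner_Integration.integrable_bound[OF c_integrable]) (auto simp: indicator_def)
    then have i: "integrable lborel (?k p s)" for s
      by simp
    have b: "(LBINT h. \<bar>?k p s h\<bar>)
        \<le> indicator (?Q p) s * (LBINT h. \<bar>c h\<bar>)" for s
    proof -
      have "(LBINT h. \<bar>?k p s h\<bar>)
          \<le> (LBINT h. indicator (?Q p) s * \<bar>c h\<bar>)"
        by (rule integral_mono) (use i[of s] c_integrable in \<open>auto simp: indicator_def\<close>)
      then show ?thesis by simp
    qed
    have G: "integrable lborel (\<lambda>s. indicator (?Q p) s * (LBINT h. \<bar>c h\<bar>))" using iQ by simp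
    note F = lborel_pair.fubini_dominated(4)[OF m i b G]
    have "(LBINT t. indicator (?Q p) t * c (t - s)) = (LBINT h. indicator (?Q p) (s + h) * c h)" for s
    proof -
      have "integrable lborel (\<lambda>t. indicator (?Q p) t * c (t - s))"
        using integrable_lborel_translate(1)[OF i0[of s], of "- s"] by simp
      from integrable_lborel_translate(2)[OF this, of s] show ?thesis by (simp add: add.commute)
    qed
    then have "expectation (\<lambda>\<omega>. (smear (indicator (?Q p)) \<omega>)\<^sup>2)
        = (LBINT s. (LBINT h. ?k p s h))"
      unfolding smear_second_moment(1)[OF iQ] by simp
    also have "\<dots> = (LBINT h. (LBINT s. ?k p s h))"
      by (rule F[symmetric])
    also have "\<dots> = (LBINT h. c h * ov p h)"
    proof (intro Bochner_Integration.integral_cong refl)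
      fix h
      have "(LBINT s. ?k p s h)
          = (LBINT s. indicator (?Q p \<inter> {s. s + h \<in> ?Q p}) s * c h)"
        by (intro Bochner_Integration.integral_cong refl) (auto simp: indicator_def)
      also have "\<dots> = c h * ov p h"
        by (simp add: ov_def)
      finally show "(LBINT s. ?k p s h) = c h * ov p h" .
    qed
    finally show ?thesis .
  qed
  have upper: "0 \<le> ov p h / real p ^ CARD('d)" "ov p h / real p ^ CARD('d) \<le> 1" for p h
  proof -
    have "ov p h \<le> measure lborel (?Q p)"
      unfolding ov_def using fQ fI by (intro measure_mono_fmeasurable) auto
    then show "ov p h / real p ^ CARD('d) \<le> 1"
      by (cases "p = 0") (auto simp: measure_hbox field_simps zero_power)
    show "0 \<le> ov p h / real p ^ CARD('d)" by (simp add: ov_def)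
  qed
  have lim: "(\<lambda>p. ov p h / real p ^ CARD('d)) \<longlonglongrightarrow> 1" for h
  proof (rule tendsto_sandwich[OF _ _ _ tendsto_const])
    have "(\<lambda>p. (1 - 2 * norm h / real p) ^ CARD('d)) \<longlonglongrightarrow> (1 - 0) ^ CARD('d)"
      by (intro tendsto_intros tendsto_divide_0[OF tendsto_const] filterlim_real_at_infinity_sequentially)
    then show "(\<lambda>p. (1 - 2 * norm h / real p) ^ CARD('d)) \<longlonglongrightarrow> 1" by simp
    obtain p0 :: nat where p0: "2 * norm h < real p0" using reals_Archimedean2 by blast
    show "\<forall>\<^sub>F p in sequentially. (1 - 2 * norm h / real p) ^ CARD('d) \<le> ov p h / real p ^ CARD('d)"
    proof (rule eventually_sequentiallyI)
      fix p assume "p0 \<le> p"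
      with p0 have p: "2 * norm h < real p" by simp
      then have pp: "0 < real p" using norm_ge_zero[of h] by linarith
      let ?H = "hbox (\<chi> i. norm h :: real ^ 'd) (real p - 2 * norm h)"
      have comp: "\<bar>h $ i\<bar> \<le> norm h" for i by (rule component_le_norm_cart)
      have "?H \<subseteq> ?Q p \<inter> {s. s + h \<in> ?Q p}"
      proof
        fix x assume x: "x \<in> ?H"
        have "0 \<le> x $ i \<and> x $ i < real p \<and> 0 \<le> x $ i + h $ i \<and> x $ i + h $ i < real p" for i
        proof -
          have "norm h \<le> x $ i" "x $ i < norm h + (real p - 2 * norm h)"
            using x by (simp_all add: hbox_def)
          with comp[of i] norm_ge_zero[of h] show ?thesis by linarith
        qed
        then show "x \<in> ?Q p \<inter> {s. s + h \<in> ?Q p}" by (simp add: hbox_def)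
      qed
      then have "measure lborel ?H \<le> ov p h"
        unfolding ov_def using fI by (intro measure_mono_fmeasurable) auto
      then have "(real p - 2 * norm h) ^ CARD('d) / real p ^ CARD('d) \<le> ov p h / real p ^ CARD('d)"
        using p by (intro divide_right_mono) (auto simp: measure_hbox)
      also have "(real p - 2 * norm h) ^ CARD('d) / real p ^ CARD('d) = (1 - 2 * norm h / real p) ^ CARD('d)"
        using pp by (simp add: power_divide[symmetric] diff_divide_distrib)
      finally show "(1 - 2 * norm h / real p) ^ CARD('d) \<le> ov p h / real p ^ CARD('d)" .
    qed
  qed (use upper in auto)
  have ovm: "(\<lambda>h. ov p h / real p ^ CARD('d)) \<in> borel_measurable borel" for p
  proof -
    have "ov p h = (LBINT s. indicator (?Q p) s * indicator (?Q p) (s + h))" for h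
    proof -
      have "(LBINT s. indicat_real (?Q p) s * indicator (?Q p) (s + h))
          = (LBINT s. indicator (?Q p \<inter> {s. s + h \<in> ?Q p}) s)"
        by (intro Bochner_Integration.integral_cong refl) (auto simp: indicator_def)
      then show ?thesis by (simp add: ov_def)
    qed
    then show ?thesis by simp
  qed
  have clim: "(\<lambda>p. c h * (ov p h / real p ^ CARD('d))) \<longlonglongrightarrow> c h" for h
  proof -
    have "(\<lambda>p. c h * (ov p h / real p ^ CARD('d))) \<longlonglongrightarrow> c h * 1"
      by (rule tendsto_mult_left) (rule lim)
    then show ?thesis by simp
  qed
  have "(\<lambda>p. LBINT h. c h * (ov p h / real p ^ CARD('d))) \<longlonglongrightarrow> (LBINT h. c h)"
  proof (rule integral_dominated_convergence[where w = "\<lambda>h. \<bar>c h\<bar>"])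
    show "AE h in lborel. (\<lambda>p. c h * (ov p h / real p ^ CARD('d))) \<longlonglongrightarrow> c h"
      by (intro AE_I2 clim)
    show "AE h in lborel. norm (c h * (ov p h / real p ^ CARD('d))) \<le> \<bar>c h\<bar>" for p
    proof (rule AE_I2)
      fix h
      have "norm (c h * (ov p h / real p ^ CARD('d))) = \<bar>c h\<bar> * (ov p h / real p ^ CARD('d))"
        unfolding real_norm_def abs_mult[of "c h"] abs_of_nonneg[OF upper(1)[of p h]] ..
      also have "\<dots> \<le> \<bar>c h\<bar> * 1"
        by (rule mult_left_mono[OF upper(2) abs_ge_zero])
      finally show "norm (c h * (ov p h / real p ^ CARD('d))) \<le> \<bar>c h\<bar>"
        unfolding mult_1_right .
    qed
    show "(\<lambda>h. c h * (ov p h / real p ^ CARD('d))) \<in> borel_measurable lborel" for p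
      using borel_measurable_times[OF c_measurable ovm[of p]] by simp
    show "c \<in> borel_measurable lborel" by simp
    show "integrable lborel (\<lambda>h. \<bar>c h\<bar>)" by (rule integrable_abs[OF c_integrable])
  qed
  then show ?thesis by (simp add: second)
qed

end

section \<open>Characteristic functions of real random variables\<close>

lemma iexp_diff_le: "cmod (iexp x - iexp y) \<le> \<bar>x - y\<bar>"
proof -
  have "iexp x - iexp y = iexp y * (iexp (x - y) - 1)"
    by (simp add: right_diff_distrib exp_add[symmetric] algebra_simps)
  then have "cmod (iexp x - iexp y) = cmod (iexp (x - y) - 1)"
    by (simp only: norm_mult norm_exp_i_times mult_1_left)
  then show ?thesis using iexp_approx1[of "x - y" 0] by simp
qed

context prob_space
begin

abbreviation cf :: "('a \<Rightarrow> real) \<Rightarrow> complex" where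
  "cf f \<equiv> expectation (\<lambda>\<omega>. iexp (f \<omega>))"

lemma iexp_integrable [simp, intro]:
  "f \<in> borel_measurable M \<Longrightarrow> integrable M (\<lambda>\<omega>. iexp (f \<omega>))"
  by (rule integrable_const_bound[where B = 1]) auto

lemma norm_expectation_iexp_le: "cmod (cf (\<lambda>\<omega>. f \<omega>)) \<le> 1"
proof (cases "integrable M (\<lambda>\<omega>. iexp (f \<omega>))")
  case True
  have "cmod (cf (\<lambda>\<omega>. f \<omega>)) \<le> expectation (\<lambda>\<omega>. cmod (iexp (f \<omega>)))"
    by (rule integral_norm_bound)
  then show ?thesis by (simp add: prob_space)
qed (simp add: not_integrable_integral_eq)

lemma char_diff_le:
  assumes "integrable M A" "integrable M B"
  shows "cmod (cf (\<lambda>\<omega>. a * A \<omega>) - cf (\<lambda>\<omega>. a * B \<omega>))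
    \<le> \<bar>a\<bar> * expectation (\<lambda>\<omega>. \<bar>A \<omega> - B \<omega>\<bar>)"
proof -
  have [measurable]: "A \<in> borel_measurable M" "B \<in> borel_measurable M" using assms by auto
  have i: "integrable M (\<lambda>\<omega>. iexp (a * A \<omega>))" "integrable M (\<lambda>\<omega>. iexp (a * B \<omega>))"
    by (rule iexp_integrable; measurable)+
  have "cmod (cf (\<lambda>\<omega>. a * A \<omega>) - cf (\<lambda>\<omega>. a * B \<omega>))
      = cmod (expectation (\<lambda>\<omega>. iexp (a * A \<omega>) - iexp (a * B \<omega>)))"
    by (subst Bochner_Integration.integral_diff[OF i]) simp
  also have "\<dots> \<le> expectation (\<lambda>\<omega>. cmod (iexp (a * A \<omega>) - iexp (a * B \<omega>)))"
    by (rule integral_norm_bound)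
  also have "\<dots> \<le> expectation (\<lambda>\<omega>. \<bar>a\<bar> * \<bar>A \<omega> - B \<omega>\<bar>)"
  proof (rule integral_mono)
    show "cmod (iexp (a * A \<omega>) - iexp (a * B \<omega>)) \<le> \<bar>a\<bar> * \<bar>A \<omega> - B \<omega>\<bar>" for \<omega>
      using iexp_diff_le[of "a * A \<omega>" "a * B \<omega>"] by (simp only: right_diff_distrib[symmetric] abs_mult)
    show "integrable M (\<lambda>\<omega>. cmod (iexp (a * A \<omega>) - iexp (a * B \<omega>)))"
      by (intro integrable_norm Bochner_Integration.integrable_diff i)
    show "integrable M (\<lambda>\<omega>. \<bar>a\<bar> * \<bar>A \<omega> - B \<omega>\<bar>)"
      by (intro integrable_mult_right integrable_abs Bochner_Integration.integrable_diff assms)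
  qed
  finally show ?thesis by simp
qed

lemma expectation_abs_le_sqrt:
  assumes [measurable]: "Z \<in> borel_measurable M" and Z: "integrable M (\<lambda>\<omega>. (Z \<omega>)\<^sup>2)"
  shows "expectation (\<lambda>\<omega>. \<bar>Z \<omega>\<bar>) \<le> sqrt (expectation (\<lambda>\<omega>. (Z \<omega>)\<^sup>2))"
proof -
  have i: "integrable M (\<lambda>\<omega>. \<bar>Z \<omega>\<bar>)"
    by (intro integrable_abs square_integrable_imp_integrable[OF _ Z]) measurable
  have "variance (\<lambda>\<omega>. \<bar>Z \<omega>\<bar>) = expectation (\<lambda>\<omega>. \<bar>Z \<omega>\<bar>\<^sup>2) - (expectation (\<lambda>\<omega>. \<bar>Z \<omega>\<bar>))\<^sup>2"
    by (rule variance_eq[OF i]) (simp add: Z)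
  moreover have "0 \<le> variance (\<lambda>\<omega>. \<bar>Z \<omega>\<bar>)" by (rule variance_positive)
  ultimately have "(expectation (\<lambda>\<omega>. \<bar>Z \<omega>\<bar>))\<^sup>2 \<le> expectation (\<lambda>\<omega>. (Z \<omega>)\<^sup>2)" by simp
  then show ?thesis by (rule real_le_rsqrt)
qed

lemma char_tendsto_of_L1:
  assumes "\<And>n. integrable M (A n)" "integrable M B"
    and "(\<lambda>n. expectation (\<lambda>\<omega>. \<bar>A n \<omega> - B \<omega>\<bar>)) \<longlonglongrightarrow> 0"
  shows "(\<lambda>n. cf (\<lambda>\<omega>. a * A n \<omega>)) \<longlonglongrightarrow> cf (\<lambda>\<omega>. a * B \<omega>)"
proof (rule Lim_transform2[OF tendsto_const])
  show "(\<lambda>n. cf (\<lambda>\<omega>. a * B \<omega>) - cf (\<lambda>\<omega>. a * A n \<omega>)) \<longlonglongrightarrow> 0"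
  proof (rule Lim_null_comparison)
    show "(\<lambda>n. \<bar>a\<bar> * expectation (\<lambda>\<omega>. \<bar>A n \<omega> - B \<omega>\<bar>)) \<longlonglongrightarrow> 0"
      using tendsto_mult_right_zero[OF assms(3)] .
    show "\<forall>\<^sub>F n in sequentially. cmod (cf (\<lambda>\<omega>. a * B \<omega>) - cf (\<lambda>\<omega>. a * A n \<omega>))
        \<le> \<bar>a\<bar> * expectation (\<lambda>\<omega>. \<bar>A n \<omega> - B \<omega>\<bar>)"
      using char_diff_le[OF assms(1,2)] by (simp add: norm_minus_commute)
  qed
qed

text \<open>
  The central limit theorem for independent copies of \<open>Y\<close>, on the level of characteristic functions
  and with a number of factors that is only asymptotically proportional to the normalization \<open>L\<close>. Both
  \<open>\<phi>\<close> and \<open>exp(- V / (2 L))\<close> agree with \<open>1 - V / (2 L)\<close> up to \<open>o(1 / L)\<close>, and powers of numbers of modulus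
  at most one satisfy \<open>\<bar>z\<^sup>N - w\<^sup>N\<bar> \<le> N \<bar>z - w\<bar>\<close>.
\<close>

lemma char_power_limit:
  fixes L :: "nat \<Rightarrow> real" and N :: "nat \<Rightarrow> nat"
  assumes [measurable]: "Y \<in> borel_measurable M" and Y2: "integrable M (\<lambda>\<omega>. (Y \<omega>)\<^sup>2)"
    and Y0: "expectation Y = 0"
    and L: "\<And>n. 0 < L n" "filterlim L at_top sequentially"
    and N: "(\<lambda>n. real (N n) / L n) \<longlonglongrightarrow> \<kappa>"
  shows "(\<lambda>n. (cf (\<lambda>\<omega>. 1 / sqrt (L n) * Y \<omega>)) ^ N n)
    \<longlonglongrightarrow> exp (- complex_of_real (expectation (\<lambda>\<omega>. (Y \<omega>)\<^sup>2) * \<kappa>) / 2)"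
proof -
  let ?m = "\<lambda>n \<omega>. min (6 * (Y \<omega>)\<^sup>2) (\<bar>1 / sqrt (L n)\<bar> * \<bar>Y \<omega>\<bar> ^ 3)"
  define V where "V = expectation (\<lambda>\<omega>. (Y \<omega>)\<^sup>2)"
  have V: "0 \<le> V" by (simp add: V_def)
  have Yi: "integrable M Y" by (rule square_integrable_imp_integrable[OF _ Y2]) measurable
  define \<phi> where "\<phi> n = cf (\<lambda>\<omega>. 1 / sqrt (L n) * Y \<omega>)" for n
  define \<epsilon> where "\<epsilon> n = expectation (?m n)" for n
  define b where "b n = exp (- V / (2 * L n))" for n
  have sq: "(1 / sqrt (L n))\<^sup>2 = 1 / L n" for n using L(1)[of n] by (simp add: power_divide)
  have invL: "(\<lambda>n. inverse (L n)) \<longlonglongrightarrow> 0"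
    using L(2) by (rule tendsto_inverse_0_at_top)
  have approx: "cmod (\<phi> n - (1 - V / (2 * L n))) \<le> \<epsilon> n / (6 * L n)" for n
  proof -
    have "variance Y = V" by (simp add: Y0 V_def)
    from char_approx3'[OF _ Yi Y2 Y0 this refl, of "1 / sqrt (L n)"]
    show ?thesis
      unfolding sq by (simp add: char_def integral_distr \<phi>_def \<epsilon>_def mult.commute)
  qed
  have \<epsilon>: "\<epsilon> \<longlonglongrightarrow> 0"
  proof -
    have "(\<lambda>n. expectation (?m n)) \<longlonglongrightarrow> expectation (\<lambda>\<omega>. 0)"
    proof (rule integral_dominated_convergence[where w = "\<lambda>\<omega>. 6 * (Y \<omega>)\<^sup>2"])
      have "(\<lambda>n. 1 / sqrt (L n)) \<longlonglongrightarrow> 0"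
        using tendsto_real_sqrt[OF invL] by (simp add: real_sqrt_divide inverse_eq_divide)
      then have 0: "(\<lambda>n. \<bar>1 / sqrt (L n)\<bar>) \<longlonglongrightarrow> 0" by (rule tendsto_rabs_zero)
      show "AE \<omega> in M. (\<lambda>n. ?m n \<omega>) \<longlonglongrightarrow> 0"
      proof (rule AE_I2)
        fix \<omega>
        have "(\<lambda>n. ?m n \<omega>) \<longlonglongrightarrow> min (6 * (Y \<omega>)\<^sup>2) (0 * \<bar>Y \<omega>\<bar> ^ 3)"
          by (intro tendsto_min tendsto_const tendsto_mult 0)
        then show "(\<lambda>n. ?m n \<omega>) \<longlonglongrightarrow> 0" by simp
      qed
      show "AE \<omega> in M. norm (?m n \<omega>) \<le> 6 * (Y \<omega>)\<^sup>2" for n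
        by (rule AE_I2) (simp add: abs_of_nonneg)
    qed (use Y2 in \<open>simp_all\<close>)
    then show ?thesis by (simp add: \<epsilon>_def[abs_def])
  qed
  have b_le: "\<bar>(1 - V / (2 * L n)) - b n\<bar> \<le> (V / (2 * L n))\<^sup>2" for n
  proof -
    define x where "x = V / (2 * L n)"
    have x: "0 \<le> x" using V L(1)[of n] by (simp add: x_def)
    have "exp (- x) \<le> 1 / (1 + x)"
      using exp_ge_add_one_self[of x] x by (simp add: exp_minus field_simps)
    also have "\<dots> \<le> 1 - x + x\<^sup>2"
    proof -
      have "0 \<le> x * (x * x)" using x by simp
      then have "1 \<le> (1 - x + x\<^sup>2) * (1 + x)" by (simp add: power2_eq_square algebra_simps)
      then show ?thesis using x by (simp add: divide_le_eq)
    qed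
    finally have "exp (- x) - (1 - x) \<le> x\<^sup>2" by simp
    moreover have "1 - x \<le> exp (- x)" using exp_ge_add_one_self[of "- x"] by simp
    ultimately show ?thesis by (simp add: b_def x_def[symmetric] abs_le_iff)
  qed
  let ?r = "\<lambda>n. real (N n) / L n * (\<epsilon> n / 6 + V\<^sup>2 / 4 * inverse (L n))"
  have diff: "cmod (\<phi> n ^ N n - complex_of_real (b n) ^ N n) \<le> ?r n" for n
  proof -
    have "0 \<le> b n" "b n \<le> 1" using V L(1)[of n] by (auto simp: b_def divide_nonneg_pos)
    moreover have "cmod (\<phi> n) \<le> 1" unfolding \<phi>_def by (rule norm_expectation_iexp_le)
    ultimately have "cmod (\<phi> n ^ N n - complex_of_real (b n) ^ N n) \<le> real (N n) * cmod (\<phi> n - complex_of_real (b n))"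
      by (intro norm_power_diff) auto
    also have "cmod (\<phi> n - complex_of_real (b n)) \<le> \<epsilon> n / (6 * L n) + (V / (2 * L n))\<^sup>2"
    proof -
      have "\<phi> n - complex_of_real (b n) = (\<phi> n - (1 - V / (2 * L n))) + complex_of_real ((1 - V / (2 * L n)) - b n)"
        by simp
      also have "cmod \<dots> \<le> cmod (\<phi> n - (1 - V / (2 * L n))) + cmod (complex_of_real ((1 - V / (2 * L n)) - b n))"
        by (rule norm_triangle_ineq)
      also have "\<dots> \<le> \<epsilon> n / (6 * L n) + (V / (2 * L n))\<^sup>2"
        using approx[of n] b_le[of n] unfolding norm_of_real by (rule add_mono)
      finally show ?thesis .
    qed
    also have "real (N n) * (\<epsilon> n / (6 * L n) + (V / (2 * L n))\<^sup>2) = ?r n"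
      using L(1)[of n] by (simp add: field_simps power2_eq_square)
    finally show ?thesis by (simp add: mult_left_mono)
  qed
  have "(\<lambda>n. \<phi> n ^ N n - complex_of_real (b n) ^ N n) \<longlonglongrightarrow> 0"
  proof (rule Lim_null_comparison)
    have "?r \<longlonglongrightarrow> \<kappa> * (0 / 6 + V\<^sup>2 / 4 * 0)"
      by (intro tendsto_intros N \<epsilon> invL) simp
    then show "?r \<longlonglongrightarrow> 0" by simp
  qed (use diff in simp)
  moreover have "(\<lambda>n. complex_of_real (b n) ^ N n) \<longlonglongrightarrow> exp (- complex_of_real (V * \<kappa>) / 2)"
  proof -
    have "b n ^ N n = exp (- (V / 2) * (real (N n) / L n))" for n
      by (simp add: b_def exp_of_nat_mult[symmetric] field_simps)
    moreover have "(\<lambda>n. exp (- (V / 2) * (real (N n) / L n))) \<longlonglongrightarrow> exp (- (V / 2) * \<kappa>)"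
      by (intro tendsto_intros N)
    ultimately have "(\<lambda>n. complex_of_real (b n ^ N n)) \<longlonglongrightarrow> complex_of_real (exp (- (V / 2) * \<kappa>))"
      by (intro tendsto_of_real) simp
    then show ?thesis by (simp add: exp_of_real[symmetric])
  qed
  ultimately have "(\<lambda>n. (\<phi> n ^ N n - complex_of_real (b n) ^ N n) + complex_of_real (b n) ^ N n)
      \<longlonglongrightarrow> 0 + exp (- complex_of_real (V * \<kappa>) / 2)"
    by (rule tendsto_add)
  then show ?thesis by (simp add: \<phi>_def V_def)
qed

end

section \<open>From grids to cubes\<close>

lemma lattice_point_shift:
  assumes "0 < m"
  shows "lattice_point (1 / real m) (\<lambda>i. j i + int (m * b) * k i)
    = lattice_point (1 / real m) j + lattice_point (real b) k"
  using assms by (simp add: lattice_point_def vec_eq_iff field_simps)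

lemma lattice_point_inj: "0 < m \<Longrightarrow> inj (lattice_point (1 / real m))"
  by (auto simp: inj_def lattice_point_def vec_eq_iff)

lemma lattice_point_in_grid: "lattice_point (1 / real m) j \<in> grid (real m)"
  by (auto simp: grid_def lattice_point_def)

lemma le_l1_setdist:
  assumes "finite I" "finite J" "I \<noteq> {}" "J \<noteq> {}"
    and "\<And>x y. x \<in> I \<Longrightarrow> y \<in> J \<Longrightarrow> r \<le> l1_norm (x - y)"
  shows "r \<le> l1_setdist I J"
proof -
  have "{l1_norm (x - y) | x y. x \<in> I \<and> y \<in> J} = (\<lambda>(x, y). l1_norm (x - y)) ` (I \<times> J)"
    by auto
  then show ?thesis
    using assms by (auto simp: l1_setdist_def)
qed

text \<open>
  What the block argument needs from stationarity and \<open>BL(\<theta>)\<close>-dependence, expressed for a scalar field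
  by means of increments and characteristic functions only.
\<close>

locale mixing_field = L2_field M \<xi> c
  for M :: "'a measure" and \<xi> :: "real ^ 'd \<Rightarrow> 'a \<Rightarrow> real" and c +
  fixes \<eta> :: "nat \<Rightarrow> real"
  assumes increment_stationary:
      "\<And>s t. expectation (\<lambda>\<omega>. \<bar>\<xi> (s + t) \<omega> - \<xi> s \<omega>\<bar>) = expectation (\<lambda>\<omega>. \<bar>\<xi> t \<omega> - \<xi> 0 \<omega>\<bar>)"
    and sum_stationary:
      "\<And>I h a. finite I \<Longrightarrow> cf (\<lambda>\<omega>. a * (\<Sum>t\<in>I. \<xi> (t + h) \<omega>))
         = cf (\<lambda>\<omega>. a * (\<Sum>t\<in>I. \<xi> t \<omega>))"
    and grid_mixing:
      "\<And>r m I J a. 1 \<le> r \<Longrightarrow> 1 < m \<Longrightarrow> finite I \<Longrightarrow> finite J \<Longrightarrow> I \<noteq> {} \<Longrightarrow> J \<noteq> {} \<Longrightarrow>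
         I \<subseteq> grid (real m) \<Longrightarrow> J \<subseteq> grid (real m) \<Longrightarrow> I \<inter> J = {} \<Longrightarrow> real r \<le> l1_setdist I J \<Longrightarrow>
         cmod (cf (\<lambda>\<omega>. a * ((\<Sum>t\<in>I. \<xi> t \<omega>) + (\<Sum>t\<in>J. \<xi> t \<omega>)))
             - cf (\<lambda>\<omega>. a * (\<Sum>t\<in>I. \<xi> t \<omega>)) * cf (\<lambda>\<omega>. a * (\<Sum>t\<in>J. \<xi> t \<omega>)))
           \<le> real (card I) * a\<^sup>2 * real m ^ CARD('d) * \<eta> r"
    and rate_nonneg: "\<And>r. 1 \<le> r \<Longrightarrow> 0 \<le> \<eta> r"
    and rate_tendsto_0: "\<eta> \<longlonglongrightarrow> 0"
begin

definition increment :: "real ^ 'd \<Rightarrow> real" where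
  "increment h = expectation (\<lambda>\<omega>. \<bar>\<xi> h \<omega> - \<xi> 0 \<omega>\<bar>)"

lemma increment_eq: "expectation (\<lambda>\<omega>. \<bar>\<xi> t \<omega> - \<xi> s \<omega>\<bar>) = increment (t - s)"
  using increment_stationary[of s "t - s"] by (simp add: increment_def)

lemma increment_nonneg: "0 \<le> increment h"
  by (simp add: increment_def)

text \<open>
  By stationarity \<open>increment h\<close> is also the average of \<open>E\<bar>\<xi>(t + h) - \<xi>(t)\<bar>\<close> over the unit cube. After
  exchanging expectation and integral, the continuity of translations in \<open>L\<^sup>1\<close> applies to almost every
  path, cut off to a ball \<open>D\<close> that contains the cube and all its translates by vectors of norm at most
  one; twice the \<open>L\<^sup>1\<close>-norm of the path on \<open>D\<close> is an integrable majorant.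
\<close>

lemma increment_tendsto_0:
  assumes h: "h \<longlonglongrightarrow> 0"
  shows "(\<lambda>n. increment (h n)) \<longlonglongrightarrow> 0"
proof -
  let ?Q = "hbox (0 :: real ^ 'd) 1"
  define D :: "(real ^ 'd) set" where "D = cball 0 (CARD('d) + 1)"
  have [measurable]: "D \<in> sets borel" by (simp add: D_def borel_closed)
  have fD: "D \<in> fmeasurable lborel" by (simp add: D_def fmeasurable_compact)
  then have iD: "integrable lborel (indicat_real D)"
    by (rule integrable_indicator_fmeasurable)
  define g where "g \<omega> t = indicator D t * \<xi> t \<omega>" for \<omega> t
  have [measurable]: "(\<lambda>x. g (f x) (u x)) \<in> borel_measurable N"
    if [measurable]: "f \<in> measurable N M" "u \<in> borel_measurable N" for f u N
    unfolding g_def by measurable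
  have ig: "integrable M (\<lambda>\<omega>. g \<omega> t)" for t
    unfolding g_def using field_integrable by simp
  have bg: "expectation (\<lambda>\<omega>. \<bar>g \<omega> t\<bar>) \<le> indicator D t * (1 + c 0)" for t
    using expectation_abs_field_le[of t] by (simp add: g_def abs_mult indicator_def)
  have iG: "integrable lborel (\<lambda>t. indicator D t * (1 + c 0))" using iD by simp
  have mg: "case_prod (\<lambda>t \<omega>. g \<omega> t) \<in> borel_measurable (lborel \<Otimes>\<^sub>M M)" by measurable
  note F = P.fubini_dominated[OF mg ig bg iG]
  have mg': "case_prod (\<lambda>t \<omega>. \<bar>g \<omega> t\<bar>) \<in> borel_measurable (lborel \<Otimes>\<^sub>M M)" by measurable
  have bg': "expectation (\<lambda>\<omega>. \<bar>\<bar>g \<omega> t\<bar>\<bar>) \<le> indicator D t * (1 + c 0)" for t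
    using bg[of t] by simp
  note F' = P.fubini_dominated[OF mg' integrable_abs[OF ig] bg' iG]
  define \<Phi> where "\<Phi> n \<omega> = (LBINT t. \<bar>g \<omega> (t + h n) - g \<omega> t\<bar>)" for n \<omega>
  have "(\<lambda>n. expectation (\<Phi> n)) \<longlonglongrightarrow> expectation (\<lambda>\<omega>. 0)"
  proof (rule integral_dominated_convergence[where w = "\<lambda>\<omega>. 2 * (LBINT t. \<bar>g \<omega> t\<bar>)"])
    show "AE \<omega> in M. (\<lambda>n. \<Phi> n \<omega>) \<longlonglongrightarrow> 0"
      using F(1) by eventually_elim (simp add: \<Phi>_def L1_translation_continuous[OF _ h])
    show "AE \<omega> in M. norm (\<Phi> n \<omega>) \<le> 2 * (LBINT t. \<bar>g \<omega> t\<bar>)" for n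
      using F(1)
    proof eventually_elim
      case (elim \<omega>)
      have tr: "integrable lborel (\<lambda>t. g \<omega> (t + h n))" by (rule integrable_lborel_translate(1)[OF elim])
      have "\<Phi> n \<omega> \<le> (LBINT t. \<bar>g \<omega> (t + h n)\<bar> + \<bar>g \<omega> t\<bar>)"
        unfolding \<Phi>_def using elim tr by (intro integral_mono) auto
      also have "\<dots> = (LBINT t. \<bar>g \<omega> (t + h n)\<bar>) + (LBINT t. \<bar>g \<omega> t\<bar>)"
        using elim tr by simp
      also have "(LBINT t. \<bar>g \<omega> (t + h n)\<bar>) = (LBINT t. \<bar>g \<omega> t\<bar>)"
        by (rule integrable_lborel_translate(2)[OF integrable_abs[OF elim]])
      finally show ?case by (simp add: \<Phi>_def)
    qed
    show "\<Phi> n \<in> borel_measurable M" for n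
      unfolding \<Phi>_def by measurable
    show "integrable M (\<lambda>\<omega>. 2 * (LBINT t. \<bar>g \<omega> t\<bar>))"
      by (rule integrable_mult_right[OF F'(2)])
  qed simp
  then have lim: "(\<lambda>n. expectation (\<Phi> n)) \<longlonglongrightarrow> 0" by simp
  have le: "increment (h n) \<le> expectation (\<Phi> n)" if hn: "norm (h n) \<le> 1" for n
  proof -
    let ?k = "\<lambda>t \<omega>. \<bar>g \<omega> (t + h n) - g \<omega> t\<bar>"
    have m: "case_prod ?k \<in> borel_measurable (lborel \<Otimes>\<^sub>M M)" by measurable
    have i: "integrable M (?k t)" for t using ig by simp
    have b: "expectation (\<lambda>\<omega>. \<bar>?k t \<omega>\<bar>)
        \<le> indicator D (t + h n) * (1 + c 0) + indicator D t * (1 + c 0)" for t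
    proof -
      have "expectation (\<lambda>\<omega>. \<bar>?k t \<omega>\<bar>) \<le> expectation (\<lambda>\<omega>. \<bar>g \<omega> (t + h n)\<bar> + \<bar>g \<omega> t\<bar>)"
        using ig by (intro integral_mono) auto
      also have "\<dots> = expectation (\<lambda>\<omega>. \<bar>g \<omega> (t + h n)\<bar>) + expectation (\<lambda>\<omega>. \<bar>g \<omega> t\<bar>)"
        using ig by simp
      finally show ?thesis using bg[of t] bg[of "t + h n"] by linarith
    qed
    have G: "integrable lborel (\<lambda>t. indicator D (t + h n) * (1 + c 0) + indicator D t * (1 + c 0))"
      by (intro Bochner_Integration.integrable_add iG integrable_lborel_translate(1)[OF iG])
    note E = P.fubini_dominated[OF m i b G]
    have "increment (h n) = (LBINT t. indicator ?Q t * increment (h n))"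
      using measure_hbox(2)[of 1 "0 :: real ^ 'd"] by simp
    also have "\<dots> \<le> (LBINT t. expectation (?k t))"
    proof (rule integral_mono)
      show "integrable lborel (\<lambda>t. indicator ?Q t * increment (h n))"
        by (intro integrable_mult_left integrable_indicator_fmeasurable measure_hbox(3)) simp
      show "indicator ?Q t * increment (h n) \<le> expectation (?k t)" for t
      proof (cases "t \<in> ?Q")
        case True
        have "norm t \<le> CARD('d)"
          using norm_diff_hbox_le[OF True, of 0] by (simp add: hbox_def)
        then have "t \<in> D" "t + h n \<in> D"
          using hn norm_triangle_ineq[of t "h n"] by (auto simp: D_def)
        then have "expectation (?k t) = increment (h n)"
          using increment_eq[of "t + h n" t] by (simp add: g_def)
        then show ?thesis using True by simp
      qed simp
    qed (rule E(3))
    also have "\<dots> = expectation (\<Phi> n)" unfolding \<Phi>_def by (rule E(4)[symmetric])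
    finally show ?thesis .
  qed
  show ?thesis
  proof (rule tendsto_sandwich[OF _ _ tendsto_const lim])
    have "\<forall>\<^sub>F n in sequentially. norm (h n) < 1"
      using tendsto_norm_zero[OF h] by (intro order_tendstoD) auto
    then show "\<forall>\<^sub>F n in sequentially. increment (h n) \<le> expectation (\<Phi> n)"
      by eventually_elim (simp add: le)
  qed (simp add: increment_nonneg)
qed

lemma increment_small:
  assumes "0 < e"
  obtains \<delta> where "0 < \<delta>" "\<And>h. norm h < \<delta> \<Longrightarrow> increment h < e"
proof -
  have "eventually (\<lambda>h. increment h < e) (nhds 0)"
    unfolding eventually_nhds_iff_sequentially
    using order_tendstoD(2)[OF increment_tendsto_0 assms] by blast
  then show thesis using that by (auto simp: eventually_nhds_metric dist_norm)
qed

definition block :: "nat \<Rightarrow> nat \<Rightarrow> ('d \<Rightarrow> int) \<Rightarrow> 'a \<Rightarrow> real" where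
  "block b p k = smear (indicator (hbox (lattice_point (real b) k) (real p)))"

definition riemann_sum :: "nat \<Rightarrow> nat \<Rightarrow> nat \<Rightarrow> ('d \<Rightarrow> int) \<Rightarrow> 'a \<Rightarrow> real" where
  "riemann_sum m b p k \<omega> =
     (1 / real m) ^ CARD('d) * (\<Sum>j\<in>subgrid m b p k. \<xi> (lattice_point (1 / real m) j) \<omega>)"

lemma indicator_hbox_integrable:
  "0 \<le> r \<Longrightarrow> integrable lborel (indicat_real (hbox (a :: real ^ 'd) r))"
  by (intro integrable_indicator_fmeasurable measure_hbox(3))

abbreviation riemann_error :: "nat \<Rightarrow> nat \<Rightarrow> nat \<Rightarrow> ('d \<Rightarrow> int) \<Rightarrow> real" where
  "riemann_error m b p k \<equiv> expectation (\<lambda>\<omega>. \<bar>riemann_sum m b p k \<omega> - block b p k \<omega>\<bar>)"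

lemma block_integrable: "integrable M (block b p k)"
  unfolding block_def by (intro smear_integrable indicator_hbox_integrable) simp

lemma riemann_sum_integrable: "integrable M (riemann_sum m b p k)"
  unfolding riemann_sum_def by (intro integrable_mult_right Bochner_Integration.integrable_sum field_integrable)

text \<open>
  On a cell of mesh \<open>1 / m\<close> the path is compared with its value at the corner of the cell, at a distance
  of at most \<open>d / m\<close>.
\<close>

lemma riemann_sum_error:
  assumes m: "0 < m" and e: "\<And>h. norm h \<le> CARD('d) / m \<Longrightarrow> increment h \<le> e"
  shows "riemann_error m b p k \<le> real p ^ CARD('d) * e"
proof -
  let ?J = "subgrid m b p k" and ?t = "lattice_point (1 / real m)"
  let ?C = "\<lambda>j. hbox (?t j) (1 / real m)" and ?Q = "hbox (lattice_point (real b) k) (real p)"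
  define D where "D t \<omega> = (\<Sum>j\<in>?J. indicator (?C j) t * (\<xi> t \<omega> - \<xi> (?t j) \<omega>))" for t \<omega>
  have mD: "case_prod D \<in> borel_measurable (lborel \<Otimes>\<^sub>M M)"
    unfolding D_def by measurable
  have iD: "integrable M (D t)" for t
    unfolding D_def using field_integrable by simp
  have bD: "expectation (\<lambda>\<omega>. \<bar>D t \<omega>\<bar>) \<le> indicator ?Q t * e" for t
  proof -
    have "expectation (\<lambda>\<omega>. \<bar>D t \<omega>\<bar>) \<le> expectation (\<lambda>\<omega>. \<Sum>j\<in>?J. indicator (?C j) t * \<bar>\<xi> t \<omega> - \<xi> (?t j) \<omega>\<bar>)"
    proof (rule integral_mono)
      show "\<bar>D t \<omega>\<bar> \<le> (\<Sum>j\<in>?J. indicator (?C j) t * \<bar>\<xi> t \<omega> - \<xi> (?t j) \<omega>\<bar>)" for \<omega>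
        unfolding D_def by (rule order_trans[OF sum_abs]) (simp add: abs_mult)
    qed (use iD field_integrable in auto)
    also have "\<dots> = (\<Sum>j\<in>?J. indicator (?C j) t * increment (t - ?t j))"
      using field_integrable by (simp add: increment_eq)
    also have "\<dots> \<le> (\<Sum>j\<in>?J. indicator (?C j) t * e)"
    proof (rule sum_mono)
      fix j
      have "t \<in> ?C j \<Longrightarrow> norm (t - ?t j) \<le> CARD('d) / m"
        using norm_diff_hbox_le[of t "?t j" "1 / real m" "?t j"] m by (simp add: hbox_def)
      then show "indicator (?C j) t * increment (t - ?t j) \<le> indicator (?C j) t * e"
        using e by (auto simp: indicator_def)
    qed
    also have "\<dots> = indicator ?Q t * e"
      by (simp add: indicator_hbox_subgrid[OF m] sum_distrib_right)
    finally show ?thesis .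
  qed
  have G: "integrable lborel (\<lambda>t. indicator ?Q t * e)"
    by (intro integrable_mult_left indicator_hbox_integrable) simp
  note F = P.fubini_dominated[OF mD iD bD G]
  have "AE \<omega> in M. (LBINT t. D t \<omega>) = block b p k \<omega> - riemann_sum m b p k \<omega>"
    using smear_integrable(1)[OF indicator_hbox_integrable[OF of_nat_0_le_iff], of "lattice_point (real b) k" p]
  proof eventually_elim
    case (elim \<omega>)
    have C: "integrable lborel (\<lambda>t. indicator (?C j) t * \<xi> (?t j) \<omega>)" for j
      by (intro integrable_mult_left indicator_hbox_integrable) simp
    have "(LBINT t. D t \<omega>) = (LBINT t. indicator ?Q t * \<xi> t \<omega> - (\<Sum>j\<in>?J. indicator (?C j) t * \<xi> (?t j) \<omega>))"
      by (simp add: D_def indicator_hbox_subgrid[OF m] sum_distrib_right right_diff_distrib sum_subtractf)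
    also have "\<dots> = block b p k \<omega> - (\<Sum>j\<in>?J. LBINT t. indicator (?C j) t * \<xi> (?t j) \<omega>)"
      using elim C by (simp add: block_def smear_def)
    also have "(\<Sum>j\<in>?J. LBINT t. indicator (?C j) t * \<xi> (?t j) \<omega>) = riemann_sum m b p k \<omega>"
      by (simp add: measure_hbox riemann_sum_def sum_distrib_left)
    finally show ?case .
  qed
  then have "riemann_error m b p k = expectation (\<lambda>\<omega>. \<bar>LBINT t. D t \<omega>\<bar>)"
    using F(2) block_integrable riemann_sum_integrable
    by (intro integral_cong_AE) (auto simp: abs_minus_commute)
  also have "\<dots> \<le> (LBINT t. indicator ?Q t * e)" by (rule F(5))
  also have "\<dots> = real p ^ CARD('d) * e" by (simp add: measure_hbox)
  finally show ?thesis .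
qed

lemma riemann_sum_tendsto_block:
  "(\<lambda>m. riemann_error m b p k) \<longlonglongrightarrow> 0"
proof (rule LIMSEQ_I)
  fix r :: real assume r: "0 < r"
  define e where "e = r / (real p ^ CARD('d) + 1)"
  have "0 < e" using r by (simp add: e_def add_nonneg_pos)
  obtain \<delta> where \<delta>: "0 < \<delta>" "\<And>h. norm h < \<delta> \<Longrightarrow> increment h < e"
    using increment_small[OF \<open>0 < e\<close>] by blast
  obtain m0 :: nat where m0: "CARD('d) / \<delta> < real m0" using reals_Archimedean2 by blast
  have "norm (riemann_error m b p k - 0) < r" if "m0 \<le> m" for m
  proof -
    have pos: "0 < CARD('d) / \<delta>" using \<delta>(1) by simp
    have mm: "CARD('d) / \<delta> < real m" using m0 that by simp
    then have m: "0 < m" using pos by (cases m) auto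
    have "CARD('d) / m < \<delta>" using mm m \<delta>(1) by (simp add: field_simps)
    then have "riemann_error m b p k \<le> real p ^ CARD('d) * e"
      using \<delta>(2) by (intro riemann_sum_error m) (auto intro!: less_imp_le)
    also have "\<dots> < (real p ^ CARD('d) + 1) * e" using \<open>0 < e\<close> by simp
    also have "\<dots> = r"
    proof -
      have "real p ^ CARD('d) + 1 \<noteq> 0" using zero_le_power[of "real p" "CARD('d)"] by linarith
      then show ?thesis by (simp add: e_def)
    qed
    finally show ?thesis by simp
  qed
  then show "\<exists>no. \<forall>m\<ge>no. norm (riemann_error m b p k - 0) < r"
    by blast
qed

lemma riemann_sums_char_tendsto:
  assumes "finite K"
  shows "(\<lambda>m. cf (\<lambda>\<omega>. a * (\<Sum>k\<in>K. riemann_sum m b p k \<omega>)))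
    \<longlonglongrightarrow> cf (\<lambda>\<omega>. a * (\<Sum>k\<in>K. block b p k \<omega>))"
proof (rule char_tendsto_of_L1)
  let ?D = "\<lambda>m. expectation (\<lambda>\<omega>. \<bar>(\<Sum>k\<in>K. riemann_sum m b p k \<omega>) - (\<Sum>k\<in>K. block b p k \<omega>)\<bar>)"
  have i: "integrable M (\<lambda>\<omega>. \<bar>riemann_sum m b p k \<omega> - block b p k \<omega>\<bar>)" for m k
    using riemann_sum_integrable block_integrable by simp
  show "(\<lambda>m. ?D m) \<longlonglongrightarrow> 0"
  proof (rule tendsto_sandwich[OF _ _ tendsto_const])
    show "(\<lambda>m. \<Sum>k\<in>K. riemann_error m b p k) \<longlonglongrightarrow> 0"
      using tendsto_sum[of K, OF riemann_sum_tendsto_block] by simp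
    have "?D m
        \<le> (\<Sum>k\<in>K. riemann_error m b p k)" for m
    proof -
      have "?D m
          \<le> expectation (\<lambda>\<omega>. \<Sum>k\<in>K. \<bar>riemann_sum m b p k \<omega> - block b p k \<omega>\<bar>)"
        using i riemann_sum_integrable block_integrable
        by (intro integral_mono) (auto simp: sum_subtractf[symmetric])
      also have "\<dots> = (\<Sum>k\<in>K. riemann_error m b p k)"
        by (rule Bochner_Integration.integral_sum) (rule i)
      finally show ?thesis .
    qed
    then show "\<forall>\<^sub>F m in sequentially. ?D m
        \<le> (\<Sum>k\<in>K. riemann_error m b p k)"
      by simp
  qed simp
qed (use riemann_sum_integrable block_integrable in auto)

lemma block_char_stationary:
  "cf (\<lambda>\<omega>. a * block b p k \<omega>) = cf (\<lambda>\<omega>. a * block b p (\<lambda>_. 0) \<omega>)"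
proof -
  have "cf (\<lambda>\<omega>. a * riemann_sum m b p k \<omega>) = cf (\<lambda>\<omega>. a * riemann_sum m b p (\<lambda>_. 0) \<omega>)"
    if m: "0 < m" for m
  proof -
    let ?t = "lattice_point (1 / real m) :: ('d \<Rightarrow> int) \<Rightarrow> real ^ 'd" and ?J = "subgrid m b p (\<lambda>_. 0) :: ('d \<Rightarrow> int) set"
    let ?h = "lattice_point (real b) k" and ?a = "a * (1 / real m) ^ CARD('d)"
    have inj: "inj_on (\<lambda>j i. j i + int (m * b) * k i) ?J"
      by (auto simp: inj_on_def fun_eq_iff)
    have injt: "inj_on ?t ?J" using lattice_point_inj[OF m] inj_on_subset by blast
    have "(\<Sum>j\<in>subgrid m b p k. \<xi> (?t j) \<omega>) = (\<Sum>j\<in>?J. \<xi> (?t j + ?h) \<omega>)" for \<omega>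
      unfolding subgrid_shift[of m b p k] sum.reindex[OF inj] by (simp only: o_def lattice_point_shift[OF m])
    then have "(\<Sum>j\<in>subgrid m b p k. \<xi> (?t j) \<omega>) = (\<Sum>t\<in>?t ` ?J. \<xi> (t + ?h) \<omega>)" for \<omega>
      by (simp add: sum.reindex[OF injt])
    moreover have "(\<Sum>j\<in>?J. \<xi> (?t j) \<omega>) = (\<Sum>t\<in>?t ` ?J. \<xi> t \<omega>)" for \<omega>
      by (simp add: sum.reindex[OF injt])
    ultimately show ?thesis
      using sum_stationary[of "?t ` ?J" ?a ?h] subgrid_card(1)[of m b p "\<lambda>_ :: 'd. 0"]
      by (simp only: riemann_sum_def mult.assoc[symmetric] finite_imageI)
  qed
  then have ev: "\<forall>\<^sub>F m in sequentially. cf (\<lambda>\<omega>. a * riemann_sum m b p (\<lambda>_. 0) \<omega>)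
      = cf (\<lambda>\<omega>. a * riemann_sum m b p k \<omega>)"
    by (intro eventually_sequentiallyI[of 1]) simp
  have 1: "(\<lambda>m. cf (\<lambda>\<omega>. a * riemann_sum m b p k \<omega>)) \<longlonglongrightarrow> cf (\<lambda>\<omega>. a * block b p k \<omega>)" for k
    using riemann_sums_char_tendsto[of "{k}" a b p] by simp
  show ?thesis
    by (rule LIMSEQ_unique[OF 1]) (rule Lim_transform_eventually[OF 1 ev])
qed

text \<open>
  One block is decoupled from a union of arbitrarily many others, at a cost proportional to its own
  volume. The bound holds for the Riemann sums with every mesh \<open>1 / m < 1\<close>: the \<open>(m p)\<^sup>d\<close> grid points in a
  block, the factor \<open>m\<^sup>d\<close> of the dependence condition and the square of the weight \<open>m\<^bsup>-d\<^esup>\<close> multiply to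
  \<open>p\<^sup>d\<close>. Then let \<open>m \<rightarrow> \<infinity>\<close>.
\<close>

lemma block_mixing:
  assumes K: "finite K" "K \<noteq> {}" "k \<notin> K" and p: "1 \<le> p" and q: "1 \<le> q"
  shows "cmod (cf (\<lambda>\<omega>. a * (block (p + q) p k \<omega> + (\<Sum>l\<in>K. block (p + q) p l \<omega>)))
      - cf (\<lambda>\<omega>. a * block (p + q) p k \<omega>)
        * cf (\<lambda>\<omega>. a * (\<Sum>l\<in>K. block (p + q) p l \<omega>)))
    \<le> real p ^ CARD('d) * a\<^sup>2 * \<eta> q"
proof -
  let ?b = "p + q"
  define A where "A m = (\<lambda>\<omega>. riemann_sum m ?b p k \<omega>)" for m
  define B where "B m = (\<lambda>\<omega>. \<Sum>l\<in>K. riemann_sum m ?b p l \<omega>)" for m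
  define d where "d m = cf (\<lambda>\<omega>. a * (A m \<omega> + B m \<omega>))
      - cf (\<lambda>\<omega>. a * A m \<omega>) * cf (\<lambda>\<omega>. a * B m \<omega>)" for m
  have bound: "cmod (d m) \<le> real p ^ CARD('d) * a\<^sup>2 * \<eta> q" if m: "1 < m" for m
  proof -
    have m0: "0 < m" using m by simp
    let ?t = "lattice_point (1 / real m) :: ('d \<Rightarrow> int) \<Rightarrow> real ^ 'd"
    let ?S = "subgrid m ?b p :: ('d \<Rightarrow> int) \<Rightarrow> _"
    let ?a = "a * (1 / real m) ^ CARD('d)"
    let ?I = "?t ` ?S k" and ?J = "?t ` (\<Union>l\<in>K. ?S l)"
    have injt: "inj_on ?t S" for S using lattice_point_inj[OF m0] inj_on_subset by blast
    have sep: "real q \<le> l1_norm (?t j - ?t j')"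
      if "l \<noteq> l'" "j \<in> ?S l" "j' \<in> ?S l'" for l l' j j'
      by (rule subgrid_separated[OF m0 that])
    have disj: "?S l \<inter> ?S l' = {}" if "l \<noteq> l'" for l l' :: "'d \<Rightarrow> int"
      using sep[OF that] q by (fastforce simp: l1_norm_def)
    have card: "card ?I = (m * p) ^ CARD('d)" by (simp add: card_image[OF injt] subgrid_card)
    have ne: "?S l \<noteq> {}" for l :: "'d \<Rightarrow> int"
    proof
      assume "?S l = {}"
      then have "(m * p) ^ CARD('d) = 0" using subgrid_card(2)[of m ?b p l] by simp
      then show False using m p by simp
    qed
    have I: "a * A m \<omega> = ?a * (\<Sum>t\<in>?I. \<xi> t \<omega>)" for \<omega>
      by (simp add: A_def riemann_sum_def sum.reindex[OF injt])
    have J: "a * B m \<omega> = ?a * (\<Sum>t\<in>?J. \<xi> t \<omega>)" for \<omega>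
    proof -
      have "(\<Sum>t\<in>?J. \<xi> t \<omega>) = (\<Sum>l\<in>K. \<Sum>j\<in>?S l. \<xi> (?t j) \<omega>)"
        using K(1) disj by (subst sum.reindex[OF injt], subst sum.UNION_disjoint) (auto simp: subgrid_card)
      then show ?thesis by (simp add: B_def riemann_sum_def sum_distrib_left[symmetric])
    qed
    have "cmod (d m) \<le> real (card ?I) * ?a\<^sup>2 * real m ^ CARD('d) * \<eta> q"
    proof -
      have dist: "real q \<le> l1_setdist ?I ?J"
      proof (rule le_l1_setdist)
        fix x y assume "x \<in> ?I" "y \<in> ?J"
        then obtain j j' l where "x = ?t j" "j \<in> ?S k" "y = ?t j'" "j' \<in> ?S l" "l \<in> K"
          by blast
        then show "real q \<le> l1_norm (x - y)" using sep[of k l j j'] K(3) by auto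
      qed (use K ne in \<open>auto simp: subgrid_card\<close>)
      have "?S k \<inter> (\<Union>l\<in>K. ?S l) = {}"
      proof (rule equals0I)
        fix x assume "x \<in> ?S k \<inter> (\<Union>l\<in>K. ?S l)"
        then obtain l where l: "l \<in> K" "x \<in> ?S l" "x \<in> ?S k" by blast
        then have "k \<noteq> l" using K(3) by auto
        from disj[OF this] l show False by blast
      qed
      then have "?I \<inter> ?J = {}"
        unfolding image_Int[OF injt[of UNIV], symmetric] by simp
      then have "cmod (cf (\<lambda>\<omega>. ?a * ((\<Sum>t\<in>?I. \<xi> t \<omega>) + (\<Sum>t\<in>?J. \<xi> t \<omega>)))
             - cf (\<lambda>\<omega>. ?a * (\<Sum>t\<in>?I. \<xi> t \<omega>)) * cf (\<lambda>\<omega>. ?a * (\<Sum>t\<in>?J. \<xi> t \<omega>)))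
           \<le> real (card ?I) * ?a\<^sup>2 * real m ^ CARD('d) * \<eta> q"
        using dist K ne by (intro grid_mixing q m) (auto simp: subgrid_card lattice_point_in_grid)
      then show ?thesis by (simp only: d_def I J distrib_left)
    qed
    also have "real (card ?I) * ?a\<^sup>2 * real m ^ CARD('d) = real p ^ CARD('d) * a\<^sup>2"
    proof -
      have "real m ^ CARD('d) \<noteq> 0" using m by simp
      then show ?thesis unfolding card by (simp add: power_mult_distrib power_divide power2_eq_square)
    qed
    finally show ?thesis .
  qed
  have "d \<longlonglongrightarrow> cf (\<lambda>\<omega>. a * (block ?b p k \<omega> + (\<Sum>l\<in>K. block ?b p l \<omega>)))
      - cf (\<lambda>\<omega>. a * block ?b p k \<omega>) * cf (\<lambda>\<omega>. a * (\<Sum>l\<in>K. block ?b p l \<omega>))"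
    unfolding d_def A_def B_def
    using riemann_sums_char_tendsto[of "insert k K" a ?b p] riemann_sums_char_tendsto[of "{k}" a ?b p]
      riemann_sums_char_tendsto[OF K(1), of a ?b p] K
    by (intro tendsto_diff tendsto_mult) simp_all
  then show ?thesis
    by (rule LIMSEQ_le_const2[OF tendsto_norm]) (use bound in \<open>auto intro!: exI[of _ 2]\<close>)
qed

lemma block_sum_char:
  assumes K: "finite K" and p: "1 \<le> p" and q: "1 \<le> q"
  shows "cmod (cf (\<lambda>\<omega>. a * (\<Sum>k\<in>K. block (p + q) p k \<omega>))
      - cf (\<lambda>\<omega>. a * block (p + q) p (\<lambda>_. 0) \<omega>) ^ card K)
    \<le> real (card K) * (real p ^ CARD('d) * a\<^sup>2 * \<eta> q)"
  using K
proof (induction K rule: finite_induct)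
  case empty
  then show ?case by (simp add: prob_space)
next
  case (insert k K)
  let ?c = "real p ^ CARD('d) * a\<^sup>2 * \<eta> q"
  let ?\<phi> = "cf (\<lambda>\<omega>. a * block (p + q) p (\<lambda>_. 0) \<omega>)"
  let ?S = "cf (\<lambda>\<omega>. a * (\<Sum>l\<in>K. block (p + q) p l \<omega>))"
  let ?T = "cf (\<lambda>\<omega>. a * (block (p + q) p k \<omega> + (\<Sum>l\<in>K. block (p + q) p l \<omega>)))"
  have c: "0 \<le> ?c" using rate_nonneg[OF q] by simp
  have 1: "cmod (?T - ?\<phi> * ?S) \<le> ?c"
  proof (cases "K = {}")
    case True
    have "?T = ?\<phi>" "?S = 1"
      unfolding True block_char_stationary[of a "p + q" p k, symmetric] by (simp_all add: prob_space)
    then show ?thesis using c by simp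
  next
    case False
    from block_mixing[OF insert.hyps(1) False insert.hyps(2) p q, of a] show ?thesis
      by (simp only: block_char_stationary[of a "p + q" p k])
  qed
  have 2: "cmod (?\<phi> * (?S - ?\<phi> ^ card K)) \<le> 1 * (real (card K) * ?c)"
    unfolding norm_mult using insert.IH c by (intro mult_mono norm_expectation_iexp_le) auto
  have split: "?T - ?\<phi> ^ card (insert k K) = (?T - ?\<phi> * ?S) + ?\<phi> * (?S - ?\<phi> ^ card K)"
    using insert.hyps by (simp add: right_diff_distrib)
  have "cmod (?T - ?\<phi> ^ card (insert k K)) \<le> ?c + 1 * (real (card K) * ?c)"
    unfolding split by (rule norm_triangle_mono[OF 1 2])
  also have "\<dots> = real (card (insert k K)) * ?c"
    using insert.hyps by (simp add: algebra_simps)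
  finally show ?case using insert.hyps by simp
qed

end

section \<open>The limit for a scalar field\<close>

context mixing_field
begin

lemma window_char_approx:
  fixes W :: "(real ^ 'd) set"
  assumes W: "compact W" "0 < measure lborel W" and p: "1 \<le> p" and q: "1 \<le> q"
  defines "L \<equiv> measure lborel W" and "b \<equiv> p + q"
  defines "N \<equiv> card (inner_tiles (real b) W)"
  shows "cmod (cf (\<lambda>\<omega>. 1 / sqrt L * smear (indicator W) \<omega>)
      - cf (\<lambda>\<omega>. 1 / sqrt L * smear (indicator (hbox 0 (real p))) \<omega>) ^ N)
    \<le> sqrt ((LBINT t. \<bar>c t\<bar>) * (1 - real p ^ CARD('d) * (real N / L)))
      + real p ^ CARD('d) * \<eta> q * (real N / L)"
proof -
  let ?K = "inner_tiles (real b) W" and ?C = "LBINT t. \<bar>c t\<bar>"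
  let ?Q = "\<lambda>k. hbox (lattice_point (real b) k) (real p)"
  let ?a = "1 / sqrt L"
  have L: "0 < L" using W by (simp add: L_def)
  have b: "0 < real b" "real p \<le> real b" using p by (auto simp: b_def)
  have K: "finite ?K" by (rule finite_inner_tiles[OF W(1) b(1)])
  have fW: "W \<in> fmeasurable lborel" by (rule fmeasurable_compact[OF W(1)])
  have [measurable]: "W \<in> sets borel" using W(1) by (rule borel_compact)
  have iW: "integrable lborel (indicat_real W)"
    by (rule integrable_indicator_fmeasurable[OF fW])
  have iQ: "integrable lborel (indicat_real (?Q k))" for k :: "'d \<Rightarrow> int" by (rule indicator_hbox_integrable) simp
  let ?U = "\<Union>k\<in>?K. ?Q k"
  have "?Q k \<subseteq> hbox (lattice_point (real b) k) (real b)" for k :: "'d \<Rightarrow> int"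
    using b(2) by (rule hbox_mono)
  then have sub: "?U \<subseteq> W" unfolding inner_tiles_def by blast
  have mU: "measure lborel ?U = real N * real p ^ CARD('d)"
    using measure_tile_union[OF K b(1) _ b(2)] by (simp add: N_def)
  have fU: "?U \<in> fmeasurable lborel"
    by (intro fmeasurable.finite_UN K measure_hbox(3)) simp
  have mD: "measure lborel (W - ?U) = L - real N * real p ^ CARD('d)"
    using measurable_measure_Diff[OF fW fmeasurableD[OF fU] sub] mU by (simp add: L_def)
  have indU: "indicat_real ?U t = (\<Sum>k\<in>?K. indicator (?Q k) t)" for t
    by (rule indicator_UN_disjoint[OF K]) (use lattice_hbox_disjoint[OF b(1) _ b(2)] in \<open>auto simp: disjoint_family_on_def\<close>)
  define S where "S \<omega> = (\<Sum>k\<in>?K. block b p k \<omega>)" for \<omega>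
  let ?g = "indicat_real (W - ?U)"
  have ig: "integrable lborel ?g"
    by (rule integrable_indicator_fmeasurable[OF fmeasurable_Diff[OF fW fmeasurableD[OF fU]]])
  have gS: "AE \<omega> in M. smear (indicator W) \<omega> - S \<omega> = smear ?g \<omega>"
  proof -
    have geq: "indicator W t - indicat_real ?U t = ?g t" for t
      using sub by (auto simp: indicator_def)
    have iU: "integrable lborel (\<lambda>t. indicat_real ?U t)"
      by (rule integrable_indicator_fmeasurable[OF fU])
    have "AE \<omega> in M. S \<omega> = smear (indicator ?U) \<omega>"
      using smear_sum[OF K, of "\<lambda>k. indicator (?Q k)", OF iQ]
      unfolding S_def block_def ext[of "indicat_real ?U", OF indU] .
    then show ?thesis
      using smear_diff[OF iW iU] unfolding geq by eventually_elim simp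
  qed
  have iS: "integrable M S"
    unfolding S_def using block_integrable by simp
  have "cmod (cf (\<lambda>\<omega>. ?a * smear (indicator W) \<omega>) - cf (\<lambda>\<omega>. ?a * S \<omega>))
      \<le> \<bar>?a\<bar> * expectation (\<lambda>\<omega>. \<bar>smear (indicator W) \<omega> - S \<omega>\<bar>)"
    by (rule char_diff_le[OF smear_integrable(2)[OF iW] iS])
  also have "expectation (\<lambda>\<omega>. \<bar>smear (indicator W) \<omega> - S \<omega>\<bar>) = expectation (\<lambda>\<omega>. \<bar>smear ?g \<omega>\<bar>)"
    using gS smear_integrable(2)[OF iW] smear_integrable(2)[OF ig] iS
    by (intro integral_cong_AE) auto
  also have "\<bar>?a\<bar> * expectation (\<lambda>\<omega>. \<bar>smear ?g \<omega>\<bar>) \<le> \<bar>?a\<bar> * sqrt (?C * (L - real N * real p ^ CARD('d)))"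
  proof (intro mult_left_mono)
    have "expectation (\<lambda>\<omega>. \<bar>smear ?g \<omega>\<bar>) \<le> sqrt (expectation (\<lambda>\<omega>. (smear ?g \<omega>)\<^sup>2))"
      using smear_integrable(2)[OF ig] by (intro expectation_abs_le_sqrt smear_square_integrable[OF ig]) auto
    also have "\<dots> \<le> sqrt (?C * (LBINT t. \<bar>?g t\<bar>))"
      by (intro real_sqrt_le_mono smear_second_moment_le[OF ig]) (simp add: indicator_def)
    also have "(LBINT t. \<bar>?g t\<bar>) = L - real N * real p ^ CARD('d)"
      using mD by simp
    finally show "expectation (\<lambda>\<omega>. \<bar>smear ?g \<omega>\<bar>) \<le> sqrt (?C * (L - real N * real p ^ CARD('d)))" .
  qed simp
  also have "\<dots> = sqrt (?C * (1 - real p ^ CARD('d) * (real N / L)))"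
  proof -
    have "?C * (1 - real p ^ CARD('d) * (real N / L)) = (?C * (L - real N * real p ^ CARD('d))) / L"
      using L by (simp add: field_simps)
    then show ?thesis using L by (simp add: real_sqrt_divide)
  qed
  finally have 1: "cmod (cf (\<lambda>\<omega>. ?a * smear (indicator W) \<omega>) - cf (\<lambda>\<omega>. ?a * S \<omega>))
      \<le> sqrt (?C * (1 - real p ^ CARD('d) * (real N / L)))" .
  have "lattice_point (real b) (\<lambda>_. 0) = (0 :: real ^ 'd)" by (simp add: lattice_point_def vec_eq_iff)
  then have blk: "block b p (\<lambda>_. 0) = smear (indicator (hbox 0 (real p)))"
    by (simp add: block_def)
  have "?a\<^sup>2 = 1 / L" using L by (simp add: power_divide)
  then have 2: "cmod (cf (\<lambda>\<omega>. ?a * S \<omega>)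
      - cf (\<lambda>\<omega>. ?a * smear (indicator (hbox 0 (real p))) \<omega>) ^ N)
    \<le> real p ^ CARD('d) * \<eta> q * (real N / L)"
    using block_sum_char[OF K p q, of ?a] unfolding S_def b_def[symmetric] blk N_def[symmetric]
    by (simp only: mult_ac times_divide_eq_right times_divide_eq_left mult_1_left mult_1_right)
  show ?thesis
    using norm_triangle_mono[OF 1 2] by (simp only: diff_add_eq_diff_diff_swap diff_add_cancel add_diff_eq)
qed

text \<open>
  The bounds depend on \<open>n\<close>, \<open>p\<close> and \<open>q\<close>; the limits are taken in this order. After the limit in \<open>n\<close> the
  error is \<open>err p q\<close>, which tends to \<open>\<eta> q\<close> as \<open>p \<rightarrow> \<infinity>\<close>: the corridors become negligible and the
  variance of a block per unit of volume tends to \<open>\<integral>c\<close>.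
\<close>

lemma window_char_limit:
  fixes W :: "nat \<Rightarrow> (real ^ 'd) set"
  assumes W: "VH_growing W"
  shows "(\<lambda>n. cf (\<lambda>\<omega>. 1 / sqrt (measure lborel (W n)) * smear (indicator (W n)) \<omega>))
    \<longlonglongrightarrow> exp (- complex_of_real (LBINT t. c t) / 2)"
proof -
  note cW = VH_growing_windows[OF W]
  let ?L = "\<lambda>n. measure lborel (W n)" and ?C = "LBINT t. \<bar>c t\<bar>"
  let ?\<phi> = "\<lambda>n. cf (\<lambda>\<omega>. 1 / sqrt (?L n) * smear (indicator (W n)) \<omega>)"
  let ?z = "exp (- complex_of_real (LBINT t. c t) / 2)"
  define V where "V p = expectation (\<lambda>\<omega>. (smear (indicator (hbox 0 (real p))) \<omega>)\<^sup>2)" for p :: nat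
  define \<rho> where "\<rho> p q = (real p / real (p + q)) ^ CARD('d)" for p q
  define err where "err p q = sqrt (?C * (1 - \<rho> p q)) + \<rho> p q * \<eta> q
      + cmod (exp (- complex_of_real (V p * (1 / real (p + q) ^ CARD('d))) / 2) - ?z)" for p q
  have ev: "\<forall>\<^sub>F n in sequentially. cmod (?\<phi> n - ?z) < e"
    if p: "1 \<le> p" and q: "1 \<le> q" and e: "err p q < e" for p q e
  proof -
    let ?b = "real (p + q)"
    define N where "N n = card (inner_tiles ?b (W n))" for n
    have N: "(\<lambda>n. real (N n) / ?L n) \<longlonglongrightarrow> 1 / ?b ^ CARD('d)"
      unfolding N_def using p by (intro VH_growing_tiles[OF W]) simp
    let ?lim = "sqrt (?C * (1 - real p ^ CARD('d) * (1 / ?b ^ CARD('d))))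
        + real p ^ CARD('d) * \<eta> q * (1 / ?b ^ CARD('d))
        + cmod (exp (- complex_of_real (V p * (1 / ?b ^ CARD('d))) / 2) - ?z)"
    let ?u = "\<lambda>n. sqrt (?C * (1 - real p ^ CARD('d) * (real (N n) / ?L n)))
        + real p ^ CARD('d) * \<eta> q * (real (N n) / ?L n)"
    let ?\<psi> = "\<lambda>n. cf (\<lambda>\<omega>. 1 / sqrt (?L n) * smear (indicator (hbox 0 (real p))) \<omega>) ^ N n"
    have iQ: "integrable lborel (indicat_real (hbox (0 :: real ^ 'd) (real p)))"
      by (rule indicator_hbox_integrable) simp
    have \<psi>: "?\<psi> \<longlonglongrightarrow> exp (- complex_of_real (V p * (1 / ?b ^ CARD('d))) / 2)"
      unfolding V_def
      by (intro char_power_limit cW(2) VH_growing_at_top[OF W] N smear_square_integrable[OF iQ]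
          smear_integrable(3)[OF iQ] borel_measurable_integrable[OF smear_integrable(2)[OF iQ]])
    have "(\<lambda>n. ?u n + cmod (?\<psi> n - ?z))
      \<longlonglongrightarrow> ?lim"
      by (intro tendsto_add tendsto_real_sqrt tendsto_mult tendsto_diff tendsto_const N tendsto_norm \<psi>)
    also have "?lim = err p q"
      by (simp add: err_def \<rho>_def power_divide)
    finally have "\<forall>\<^sub>F n in sequentially. ?u n + cmod (?\<psi> n - ?z) < e"
      using e by (rule order_tendstoD)
    then show ?thesis
    proof eventually_elim
      case (elim n)
      have "cmod (?\<phi> n - ?z) \<le> cmod (?\<phi> n - ?\<psi> n) + cmod (?\<psi> n - ?z)"
        using norm_triangle_ineq[of "?\<phi> n - ?\<psi> n" "?\<psi> n - ?z"] by (simp only: diff_add_cancel add_diff_eq)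
      moreover have "cmod (?\<phi> n - ?\<psi> n) \<le> ?u n"
        using window_char_approx[OF cW p q, of n] unfolding N_def .
      ultimately show ?case using elim by linarith
    qed
  qed
  have err: "(\<lambda>p. err p q) \<longlonglongrightarrow> \<eta> q" if q: "1 \<le> q" for q
  proof -
    have "(\<lambda>p. 1 - real q / real (p + q)) \<longlonglongrightarrow> 1 - 0"
      by (intro tendsto_diff tendsto_const LIMSEQ_ignore_initial_segment lim_const_over_n)
    moreover have "1 - real q / real (p + q) = real p / real (p + q)" for p
      using q by (simp add: field_simps)
    ultimately have "(\<lambda>p. \<rho> p q) \<longlonglongrightarrow> 1 ^ CARD('d)"
      unfolding \<rho>_def by (intro tendsto_power) simp
    then have \<rho>: "(\<lambda>p. \<rho> p q) \<longlonglongrightarrow> 1" by simp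
    have "(\<lambda>p. V p / real p ^ CARD('d) * \<rho> p q) \<longlonglongrightarrow> (LBINT t. c t) * 1"
      unfolding V_def by (intro tendsto_mult smear_cube_variance_limit \<rho>)
    moreover have "\<forall>\<^sub>F p in sequentially. V p / real p ^ CARD('d) * \<rho> p q = V p * (1 / real (p + q) ^ CARD('d))"
      by (intro eventually_sequentiallyI[of 1]) (simp add: \<rho>_def power_divide)
    ultimately have V: "(\<lambda>p. V p * (1 / real (p + q) ^ CARD('d))) \<longlonglongrightarrow> (LBINT t. c t)"
      by (simp add: tendsto_cong)
    have "(\<lambda>p. err p q) \<longlonglongrightarrow> sqrt (?C * (1 - 1)) + 1 * \<eta> q
      + cmod (exp (- complex_of_real (LBINT t. c t) / 2) - ?z)"
      unfolding err_def by (intro tendsto_intros V \<rho>) simp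
    then show ?thesis by simp
  qed
  show ?thesis
  proof (rule tendstoI)
    fix e :: real assume "0 < e"
    have "\<forall>\<^sub>F q in sequentially. \<eta> q < e"
      using rate_tendsto_0 \<open>0 < e\<close> by (rule order_tendstoD)
    then obtain q0 where "\<And>q. q0 \<le> q \<Longrightarrow> \<eta> q < e" by (auto simp: eventually_sequentially)
    then have q: "1 \<le> max 1 q0" "\<eta> (max 1 q0) < e" by auto
    have "\<forall>\<^sub>F p in sequentially. err p (max 1 q0) < e"
      using err[OF q(1)] q(2) by (rule order_tendstoD)
    then obtain p0 where "\<And>p. p0 \<le> p \<Longrightarrow> err p (max 1 q0) < e" by (auto simp: eventually_sequentially)
    then have "err (max 1 p0) (max 1 q0) < e" by simp
    from ev[OF _ q(1) this] show "\<forall>\<^sub>F n in sequentially. dist (?\<phi> n) ?z < e"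
      by (simp add: dist_norm)
  qed
qed

end

section \<open>From \<open>BL(\<theta>)\<close>-dependence to characteristic functions\<close>

lemma integral_lborel_uminus:
  fixes f :: "'a::euclidean_space \<Rightarrow> real"
  assumes [measurable]: "f \<in> borel_measurable borel"
  shows "(LBINT x. f (- x)) = (LBINT x. f x)"
proof -
  have "(lborel :: 'a measure) = distr lborel borel (\<lambda>x. - x)"
    using lborel_affine[of "-1" "0 :: 'a"] by (simp add: density_1)
  then have "(LBINT x. f x) = (\<integral>x. f x \<partial>distr lborel borel (\<lambda>x. - x))"
    by metis
  also have "\<dots> = (LBINT x. f (- x))"
    by (rule integral_distr) measurable
  finally show ?thesis ..
qed

lemma abs_inner_le_l1_norm: "\<bar>u \<bullet> v\<bar> \<le> l1_norm u * l1_norm v"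
proof -
  have "\<bar>u \<bullet> v\<bar> \<le> (\<Sum>i\<in>UNIV. \<bar>u $ i\<bar> * \<bar>v $ i\<bar>)"
    unfolding inner_vec_def by (rule order_trans[OF sum_abs]) (simp add: abs_mult)
  also have "\<dots> \<le> (\<Sum>i\<in>UNIV. l1_norm u * \<bar>v $ i\<bar>)"
    by (intro sum_mono mult_right_mono component_le_l1_norm) auto
  finally show ?thesis by (simp add: l1_norm_def sum_distrib_left)
qed

lemma l1_dist_on_nonneg: "0 \<le> l1_dist_on I x y"
  by (simp add: l1_dist_on_def l1_norm_def sum_nonneg)

lemma Lip_bounds:
  fixes f :: "('t \<Rightarrow> real ^ 's) \<Rightarrow> real"
  assumes "I \<noteq> {}" "0 \<le> L"
    and f: "\<And>x y. \<bar>f x - f y\<bar> \<le> L * l1_dist_on I x y"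
  shows "0 \<le> Lip I f" "Lip I f \<le> L"
proof -
  let ?S = "{\<bar>f x - f y\<bar> / l1_dist_on I x y | x y.
                    x \<in> I \<rightarrow>\<^sub>E UNIV \<and> y \<in> I \<rightarrow>\<^sub>E UNIV \<and> x \<noteq> y}"
  have le: "\<bar>f x - f y\<bar> / l1_dist_on I x y \<le> L" for x y
    using f[of x y] l1_dist_on_nonneg[of I x y] assms(2)
    by (cases "l1_dist_on I x y = 0") (auto simp: divide_le_eq)
  obtain t where "t \<in> I" using assms(1) by blast
  define a :: "'t \<Rightarrow> real ^ 's" where "a = (\<lambda>t\<in>I. 0)"
  define b :: "'t \<Rightarrow> real ^ 's" where "b = (\<lambda>t\<in>I. 1)"
  have "a t \<noteq> b t" using \<open>t \<in> I\<close> by (simp add: a_def b_def)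
  then have "a \<noteq> b" by auto
  moreover have "a \<in> I \<rightarrow>\<^sub>E UNIV" "b \<in> I \<rightarrow>\<^sub>E UNIV"
    by (auto simp: a_def b_def)
  ultimately have ab: "a \<in> I \<rightarrow>\<^sub>E UNIV" "b \<in> I \<rightarrow>\<^sub>E UNIV" "a \<noteq> b" by auto
  have mem: "\<bar>f a - f b\<bar> / l1_dist_on I a b \<in> ?S" using ab by blast
  have "bdd_above ?S" using le by (intro bdd_aboveI[of _ L]) auto
  from cSup_upper[OF mem this] show "0 \<le> Lip I f"
    unfolding Lip_def using l1_dist_on_nonneg[of I a b] by (smt (verit) abs_ge_zero divide_nonneg_nonneg)
  show "Lip I f \<le> L"
    unfolding Lip_def using le mem by (intro cSup_least) auto
qed

context prob_space
begin

lemma cov_bounded: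
  assumes [measurable]: "U \<in> borel_measurable M" "V \<in> borel_measurable M"
    and b: "\<And>\<omega>. \<bar>U \<omega>\<bar> \<le> 1" "\<And>\<omega>. \<bar>V \<omega>\<bar> \<le> 1"
  shows "cov M U V = expectation (\<lambda>\<omega>. U \<omega> * V \<omega>) - expectation U * expectation V"
proof -
  have i: "integrable M U" "integrable M V"
    using b by (auto intro!: integrable_const_bound[where B=1])
  have "\<bar>U \<omega> * V \<omega>\<bar> \<le> 1" for \<omega>
    using mult_mono[OF b] by (simp add: abs_mult)
  then have iUV: "integrable M (\<lambda>\<omega>. U \<omega> * V \<omega>)"
    by (intro integrable_const_bound[where B=1]) auto
  have "cov M U V = expectation (\<lambda>\<omega>. U \<omega> * V \<omega> - expectation U * V \<omega>
      - U \<omega> * expectation V + expectation U * expectation V)"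
    unfolding cov_def by (simp add: algebra_simps)
  also have "\<dots> = expectation (\<lambda>\<omega>. U \<omega> * V \<omega>) - expectation U * expectation V"
    using i iUV by (simp add: prob_space)
  finally show ?thesis .
qed

lemma expectation_iexp:
  assumes [measurable]: "A \<in> borel_measurable M"
  shows "cf (\<lambda>\<omega>. A \<omega>)
    = complex_of_real (expectation (\<lambda>\<omega>. cos (A \<omega>))) + \<i> * complex_of_real (expectation (\<lambda>\<omega>. sin (A \<omega>)))"
proof -
  have i: "integrable M (\<lambda>\<omega>. complex_of_real (cos (A \<omega>)))" "integrable M (\<lambda>\<omega>. complex_of_real (sin (A \<omega>)))"
    by (auto intro!: integrable_const_bound[where B=1])
  have "iexp x = complex_of_real (cos x) + \<i> * complex_of_real (sin x)" for x
    by (simp add: exp_Euler cos_of_real sin_of_real)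
  then show ?thesis using i by simp
qed

text \<open>
  By Euler's formula and the addition theorems, the real and the imaginary part of the difference are
  a difference and a sum of two covariances.
\<close>

lemma char_mixing_of_cov:
  assumes [measurable]: "A \<in> borel_measurable M" "B \<in> borel_measurable M"
    and D: "\<And>F G. F \<in> {cos, sin} \<Longrightarrow> G \<in> {cos, sin} \<Longrightarrow>
      \<bar>cov M (\<lambda>\<omega>. F (A \<omega>)) (\<lambda>\<omega>. G (B \<omega>))\<bar> \<le> D"
  shows "cmod (cf (\<lambda>\<omega>. A \<omega> + B \<omega>)
    - cf (\<lambda>\<omega>. A \<omega>) * cf (\<lambda>\<omega>. B \<omega>)) \<le> 4 * D"
proof -
  let ?c = "\<lambda>F G. cov M (\<lambda>\<omega>. F (A \<omega>)) (\<lambda>\<omega>. G (B \<omega>))"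
  have c: "?c F G = expectation (\<lambda>\<omega>. F (A \<omega>) * G (B \<omega>)) - expectation (\<lambda>\<omega>. F (A \<omega>)) * expectation (\<lambda>\<omega>. G (B \<omega>))"
    if "F \<in> {cos, sin}" "G \<in> {cos, sin}" for F G :: "real \<Rightarrow> real"
    using that by (intro cov_bounded) auto
  have i: "integrable M (\<lambda>\<omega>. F (A \<omega>) * G (B \<omega>))" if "F \<in> {cos, sin}" "G \<in> {cos, sin}" for F G :: "real \<Rightarrow> real"
  proof (rule integrable_const_bound[where B = 1])
    have "\<bar>F x\<bar> \<le> 1" "\<bar>G x\<bar> \<le> 1" for x using that by auto
    then show "AE \<omega> in M. norm (F (A \<omega>) * G (B \<omega>)) \<le> 1"
      by (intro AE_I2) (metis abs_ge_zero abs_mult mult_le_one real_norm_def)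
    show "(\<lambda>\<omega>. F (A \<omega>) * G (B \<omega>)) \<in> borel_measurable M" using that by auto
  qed
  have AB: "cf (\<lambda>\<omega>. A \<omega> + B \<omega>) = complex_of_real (expectation (\<lambda>\<omega>. cos (A \<omega> + B \<omega>)))
      + \<i> * complex_of_real (expectation (\<lambda>\<omega>. sin (A \<omega> + B \<omega>)))"
    by (rule expectation_iexp) measurable
  have "expectation (\<lambda>\<omega>. cos (A \<omega> + B \<omega>)) = expectation (\<lambda>\<omega>. cos (A \<omega>) * cos (B \<omega>)) - expectation (\<lambda>\<omega>. sin (A \<omega>) * sin (B \<omega>))"
    "expectation (\<lambda>\<omega>. sin (A \<omega> + B \<omega>)) = expectation (\<lambda>\<omega>. sin (A \<omega>) * cos (B \<omega>)) + expectation (\<lambda>\<omega>. cos (A \<omega>) * sin (B \<omega>))"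
    using i[of cos cos] i[of sin sin] i[of sin cos] i[of cos sin] by (simp_all add: cos_add sin_add)
  note AB = AB[unfolded this]
  have eq: "cf (\<lambda>\<omega>. A \<omega> + B \<omega>) - cf (\<lambda>\<omega>. A \<omega>) * cf (\<lambda>\<omega>. B \<omega>)
    = complex_of_real (?c cos cos - ?c sin sin) + \<i> * complex_of_real (?c sin cos + ?c cos sin)"
    unfolding AB expectation_iexp[OF assms(1)] expectation_iexp[OF assms(2)]
    by (simp add: c complex_eq_iff algebra_simps)
  have "cmod (complex_of_real (?c cos cos - ?c sin sin) + \<i> * complex_of_real (?c sin cos + ?c cos sin))
      \<le> \<bar>?c cos cos - ?c sin sin\<bar> + \<bar>?c sin cos + ?c cos sin\<bar>"
    using norm_triangle_ineq[of "complex_of_real (?c cos cos - ?c sin sin)" "\<i> * complex_of_real (?c sin cos + ?c cos sin)"]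
    unfolding norm_mult norm_ii norm_of_real mult_1_left .
  also have "\<dots> \<le> 4 * D"
  proof -
    have mem: "cos \<in> {cos, sin :: real \<Rightarrow> real}" "sin \<in> {cos, sin :: real \<Rightarrow> real}" by blast+
    show ?thesis
      using D[OF mem(1,1)] D[OF mem(2,2)] D[OF mem(2,1)] D[OF mem(1,2)] by linarith
  qed
  finally show ?thesis unfolding eq .
qed

end

text \<open>
  Lipschitz functions of linear functionals of \<open>X\<close> are admissible in the dependence condition; their
  Lipschitz constants with respect to the \<open>\<ell>\<^sub>1\<close>-norm are at most \<open>\<bar>a\<bar>\<close> times the \<open>\<ell>\<^sub>1\<close>-norm of \<open>u\<close>.
\<close>

lemma BL_dependent_linear:
  fixes X :: "real ^ 'd \<Rightarrow> 'a \<Rightarrow> real ^ 's" and u \<mu> :: "real ^ 's" and F G :: "real \<Rightarrow> real"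
  assumes BL: "BL_dependent M \<theta> X" and \<theta>: "0 \<le> \<theta> r"
    and I: "1 \<le> r" "1 < \<Delta>" "finite I" "finite J" "I \<noteq> {}" "J \<noteq> {}" "I \<subseteq> grid \<Delta>" "J \<subseteq> grid \<Delta>"
      "I \<inter> J = {}" "real r \<le> l1_setdist I J"
    and F: "\<And>x. \<bar>F x\<bar> \<le> 1" "\<And>x y. \<bar>F x - F y\<bar> \<le> \<bar>x - y\<bar>"
    and G: "\<And>x. \<bar>G x\<bar> \<le> 1" "\<And>x y. \<bar>G x - G y\<bar> \<le> \<bar>x - y\<bar>"
  shows "cov M (\<lambda>\<omega>. F (a * (\<Sum>t\<in>I. u \<bullet> (X t \<omega> - \<mu>)))) (\<lambda>\<omega>. G (a * (\<Sum>t\<in>J. u \<bullet> (X t \<omega> - \<mu>))))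
    \<le> real (card I) * a\<^sup>2 * \<Delta> ^ CARD('d) * ((l1_norm u)\<^sup>2 * \<theta> r)"
proof -
  let ?L = "\<bar>a\<bar> * l1_norm u"
  let ?h = "\<lambda>H (S :: (real ^ 'd) set) (x :: real ^ 'd \<Rightarrow> real ^ 's). H (a * (\<Sum>t\<in>S. u \<bullet> (x t - \<mu>))) :: real"
  have u: "0 \<le> l1_norm u" by (simp add: l1_norm_def sum_nonneg)
  then have L: "0 \<le> ?L" by simp
  have lip: "\<bar>?h H S x - ?h H S y\<bar> \<le> ?L * l1_dist_on S x y"
    if H: "\<And>x y. \<bar>H x - H y\<bar> \<le> \<bar>x - y\<bar>" for H S x y
  proof -
    have "\<bar>?h H S x - ?h H S y\<bar> \<le> \<bar>a * (\<Sum>t\<in>S. u \<bullet> (x t - \<mu>)) - a * (\<Sum>t\<in>S. u \<bullet> (y t - \<mu>))\<bar>" by (rule H)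
    also have "\<dots> = \<bar>a\<bar> * \<bar>\<Sum>t\<in>S. u \<bullet> (x t - y t)\<bar>"
      by (simp add: right_diff_distrib[symmetric] sum_subtractf[symmetric] inner_diff_right[symmetric] abs_mult)
    also have "\<dots> \<le> \<bar>a\<bar> * (\<Sum>t\<in>S. l1_norm u * l1_norm (x t - y t))"
      by (intro mult_left_mono order_trans[OF sum_abs] sum_mono abs_inner_le_l1_norm) auto
    also have "\<dots> = ?L * l1_dist_on S x y" by (simp add: l1_dist_on_def sum_distrib_left mult.assoc)
    finally show ?thesis .
  qed
  have bl: "bounded_lipschitz S (?h H S)"
    if "\<And>x. \<bar>H x\<bar> \<le> 1" "\<And>x y. \<bar>H x - H y\<bar> \<le> \<bar>x - y\<bar>" for H S
    unfolding bounded_lipschitz_def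
  proof (intro conjI exI[of _ ?L] ballI)
    show "bounded (?h H S ` (S \<rightarrow>\<^sub>E UNIV))" using that(1) by (auto simp: bounded_iff)
  qed (rule lip[OF that(2)])
  note lF = Lip_bounds[of I ?L "?h F I", OF I(5) L lip[OF F(2)]]
  note lG = Lip_bounds[of J ?L "?h G J", OF I(6) L lip[OF G(2)]]
  have "cov M (\<lambda>\<omega>. ?h F I (\<lambda>t\<in>I. X t \<omega>)) (\<lambda>\<omega>. ?h G J (\<lambda>t\<in>J. X t \<omega>))
      \<le> real (min (card I) (card J)) * Lip I (?h F I) * Lip J (?h G J) * \<Delta> ^ CARD('d) * \<theta> r"
    using BL[unfolded BL_dependent_def, rule_format, OF I bl[OF F] bl[OF G]] .
  also have "\<dots> \<le> real (card I) * ?L * ?L * \<Delta> ^ CARD('d) * \<theta> r"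
    using lF lG L I(2) \<theta> by (intro mult_right_mono mult_mono) auto
  also have "\<dots> = real (card I) * a\<^sup>2 * \<Delta> ^ CARD('d) * ((l1_norm u)\<^sup>2 * \<theta> r)"
    by (simp add: power2_eq_square mult_ac)
  finally show ?thesis by simp
qed

lemma stationary_expectation:
  fixes X :: "real ^ 'd \<Rightarrow> 'a \<Rightarrow> real ^ 's" and H :: "(real ^ 'd \<Rightarrow> real ^ 's) \<Rightarrow> 'b::{banach, second_countable_topology}"
  assumes X: "stationary_field M X" and [measurable]: "\<And>t. X t \<in> borel_measurable M"
    and I: "finite I" and [measurable]: "H \<in> borel_measurable (Pi\<^sub>M I (\<lambda>_. borel))"
  shows "(\<integral>\<omega>. H (\<lambda>t\<in>I. X (t + h) \<omega>) \<partial>M) = (\<integral>\<omega>. H (\<lambda>t\<in>I. X t \<omega>) \<partial>M)"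
    and "integrable M (\<lambda>\<omega>. H (\<lambda>t\<in>I. X (t + h) \<omega>)) \<longleftrightarrow> integrable M (\<lambda>\<omega>. H (\<lambda>t\<in>I. X t \<omega>))"
proof -
  have m: "(\<lambda>\<omega>. \<lambda>t\<in>I. X (t + h) \<omega>) \<in> measurable M (Pi\<^sub>M I (\<lambda>_. borel))" for h
    by (rule measurable_restrict) measurable
  have eq: "distr M (Pi\<^sub>M I (\<lambda>_. borel)) (\<lambda>\<omega>. \<lambda>t\<in>I. X (t + h) \<omega>) = distr M (Pi\<^sub>M I (\<lambda>_. borel)) (\<lambda>\<omega>. \<lambda>t\<in>I. X t \<omega>)"
    using X I unfolding stationary_field_def by blast
  have m0: "(\<lambda>\<omega>. \<lambda>t\<in>I. X t \<omega>) \<in> measurable M (Pi\<^sub>M I (\<lambda>_. borel))"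
    by (rule measurable_restrict) measurable
  show "(\<integral>\<omega>. H (\<lambda>t\<in>I. X (t + h) \<omega>) \<partial>M) = (\<integral>\<omega>. H (\<lambda>t\<in>I. X t \<omega>) \<partial>M)"
    using integral_distr[OF m[of h], of H] integral_distr[OF m0, of H] by (simp add: eq)
  show "integrable M (\<lambda>\<omega>. H (\<lambda>t\<in>I. X (t + h) \<omega>)) \<longleftrightarrow> integrable M (\<lambda>\<omega>. H (\<lambda>t\<in>I. X t \<omega>))"
    using integrable_distr_eq[OF m[of h], of H] integrable_distr_eq[OF m0, of H] by (simp add: eq)
qed

section \<open>The central limit theorem for vector-valued fields\<close>

lemma measurable_field_comp_vec:
  fixes X :: "real ^ 'd \<Rightarrow> 'a \<Rightarrow> real ^ 's"
  assumes "measurable_field M X" "f \<in> measurable N M" "g \<in> borel_measurable N"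
  shows "(\<lambda>x. X (g x) (f x)) \<in> borel_measurable N"
  using measurable_compose[OF measurable_Pair[OF assms(2,3)] assms(1)[unfolded measurable_field_def]] by simp

lemma borel_measurable_vec_nth [measurable (raw)]:
  assumes "f \<in> borel_measurable M"
  shows "(\<lambda>x. f x $ i) \<in> borel_measurable M"
  using borel_measurable_continuous_on[OF continuous_on_component[OF continuous_on_id] assms] by simp

lemma borel_measurable_vecI:
  fixes f :: "'a \<Rightarrow> real ^ 's"
  assumes "\<And>i. (\<lambda>x. f x $ i) \<in> borel_measurable M"
  shows "f \<in> borel_measurable M"
  using assms by (subst borel_measurable_euclidean_space) (auto simp: Basis_vec_def inner_axis)

locale BL_field = prob_space M for M :: "'a measure" +
  fixes X :: "real ^ 'd \<Rightarrow> 'a \<Rightarrow> real ^ 's" and \<theta> :: "nat \<Rightarrow> real"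
  assumes X_measurable [measurable]: "\<And>t. X t \<in> borel_measurable M"
    and rate_antimono: "antimono_on {1..} \<theta>"
    and rate_lim: "\<theta> \<longlonglongrightarrow> 0"
    and stationary: "stationary_field M X"
    and jointly_measurable: "measurable_field M X"
    and BL: "BL_dependent M \<theta> X"
    and second_moment: "\<And>i. integrable M (\<lambda>\<omega>. (X 0 \<omega> $ i)\<^sup>2)"
    and cov_integrable: "\<And>i j. integrable lborel (\<lambda>t. \<bar>cov M (\<lambda>\<omega>. X 0 \<omega> $ i) (\<lambda>\<omega>. X t \<omega> $ j)\<bar>)"
begin

definition \<mu> :: "real ^ 's" where "\<mu> = (\<chi> i. expectation (\<lambda>\<omega>. X 0 \<omega> $ i))"

definition proj :: "real ^ 's \<Rightarrow> real ^ 'd \<Rightarrow> 'a \<Rightarrow> real" where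
  "proj u t \<omega> = u \<bullet> (X t \<omega> - \<mu>)"

definition \<Sigma> :: "real ^ 's ^ 's" where
  "\<Sigma> = (\<chi> i j. LBINT t. cov M (\<lambda>\<omega>. X 0 \<omega> $ i) (\<lambda>\<omega>. X t \<omega> $ j))"

lemmas X_comp [measurable (raw)] = measurable_field_comp_vec[OF jointly_measurable]

lemma proj_comp [measurable (raw)]:
  assumes [measurable]: "f \<in> measurable N M" "g \<in> borel_measurable N"
  shows "(\<lambda>x. proj u (g x) (f x)) \<in> borel_measurable N"
  unfolding proj_def by measurable

lemma rate_nonneg:
  assumes "1 \<le> r" shows "0 \<le> \<theta> r"
proof (rule LIMSEQ_le_const2[OF rate_lim], intro exI allI impI)
  fix n assume "r \<le> n"
  then show "\<theta> n \<le> \<theta> r"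
    using monotone_onD[OF rate_antimono, of r n] assms by simp
qed

lemma component_square_integrable: "integrable M (\<lambda>\<omega>. (X t \<omega> $ i)\<^sup>2)"
proof -
  have "(\<lambda>x. (x 0 $ i)\<^sup>2) \<in> borel_measurable (Pi\<^sub>M {0 :: real ^ 'd} (\<lambda>_. borel :: (real ^ 's) measure))"
    by measurable
  from stationary_expectation(2)[OF stationary X_measurable _ this, of t] second_moment[of i]
  show ?thesis by simp
qed

lemma component_integrable: "integrable M (\<lambda>\<omega>. X t \<omega> $ i)"
  by (rule square_integrable_imp_integrable[OF _ component_square_integrable]) measurable

lemma component_expectation: "expectation (\<lambda>\<omega>. X t \<omega> $ i) = \<mu> $ i"
proof -
  have "(\<lambda>x. x 0 $ i) \<in> borel_measurable (Pi\<^sub>M {0 :: real ^ 'd} (\<lambda>_. borel :: (real ^ 's) measure))"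
    by measurable
  from stationary_expectation(1)[OF stationary X_measurable _ this, of t]
  show ?thesis by (simp add: \<mu>_def)
qed

lemma centered_product_integrable:
  "integrable M (\<lambda>\<omega>. (X s \<omega> $ i - \<mu> $ i) * (X t \<omega> $ j - \<mu> $ j))"
proof -
  have c: "integrable M (\<lambda>\<omega>. (X t \<omega> $ i - \<mu> $ i)\<^sup>2)" for t i
    using component_square_integrable[of t i] component_integrable[of t i] by (simp add: power2_diff)
  have i: "integrable M (\<lambda>\<omega>. (X s \<omega> $ i - \<mu> $ i)\<^sup>2 + (X t \<omega> $ j - \<mu> $ j)\<^sup>2)"
    by (intro Bochner_Integration.integrable_add c)
  show ?thesis
  proof (rule Bochner_Integration.integrable_bound[OF i])
    have "\<bar>x * y\<bar> \<le> \<bar>x\<^sup>2 + y\<^sup>2\<bar>" for x y :: real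
      by (rule order_trans[OF abs_mult_le_squares abs_ge_self])
    then show "AE \<omega> in M. norm ((X s \<omega> $ i - \<mu> $ i) * (X t \<omega> $ j - \<mu> $ j))
        \<le> norm ((X s \<omega> $ i - \<mu> $ i)\<^sup>2 + (X t \<omega> $ j - \<mu> $ j)\<^sup>2)"
      by (intro AE_I2) (simp only: real_norm_def)
  qed measurable
qed

lemma cov_eq: "cov M (\<lambda>\<omega>. X s \<omega> $ i) (\<lambda>\<omega>. X t \<omega> $ j)
    = expectation (\<lambda>\<omega>. (X s \<omega> $ i - \<mu> $ i) * (X t \<omega> $ j - \<mu> $ j))"
  by (simp add: cov_def component_expectation)

lemma proj_product: "proj u s \<omega> * proj u t \<omega>
    = (\<Sum>i\<in>UNIV. \<Sum>j\<in>UNIV. u $ i * u $ j * ((X s \<omega> $ i - \<mu> $ i) * (X t \<omega> $ j - \<mu> $ j)))"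
  unfolding proj_def inner_vec_def sum_product by (simp add: mult_ac)

lemma proj_covariance: "expectation (\<lambda>\<omega>. proj u s \<omega> * proj u t \<omega>)
    = (\<Sum>i\<in>UNIV. \<Sum>j\<in>UNIV. u $ i * u $ j * cov M (\<lambda>\<omega>. X s \<omega> $ i) (\<lambda>\<omega>. X t \<omega> $ j))"
  unfolding proj_product using centered_product_integrable by (simp add: cov_eq)

lemma cov_shift: "cov M (\<lambda>\<omega>. X (s + h) \<omega> $ i) (\<lambda>\<omega>. X (t + h) \<omega> $ j) = cov M (\<lambda>\<omega>. X s \<omega> $ i) (\<lambda>\<omega>. X t \<omega> $ j)"
proof -
  have "(\<lambda>x. (x s $ i - \<mu> $ i) * (x t $ j - \<mu> $ j)) \<in> borel_measurable (Pi\<^sub>M {s, t} (\<lambda>_. borel :: (real ^ 's) measure))"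
    by measurable
  from stationary_expectation(1)[OF stationary X_measurable _ this, of h]
  show ?thesis by (simp add: cov_eq)
qed

lemma cov_measurable [measurable]: "(\<lambda>t. cov M (\<lambda>\<omega>. X 0 \<omega> $ i) (\<lambda>\<omega>. X t \<omega> $ j)) \<in> borel_measurable borel"
  unfolding cov_eq by measurable

definition proj_cov :: "real ^ 's \<Rightarrow> real ^ 'd \<Rightarrow> real" where
  "proj_cov u t = expectation (\<lambda>\<omega>. proj u 0 \<omega> * proj u t \<omega>)"

lemma cov_integrable': "integrable lborel (\<lambda>t. cov M (\<lambda>\<omega>. X 0 \<omega> $ i) (\<lambda>\<omega>. X t \<omega> $ j))"
  using cov_integrable[of i j] by (subst (asm) integrable_abs_iff) auto

lemma proj_cov_integrable: "integrable lborel (proj_cov u)"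
  unfolding proj_cov_def[abs_def] proj_covariance using cov_integrable' by simp

lemma proj_cov_integral: "(LBINT t. proj_cov u t) = u \<bullet> (\<Sigma> *v u)"
proof -
  have "(LBINT t. proj_cov u t) = (\<Sum>i\<in>UNIV. \<Sum>j\<in>UNIV. u $ i * u $ j * \<Sigma> $ i $ j)"
    unfolding proj_cov_def proj_covariance using cov_integrable' by (simp add: \<Sigma>_def)
  also have "\<dots> = u \<bullet> (\<Sigma> *v u)"
    by (simp add: inner_vec_def matrix_vector_mult_def sum_distrib_left mult_ac)
  finally show ?thesis .
qed

text \<open>
  Stationarity gives \<open>Cov(X\<^sub>j(0), X\<^sub>i(-t)) = Cov(X\<^sub>i(0), X\<^sub>j(t))\<close>, and Lebesgue measure is invariant under
  the reflection \<open>t \<mapsto> - t\<close>.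
\<close>

lemma \<Sigma>_symmetric: "transpose \<Sigma> = \<Sigma>"
proof -
  have "\<Sigma> $ j $ i = \<Sigma> $ i $ j" for i j
  proof -
    have "cov M (\<lambda>\<omega>. X 0 \<omega> $ j) (\<lambda>\<omega>. X (- t) \<omega> $ i) = cov M (\<lambda>\<omega>. X 0 \<omega> $ i) (\<lambda>\<omega>. X t \<omega> $ j)" for t
      using cov_shift[of 0 t j "- t" i] by (simp add: cov_eq mult.commute)
    then show ?thesis
      using integral_lborel_uminus[OF cov_measurable[of j i]] by (simp add: \<Sigma>_def)
  qed
  then show ?thesis by (simp add: transpose_def vec_eq_iff)
qed

abbreviation proj_rate :: "real ^ 's \<Rightarrow> nat \<Rightarrow> real" where
  "proj_rate u \<equiv> \<lambda>r. 4 * ((l1_norm u)\<^sup>2 * \<theta> r)"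

text \<open>
  The factor 4 in the rate comes from the four covariances of sines and cosines that make up a
  covariance of complex exponentials.
\<close>

lemma mixing_field_proj:
  "mixing_field M (proj u) (proj_cov u) (proj_rate u)"
proof
  show "(\<lambda>(\<omega>, t). proj u t \<omega>) \<in> borel_measurable (M \<Otimes>\<^sub>M borel)" by measurable
  show "integrable M (\<lambda>\<omega>. (proj u t \<omega>)\<^sup>2)" for t
    unfolding power2_eq_square proj_product using centered_product_integrable by simp
  show "expectation (proj u t) = 0" for t
    unfolding proj_def[abs_def] inner_vec_def
    using component_integrable by (simp add: component_expectation prob_space)
  show "expectation (\<lambda>\<omega>. proj u s \<omega> * proj u t \<omega>) = proj_cov u (t - s)" for s t
    unfolding proj_cov_def proj_covariance using cov_shift[of 0 s _ "t - s"] by simp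
  show "integrable lborel (proj_cov u)" by (rule proj_cov_integrable)
  show "expectation (\<lambda>\<omega>. \<bar>proj u (s + t) \<omega> - proj u s \<omega>\<bar>) = expectation (\<lambda>\<omega>. \<bar>proj u t \<omega> - proj u 0 \<omega>\<bar>)" for s t
  proof -
    have "(\<lambda>x. \<bar>u \<bullet> (x t - \<mu>) - u \<bullet> (x 0 - \<mu>)\<bar>) \<in> borel_measurable (Pi\<^sub>M {0, t} (\<lambda>_. borel :: (real ^ 's) measure))"
      by measurable
    from stationary_expectation(1)[OF stationary X_measurable _ this, of s]
    show ?thesis by (simp add: proj_def add.commute)
  qed
  show "cf (\<lambda>\<omega>. a * (\<Sum>t\<in>I. proj u (t + h) \<omega>)) = cf (\<lambda>\<omega>. a * (\<Sum>t\<in>I. proj u t \<omega>))"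
    if "finite I" for I h a
  proof -
    have "(\<lambda>x. iexp (a * (\<Sum>t\<in>I. u \<bullet> (x t - \<mu>)))) \<in> borel_measurable (Pi\<^sub>M I (\<lambda>_. borel :: (real ^ 's) measure))"
      by measurable
    from stationary_expectation(1)[OF stationary X_measurable that this, of h]
    show ?thesis by (simp add: proj_def)
  qed
  show "cmod (cf (\<lambda>\<omega>. a * ((\<Sum>t\<in>I. proj u t \<omega>) + (\<Sum>t\<in>J. proj u t \<omega>)))
             - cf (\<lambda>\<omega>. a * (\<Sum>t\<in>I. proj u t \<omega>)) * cf (\<lambda>\<omega>. a * (\<Sum>t\<in>J. proj u t \<omega>)))
           \<le> real (card I) * a\<^sup>2 * real m ^ CARD('d) * (4 * ((l1_norm u)\<^sup>2 * \<theta> r))"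
    if r: "1 \<le> r" and m: "1 < m" and IJ: "finite I" "finite J" "I \<noteq> {}" "J \<noteq> {}"
         "I \<subseteq> grid (real m)" "J \<subseteq> grid (real m)" "I \<inter> J = {}" "real r \<le> l1_setdist I J"
    for r m I J a
  proof -
    let ?A = "\<lambda>\<omega>. a * (\<Sum>t\<in>I. proj u t \<omega>)" and ?B = "\<lambda>\<omega>. a * (\<Sum>t\<in>J. proj u t \<omega>)"
    let ?D = "real (card I) * a\<^sup>2 * real m ^ CARD('d) * ((l1_norm u)\<^sup>2 * \<theta> r)"
    have one: "cov M (\<lambda>\<omega>. F (?A \<omega>)) (\<lambda>\<omega>. G (?B \<omega>)) \<le> ?D"
      if "\<And>x. \<bar>F x\<bar> \<le> 1" "\<And>x y. \<bar>F x - F y\<bar> \<le> \<bar>x - y\<bar>" "\<And>x. \<bar>G x\<bar> \<le> 1" "\<And>x y. \<bar>G x - G y\<bar> \<le> \<bar>x - y\<bar>"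
      for F G :: "real \<Rightarrow> real"
      unfolding proj_def using m by (intro BL_dependent_linear[OF BL rate_nonneg[OF r] r _ IJ that]) simp
    have trig: "\<bar>F x\<bar> \<le> 1 \<and> \<bar>F x - F y\<bar> \<le> \<bar>x - y\<bar>" if "F \<in> {cos, sin}" for F :: "real \<Rightarrow> real" and x y
    proof -
      have "iexp x - iexp y = Complex (cos x - cos y) (sin x - sin y)"
        by (simp add: complex_eq_iff Re_exp Im_exp)
      then have "\<bar>cos x - cos y\<bar> \<le> \<bar>x - y\<bar>" "\<bar>sin x - sin y\<bar> \<le> \<bar>x - y\<bar>"
        using iexp_diff_le[of x y] abs_Re_le_cmod[of "iexp x - iexp y"] abs_Im_le_cmod[of "iexp x - iexp y"]
        by auto
      then show ?thesis using that by auto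
    qed
    have bnd: "\<bar>cov M (\<lambda>\<omega>. F (?A \<omega>)) (\<lambda>\<omega>. G (?B \<omega>))\<bar> \<le> ?D" if FG: "F \<in> {cos, sin}" "G \<in> {cos, sin}" for F G
    proof -
      have "cov M (\<lambda>\<omega>. F (?A \<omega>)) (\<lambda>\<omega>. G (?B \<omega>)) \<le> ?D"
        using trig[OF FG(1)] trig[OF FG(2)] by (intro one) blast+
      moreover have "cov M (\<lambda>\<omega>. - F (?A \<omega>)) (\<lambda>\<omega>. G (?B \<omega>)) \<le> ?D"
      proof (rule one)
        show "\<bar>- F x - - F y\<bar> \<le> \<bar>x - y\<bar>" for x y using trig[OF FG(1), of x y] by linarith
      qed (use trig[OF FG(1)] trig[OF FG(2)] in auto)
      moreover have "cov M (\<lambda>\<omega>. - F (?A \<omega>)) (\<lambda>\<omega>. G (?B \<omega>)) = - cov M (\<lambda>\<omega>. F (?A \<omega>)) (\<lambda>\<omega>. G (?B \<omega>))"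
      proof -
        have neg: "cov M (\<lambda>\<omega>. - U \<omega>) V = - cov M U V" for U V :: "'a \<Rightarrow> real"
        proof -
          have "(- U \<omega> - (\<integral>\<omega>. - U \<omega> \<partial>M)) * v = - ((U \<omega> - (\<integral>\<omega>. U \<omega> \<partial>M)) * v)" for \<omega> v
            by (simp add: algebra_simps)
          then show ?thesis unfolding cov_def by (simp only: integral_minus)
        qed
        show ?thesis by (rule neg[of "\<lambda>\<omega>. F (?A \<omega>)" "\<lambda>\<omega>. G (?B \<omega>)"])
      qed
      ultimately show ?thesis by linarith
    qed
    have AB: "?A \<in> borel_measurable M" "?B \<in> borel_measurable M" by measurable
    have "cmod (cf (\<lambda>\<omega>. ?A \<omega> + ?B \<omega>) - cf (\<lambda>\<omega>. ?A \<omega>) * cf (\<lambda>\<omega>. ?B \<omega>))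
        \<le> 4 * ?D"
      by (rule char_mixing_of_cov[OF AB bnd])
    moreover have "4 * ?D = real (card I) * a\<^sup>2 * real m ^ CARD('d) * (4 * ((l1_norm u)\<^sup>2 * \<theta> r))" by simp
    ultimately show ?thesis by (simp only: distrib_left[of a])
  qed
  show "0 \<le> 4 * ((l1_norm u)\<^sup>2 * \<theta> r)" if "1 \<le> r" for r
    using rate_nonneg[OF that] by simp
  show "(proj_rate u) \<longlonglongrightarrow> 0"
    using tendsto_mult_right_zero[OF rate_lim, of "4 * (l1_norm u)\<^sup>2"] by (simp add: mult.assoc)
qed

lemma \<Sigma>_psd: "0 \<le> u \<bullet> (\<Sigma> *v u)"
proof -
  interpret m: mixing_field M "proj u" "proj_cov u" "proj_rate u"
    by (rule mixing_field_proj)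
  show ?thesis
    unfolding proj_cov_integral[symmetric]
    by (rule LIMSEQ_le_const[OF m.smear_cube_variance_limit]) (auto intro!: divide_nonneg_nonneg)
qed

definition normalized :: "(real ^ 'd) set \<Rightarrow> 'a \<Rightarrow> real ^ 's" where
  "normalized W \<omega> = (\<chi> i. ((LINT t:W|lborel. X t \<omega> $ i)
      - (\<integral>\<omega>'. X 0 \<omega>' $ i \<partial>M) * measure lborel W) / sqrt (measure lborel W))"

lemma normalized_measurable [measurable]:
  assumes [measurable]: "W \<in> sets borel"
  shows "normalized W \<in> borel_measurable M"
proof -
  have "(\<lambda>\<omega>. normalized W \<omega> $ i) \<in> borel_measurable M" for i
    unfolding normalized_def vec_lambda_beta set_lebesgue_integral_def by measurable
  then show ?thesis by (rule borel_measurable_vecI)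
qed

text \<open>
  The identity holds only almost surely: subtracting \<open>\<mu>\<close> under the integral requires every component of
  the path to be integrable on \<open>W\<close>.
\<close>

lemma inner_normalized:
  assumes W: "compact W"
  shows "AE \<omega> in M. u \<bullet> normalized W \<omega> = 1 / sqrt (measure lborel W) * L2_field.smear (proj u) (indicator W) \<omega>"
proof -
  have fW: "W \<in> fmeasurable lborel" by (rule fmeasurable_compact[OF W])
  have iW: "integrable lborel (indicat_real W)"
    by (rule integrable_indicator_fmeasurable[OF fW])
  have "AE \<omega> in M. \<forall>i\<in>UNIV. integrable lborel (\<lambda>t. indicator W t * proj (axis i 1) t \<omega>)"
  proof -
    have "AE \<omega> in M. integrable lborel (\<lambda>t. indicator W t * proj (axis i 1) t \<omega>)" for i
    proof -
      interpret m: mixing_field M "proj (axis i 1)" "proj_cov (axis i 1)" "proj_rate (axis i 1)"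
        by (rule mixing_field_proj)
      show ?thesis by (rule m.smear_integrable(1)[OF iW])
    qed
    then show ?thesis by (subst AE_finite_all) auto
  qed
  then show ?thesis
  proof eventually_elim
    case (elim \<omega>)
    interpret m: mixing_field M "proj u" "proj_cov u" "proj_rate u"
      by (rule mixing_field_proj)
    have p: "proj (axis i 1) t \<omega> = X t \<omega> $ i - \<mu> $ i" for i t
      by (simp add: proj_def inner_axis')
    have i1: "integrable lborel (\<lambda>t. indicator W t * (X t \<omega> $ i - \<mu> $ i))" for i
      using elim by (simp add: p)
    have "integrable lborel (\<lambda>t. indicator W t * (X t \<omega> $ i - \<mu> $ i) + indicator W t * \<mu> $ i)" for i
      by (intro Bochner_Integration.integrable_add i1 integrable_mult_left iW)
    then have i2: "integrable lborel (\<lambda>t. indicator W t * X t \<omega> $ i)" for i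
      by (simp add: algebra_simps)
    have comp: "(LINT t:W|lborel. X t \<omega> $ i) - \<mu> $ i * measure lborel W
        = (LBINT t. indicator W t * (X t \<omega> $ i - \<mu> $ i))" for i
    proof -
      have "(LBINT t. indicator W t * (X t \<omega> $ i - \<mu> $ i))
          = (LBINT t. indicator W t * X t \<omega> $ i - indicator W t * \<mu> $ i)"
        by (simp add: right_diff_distrib)
      also have "\<dots> = (LBINT t. indicator W t * X t \<omega> $ i) - (LBINT t. indicator W t * \<mu> $ i)"
        by (intro Bochner_Integration.integral_diff i2 integrable_mult_left iW)
      finally show ?thesis by (simp add: set_lebesgue_integral_def mult.commute)
    qed
    have "m.smear (indicator W) \<omega> = (LBINT t. (\<Sum>i\<in>UNIV. u $ i * (indicator W t * (X t \<omega> $ i - \<mu> $ i))))"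
      by (simp add: m.smear_def proj_def inner_vec_def sum_distrib_left mult_ac)
    also have "\<dots> = (\<Sum>i\<in>UNIV. u $ i * (LBINT t. indicator W t * (X t \<omega> $ i - \<mu> $ i)))"
      using i1 by simp
    also have "\<dots> = (\<Sum>i\<in>UNIV. u $ i * ((LINT t:W|lborel. X t \<omega> $ i) - \<mu> $ i * measure lborel W))"
      by (simp add: comp)
    finally show ?case
      by (simp add: normalized_def inner_vec_def \<mu>_def sum_distrib_left)
  qed
qed

lemma normalized_component_square:
  assumes W: "compact W" "0 < measure lborel W"
  shows "integrable M (\<lambda>\<omega>. (normalized W \<omega> $ i)\<^sup>2)"
    and "expectation (\<lambda>\<omega>. (normalized W \<omega> $ i)\<^sup>2) \<le> (LBINT t. \<bar>proj_cov (axis i 1) t\<bar>)"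
proof -
  let ?u = "axis i 1 :: real ^ 's" and ?L = "measure lborel W"
  interpret m: mixing_field M "proj ?u" "proj_cov ?u" "proj_rate ?u"
    by (rule mixing_field_proj)
  have [measurable]: "W \<in> sets borel" using W(1) by (rule borel_compact)
  have fW: "W \<in> fmeasurable lborel" by (rule fmeasurable_compact[OF W(1)])
  have iW: "integrable lborel (indicat_real W)"
    by (rule integrable_indicator_fmeasurable[OF fW])
  have ae: "AE \<omega> in M. (normalized W \<omega> $ i)\<^sup>2 = 1 / ?L * (m.smear (indicator W) \<omega>)\<^sup>2"
    using inner_normalized[OF W(1), of ?u]
    by eventually_elim (use W(2) in \<open>simp add: inner_axis' power_mult_distrib power_divide\<close>)
  have s: "integrable M (\<lambda>\<omega>. 1 / ?L * (m.smear (indicator W) \<omega>)\<^sup>2)"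
    by (intro integrable_mult_right m.smear_square_integrable iW)
  have sm: "m.smear (indicator W) \<in> borel_measurable M"
    using m.smear_integrable(2)[OF iW] by auto
  note [measurable] = sm
  show "integrable M (\<lambda>\<omega>. (normalized W \<omega> $ i)\<^sup>2)"
  proof (rule integrable_cong_AE_imp[OF s])
    show "(\<lambda>\<omega>. (normalized W \<omega> $ i)\<^sup>2) \<in> borel_measurable M" by measurable
    show "AE \<omega> in M. 1 / ?L * (m.smear (indicator W) \<omega>)\<^sup>2 = (normalized W \<omega> $ i)\<^sup>2"
      using ae by eventually_elim (rule sym)
  qed
  have "expectation (\<lambda>\<omega>. (normalized W \<omega> $ i)\<^sup>2) = expectation (\<lambda>\<omega>. 1 / ?L * (m.smear (indicator W) \<omega>)\<^sup>2)"
    by (rule integral_cong_AE[OF _ _ ae]) measurable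
  also have "\<dots> = 1 / ?L * expectation (\<lambda>\<omega>. (m.smear (indicator W) \<omega>)\<^sup>2)" by simp
  also have "\<dots> \<le> 1 / ?L * ((LBINT t. \<bar>proj_cov ?u t\<bar>) * (LBINT t. \<bar>indicat_real W t\<bar>))"
    using W(2) by (intro mult_left_mono m.smear_second_moment_le iW) (auto simp: indicator_def)
  also have "\<dots> = (LBINT t. \<bar>proj_cov ?u t\<bar>)"
    using W(2) by simp
  finally show "expectation (\<lambda>\<omega>. (normalized W \<omega> $ i)\<^sup>2) \<le> (LBINT t. \<bar>proj_cov ?u t\<bar>)" .
qed

text \<open>
  The second moments of the components are bounded by the \<open>L\<^sup>1\<close>-norms of their covariance functions,
  uniformly in \<open>W\<close>; then Markov's inequality applies to the squared norm.
\<close>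

lemma normalized_tight:
  assumes "0 < e"
  obtains R where "\<And>W. compact W \<Longrightarrow> 0 < measure lborel W \<Longrightarrow>
    prob {\<omega> \<in> space M. R < norm (normalized W \<omega>)} \<le> e"
proof -
  define C where "C = (\<Sum>i\<in>UNIV. LBINT t. \<bar>proj_cov (axis i 1) t\<bar>)"
  have C: "0 \<le> C" by (simp add: C_def sum_nonneg)
  define R where "R = sqrt ((C + 1) / e)"
  have R: "0 < R" "R\<^sup>2 = (C + 1) / e" using C assms by (auto simp: R_def)
  have "prob {\<omega> \<in> space M. R < norm (normalized W \<omega>)} \<le> e" if W: "compact W" "0 < measure lborel W" for W
  proof -
    have [measurable]: "W \<in> sets borel" using W(1) by (rule borel_compact)
    have sq: "(norm x)\<^sup>2 = (\<Sum>i\<in>UNIV. (x $ i)\<^sup>2)" for x :: "real ^ 's"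
      unfolding power2_norm_eq_inner inner_vec_def by (simp add: power2_eq_square)
    have i: "integrable M (\<lambda>\<omega>. (norm (normalized W \<omega>))\<^sup>2)"
      unfolding sq using normalized_component_square(1)[OF W] by simp
    have "prob {\<omega> \<in> space M. R < norm (normalized W \<omega>)} \<le> prob {\<omega> \<in> space M. R\<^sup>2 \<le> (norm (normalized W \<omega>))\<^sup>2}"
      using R(1) by (intro finite_measure_mono) (auto intro: power_mono)
    also have "\<dots> \<le> expectation (\<lambda>\<omega>. (norm (normalized W \<omega>))\<^sup>2) / R\<^sup>2"
      using R(1) by (intro integral_Markov_inequality_measure[OF i, of "{}"]) auto
    also have "\<dots> \<le> C / R\<^sup>2"
      unfolding sq C_def using normalized_component_square[OF W] by (intro divide_right_mono) (auto intro!: sum_mono)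
    also have "\<dots> \<le> e" using C assms by (simp add: R(2) field_simps)
    finally show ?thesis .
  qed
  then show thesis by (rule that)
qed

lemma normalized_char_limit:
  assumes W: "VH_growing W"
  shows "(\<lambda>n. cf (\<lambda>\<omega>. u \<bullet> normalized (W n) \<omega>))
    \<longlonglongrightarrow> exp (- complex_of_real (u \<bullet> (\<Sigma> *v u)) / 2)"
proof -
  interpret m: mixing_field M "proj u" "proj_cov u" "proj_rate u"
    by (rule mixing_field_proj)
  have "cf (\<lambda>\<omega>. u \<bullet> normalized (W n) \<omega>)
      = cf (\<lambda>\<omega>. 1 / sqrt (measure lborel (W n)) * m.smear (indicator (W n)) \<omega>)" for n
  proof -
    have cW: "compact (W n)" by (rule VH_growing_windows[OF W])
    have [measurable]: "W n \<in> sets borel" using cW by (rule borel_compact)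
    have iW: "integrable lborel (indicat_real (W n))"
      by (rule integrable_indicator_fmeasurable[OF fmeasurable_compact[OF cW]])
    have [measurable]: "m.smear (indicator (W n)) \<in> borel_measurable M"
      using m.smear_integrable(2)[OF iW] by auto
    show ?thesis
      using inner_normalized[OF cW, of u] by (intro integral_cong_AE) auto
  qed
  then show ?thesis using m.window_char_limit[OF W] by (simp only: proj_cov_integral)
qed

theorem central_limit:
  assumes W: "VH_growing W"
  shows "\<exists>N. is_centered_normal \<Sigma> N \<and> conv_in_distribution M (\<lambda>n. normalized (W n)) N"
proof -
  note cW = VH_growing_windows[OF W]
  have mY: "normalized (W n) \<in> borel_measurable M" for n
    by (rule normalized_measurable) (rule borel_compact[OF cW(1)])
  obtain A :: "real ^ 's ^ 's" where A: "A ** transpose A = \<Sigma>"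
    using psd_matrix_factor[OF \<Sigma>_symmetric \<Sigma>_psd] by blast
  let ?P = "Pi\<^sub>M UNIV (\<lambda>_ :: 's. std_normal_distribution)"
  define T :: "('s \<Rightarrow> real) \<Rightarrow> real ^ 's" where "T z = A *v (\<chi> i. z i)" for z
  define N where "N = distr ?P borel T"
  interpret P: product_prob_space "\<lambda>_ :: 's. std_normal_distribution" UNIV
    by (intro product_prob_spaceI) (simp add: prob_space_normal_density)
  have T [measurable]: "T \<in> borel_measurable ?P"
  proof -
    have "(\<lambda>z. T z $ i) \<in> borel_measurable ?P" for i
      unfolding T_def matrix_vector_mult_def vec_lambda_beta by measurable
    then show ?thesis by (rule borel_measurable_vecI)
  qed
  have N: "prob_space N" "sets N = sets borel"
    unfolding N_def using P.prob_space_axioms T by (auto intro: prob_space.prob_space_distr)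
  have charN: "(\<integral>x. iexp (u \<bullet> x) \<partial>N) = exp (- complex_of_real (u \<bullet> (\<Sigma> *v u)) / 2)" for u
  proof -
    have "(\<integral>x. iexp (u \<bullet> x) \<partial>N) = (\<integral>z. iexp (u \<bullet> T z) \<partial>?P)"
      unfolding N_def by (rule integral_distr[OF T]) measurable
    then show ?thesis by (simp only: T_def char_linear_image_std_normal A)
  qed
  have "is_centered_normal \<Sigma> N"
    unfolding is_centered_normal_def N_def T_def using A by blast
  moreover have "conv_in_distribution M (\<lambda>n. normalized (W n)) N"
    unfolding conv_in_distribution_def
  proof (intro conjI allI impI mY)
    fix f :: "real ^ 's \<Rightarrow> real" assume f: "continuous_on UNIV f" "bounded (range f)"
    show "(\<lambda>n. \<integral>\<omega>. f (normalized (W n) \<omega>) \<partial>M) \<longlonglongrightarrow> (\<integral>x. f x \<partial>N)"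
    proof (rule levy_continuity_vec[OF prob_space_axioms N mY _ _ f])
      show "(\<lambda>n. \<integral>\<omega>. iexp (u \<bullet> normalized (W n) \<omega>) \<partial>M) \<longlonglongrightarrow> (\<integral>x. iexp (u \<bullet> x) \<partial>N)" for u
        unfolding charN by (rule normalized_char_limit[OF W])
      show "\<exists>R. \<forall>n. measure M {\<omega> \<in> space M. R < norm (normalized (W n) \<omega>)} \<le> e" if "0 < e" for e
        using normalized_tight[OF that] cW by metis
    qed
  qed
  ultimately show ?thesis by blast
qed

end

theorem theorem10:
  fixes M :: "'a measure"
    and X :: "real ^ 'd \<Rightarrow> 'a \<Rightarrow> real ^ 's"
    and \<theta> :: "nat \<Rightarrow> real"
    and W :: "nat \<Rightarrow> (real ^ 'd) set"
  assumes "prob_space M"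
    and "\<And>t. X t \<in> borel_measurable M"
    and "antimono_on {1..} \<theta>"
    and "\<theta> \<longlonglongrightarrow> 0"
    and "stationary_field M X"
    and "measurable_field M X"
    and "BL_dependent M \<theta> X"
    and "\<And>i. integrable M (\<lambda>\<omega>. (X 0 \<omega> $ i)\<^sup>2)"
    and "\<And>i j. integrable lborel (\<lambda>t. \<bar>cov M (\<lambda>\<omega>. X 0 \<omega> $ i) (\<lambda>\<omega>. X t \<omega> $ j)\<bar>)"
    and "VH_growing W"
  shows "\<exists>N. is_centered_normal
               (\<chi> i j. \<integral>t. cov M (\<lambda>\<omega>. X 0 \<omega> $ i) (\<lambda>\<omega>. X t \<omega> $ j) \<partial>lborel) N \<and>
             conv_in_distribution M
               (\<lambda>n \<omega>. \<chi> i. ((LINT t:W n|lborel. X t \<omega> $ i)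
                              - (\<integral>\<omega>'. X 0 \<omega>' $ i \<partial>M) * measure lborel (W n))
                            / sqrt (measure lborel (W n))) N"
proof -
  interpret BL_field M X \<theta>
    using assms by (intro BL_field.intro BL_field_axioms.intro)
  show ?thesis
    using central_limit[OF assms(10)] unfolding \<Sigma>_def normalized_def[abs_def] .
qed

end
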